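(* Let $(\mathcal{R},\partial)$ be a commutative differential ring with ring of constants $\mathcal{C}$ and a quasi-integration $\mathrm{Q}$, and let $\mathcal{T}$, $\mathcal{C}_1$, $\mathcal{C}_2$ and $\mathrm{IDR}(\mathcal{R})$ be as defined in the context. If $B$ is a $\mathcal{C}$-algebra basis of the shuffle algebra $(\mathcal{T},+,\sqcup\!\sqcup)$ consisting of homogeneous elements, then $\{1\otimes1\otimes1\otimes b\mid b\in B\}$ is an $\mathcal{R}\otimes\mathcal{C}_1\otimes\mathcal{C}_2\otimes\mathcal{C}1_{\mathcal{T}}$-algebra basis of $\mathrm{IDR}(\mathcal{R})$.
   Context: Rings and algebras have a unit. A differential ring is a ring with an additive map $\partial$ satisfying the Leibniz rule; its ring of constants is $\ker\partial$. An algebra basis of a commutative algebra over a commutative ring is an algebraically independent generating set (i.e. the algebra is freely generated by it as a commutative algebra). Setting: $(\mathcal{R},\partial)$ is a commutative differential ring, $\mathcal{C}=\ker\partial$, and all tensor and symmetric products are over $\mathcal{C}$. A quasi-integration is a $\mathcal{C}$-linear $\mathrm{Q}:\mathcal{R}\to\mathcal{R}$ with $\partial\mathrm{Q}\partial=\partial$ and $\mathrm{Q}\partial\mathrm{Q}=\mathrm{Q}$; one such $\mathrm{Q}$ is fixed. Put $\mathcal{R}_{\mathrm{J}}=\mathrm{Q}\mathcal{R}$ and $\mathcal{R}_{\mathrm{T}}=\ker\mathrm{Q}$. Tensors: $\mathcal{T}=\bigoplus_{n\ge0}\mathcal{R}_{\mathrm{T}}^{\otimes n}$ with empty tensor $1_{\mathcal{T}}$;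 $\widetilde{\mathcal{T}}=\bigoplus_{n\ge1}\mathcal{R}_{\mathrm{T}}^{\otimes n}$. An element of $\mathcal{T}$ is homogeneous if it lies in some $\mathcal{R}_{\mathrm{T}}^{\otimes n}$. The shuffle product $\sqcup\!\sqcup$ on $\mathcal{T}$ is the $\mathcal{C}$-bilinear product with $t\sqcup\!\sqcup s=t\otimes s$ if $t$ or $s$ has length $0$ and $t\sqcup\!\sqcup s=t_1\otimes((t_2\otimes\dots\otimes t_n)\sqcup\!\sqcup s)+s_1\otimes(t\sqcup\!\sqcup(s_2\otimes\dots\otimes s_m))$ for pure tensors of lengths $n,m\ge1$. For a pure tensor $f=f_1\otimes\dots\otimes f_n$, $f_i^j:=f_i\otimes\dots\otimes f_j$, and $f_i^j=1_{\mathcal{T}}$ if $i=j+1$. Constants: $M_1=\mathcal{R}_{\mathrm{J}}\otimes\mathcal{T}$, $M_2=\widetilde{\mathcal{T}}^{\odot2}$ (symmetric square). $\varepsilon(M_1),\varepsilon(M_2)$ are isomorphic copies with isomorphisms $\varepsilon$. $\mathcal{C}_1=\mathrm{Sym}(\varepsilon(M_1))$ and $\mathcal{C}_2=\mathrm{Sym}(\varepsilon(M_2))/J_2$ (unital symmetric $\mathcal{C}$-algebras), where $J_2$ is the ideal generated by all $$\varepsilon((f\sqcup\!\sqcup g)\odot h)-\varepsilon(f\odot(g\sqcup\!\sqcup h))+\sum_{j=0}^{m-1}\Big(\sum_{i=\max(0,1-j)}^{n-1}\varepsilon(f_{i+1}^n\odot g_{j+1}^m)\cdot\varepsilon((f_1^i\sqcup\!\sqcup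 g_1^j)\odot h)-\sum_{k=\max(0,1-j)}^{l-1}\varepsilon(f\odot(g_1^j\sqcup\!\sqcup h_1^k))\cdot\varepsilon(g_{j+1}^m\odot h_{k+1}^l)\Big)$$ for $n,m,l\ge1$ and pure tensors $f\in\mathcal{R}_{\mathrm{T}}^{\otimes n}$, $g\in\mathcal{R}_{\mathrm{T}}^{\otimes m}$, $h\in\mathcal{R}_{\mathrm{T}}^{\otimes l}$. Elements $\varepsilon(\cdot)$ of $\mathcal{C}_2$ denote classes. Product on $\mathcal{C}_2\otimes\mathcal{T}$: the $\mathcal{C}$-bilinear map with, for $c,d\in\mathcal{C}_2$ and pure tensors $f,g$ of lengths $n,m\ge0$, $$(c\otimes f)\cdot(d\otimes g)=(c\cdot d)\otimes(f\sqcup\!\sqcup g)+\sum_{i=0}^{n-1}\sum_{j=0}^{m-1}\big(c\cdot d\cdot\varepsilon(f_{i+1}^n\odot g_{j+1}^m)\big)\otimes(f_1^i\sqcup\!\sqcup g_1^j);$$ this makes $\mathcal{C}_2\otimes\mathcal{T}$ a commutative $\mathcal{C}$-algebra with unit $1\otimes1_{\mathcal{T}}$. $\mathrm{IDR}(\mathcal{R}):=\mathcal{R}\otimes\mathcal{C}_1\otimes\mathcal{C}_2\otimes\mathcal{T}$ is the tensor product of the commutative $\mathcal{C}$-algebras $\mathcal{R}$, $\mathcal{C}_1$ and $\mathcal{C}_2\otimes\mathcal{T}$ (with the product just defined). *)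

theory Defs
  imports "HOL-Library.Multiset" "HOL-Algebra.Module" "HOL-Algebra.QuotRing"
begin

section \<open>Differential rings and quasi-integrations\<close>

locale differential_ring = cring R for R (structure) +
  fixes der :: "'a \<Rightarrow> 'a"
  assumes der_closed: "x \<in> carrier R \<Longrightarrow> der x \<in> carrier R"
    and der_add: "\<lbrakk>x \<in> carrier R; y \<in> carrier R\<rbrakk> \<Longrightarrow> der (x \<oplus> y) = der x \<oplus> der y"
    and der_mult: "\<lbrakk>x \<in> carrier R; y \<in> carrier R\<rbrakk> \<Longrightarrow> der (x \<otimes> y) = der x \<otimes> y \<oplus> x \<otimes> der y"

definition constants :: "('a, 'r) ring_scheme \<Rightarrow> ('a \<Rightarrow> 'a) \<Rightarrow> ('a, 'r) ring_scheme" where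
  "constants R der = R\<lparr>carrier := {c \<in> carrier R. der c = \<zero>\<^bsub>R\<^esub>}\<rparr>"

locale quasi_integration = differential_ring +
  fixes Q :: "'a \<Rightarrow> 'a"
  assumes Q_closed: "x \<in> carrier R \<Longrightarrow> Q x \<in> carrier R"
    and Q_add: "\<lbrakk>x \<in> carrier R; y \<in> carrier R\<rbrakk> \<Longrightarrow> Q (x \<oplus> y) = Q x \<oplus> Q y"
    and Q_scale: "\<lbrakk>c \<in> carrier (constants R der); x \<in> carrier R\<rbrakk> \<Longrightarrow> Q (c \<otimes> x) = c \<otimes> Q x"
    and der_Q_der: "x \<in> carrier R \<Longrightarrow> der (Q (der x)) = der x"
    and Q_der_Q: "x \<in> carrier R \<Longrightarrow> Q (der (Q x)) = Q x"

text \<open>A ring acting on itself by multiplication; restricting the scalars to a subring or the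
  carrier to a submodule only changes the carriers.\<close>

definition self_algebra :: "('a, 'r) ring_scheme \<Rightarrow> ('a, 'a) module" where
  "self_algebra R = \<lparr>carrier = carrier R, mult = mult R, one = \<one>\<^bsub>R\<^esub>, zero = \<zero>\<^bsub>R\<^esub>, add = add R,
     smult = mult R\<rparr>"

definition R_J :: "('a, 'r) ring_scheme \<Rightarrow> ('a \<Rightarrow> 'a) \<Rightarrow> ('a, 'a) module" where
  "R_J R Q = (self_algebra R)\<lparr>carrier := Q ` carrier R\<rparr>"

definition R_T :: "('a, 'r) ring_scheme \<Rightarrow> ('a \<Rightarrow> 'a) \<Rightarrow> ('a, 'a) module" where
  "R_T R Q = (self_algebra R)\<lparr>carrier := {x \<in> carrier R. Q x = \<zero>\<^bsub>R\<^esub>}\<rparr>"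


section \<open>Algebra bases\<close>

text \<open>The elements are the finitely supported functions on \<open>X\<close>, extended by zero. The ring
  operations that come with the record type are irrelevant.\<close>

definition free_module :: "('a, 'k) ring_scheme \<Rightarrow> 'x set \<Rightarrow> ('a, 'x \<Rightarrow> 'a) module" where
  "free_module K X =
    \<lparr>carrier = {p. range p \<subseteq> carrier K \<and> finite {x. p x \<noteq> \<zero>\<^bsub>K\<^esub>} \<and> {x. p x \<noteq> \<zero>\<^bsub>K\<^esub>} \<subseteq> X},
     mult = undefined, one = undefined,
     zero = (\<lambda>x. \<zero>\<^bsub>K\<^esub>), add = (\<lambda>p q x. p x \<oplus>\<^bsub>K\<^esub> q x),
     smult = (\<lambda>c p x. c \<otimes>\<^bsub>K\<^esub> p x)\<rparr>"

definition unit_vec :: "('a, 'k) ring_scheme \<Rightarrow> 'x \<Rightarrow> 'x \<Rightarrow> 'a" where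
  "unit_vec K x = (\<lambda>y. if y = x then \<one>\<^bsub>K\<^esub> else \<zero>\<^bsub>K\<^esub>)"

text \<open>Polynomials over \<open>K\<close> in the variables \<open>B\<close>, as coefficient functions on the monomials, which
  are the multisets over \<open>B\<close>.\<close>

definition polynomials :: "('a, 'k) ring_scheme \<Rightarrow> 'b set \<Rightarrow> ('b multiset \<Rightarrow> 'a) set" where
  "polynomials K B = carrier (free_module K {m. set_mset m \<subseteq> B})"

definition poly_eval ::
  "('a, 'k) ring_scheme \<Rightarrow> ('a, 'b, 'z) module_scheme \<Rightarrow> ('b multiset \<Rightarrow> 'a) \<Rightarrow> 'b" where
  "poly_eval K A p =
     (\<Oplus>\<^bsub>A\<^esub>m\<in>{m. p m \<noteq> \<zero>\<^bsub>K\<^esub>}. p m \<odot>\<^bsub>A\<^esub> (\<Otimes>\<^bsub>A\<^esub>b\<in>set_mset m. b [^]\<^bsub>A\<^esub> count m b))"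

definition algebra_generators ::
  "('a, 'k) ring_scheme \<Rightarrow> ('a, 'b, 'z) module_scheme \<Rightarrow> 'b set \<Rightarrow> bool" where
  "algebra_generators K A B \<longleftrightarrow>
     B \<subseteq> carrier A \<and> (\<forall>x\<in>carrier A. \<exists>p\<in>polynomials K B. x = poly_eval K A p)"

definition algebraically_independent ::
  "('a, 'k) ring_scheme \<Rightarrow> ('a, 'b, 'z) module_scheme \<Rightarrow> 'b set \<Rightarrow> bool" where
  "algebraically_independent K A B \<longleftrightarrow>
     B \<subseteq> carrier A \<and> (\<forall>p\<in>polynomials K B. poly_eval K A p = \<zero>\<^bsub>A\<^esub> \<longrightarrow> p = (\<lambda>m. \<zero>\<^bsub>K\<^esub>))"

definition algebra_basis ::
  "('a, 'k) ring_scheme \<Rightarrow> ('a, 'b, 'z) module_scheme \<Rightarrow> 'b set \<Rightarrow> bool" where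
  "algebra_basis K A B \<longleftrightarrow>
     algebra K A \<and> algebra_generators K A B \<and> algebraically_independent K A B"


section \<open>Modules by generators and relations\<close>

definition mspan ::
  "('a, 'k) ring_scheme \<Rightarrow> ('a, 'b, 'z) module_scheme \<Rightarrow> 'b set \<Rightarrow> 'b set" where
  "mspan K M S = \<Inter>{N. submodule N K M \<and> S \<subseteq> N}"

text \<open>The quotient of a module by a submodule, or of an algebra by an ideal.\<close>

definition quot_algebra :: "('a, 'b, 'z) module_scheme \<Rightarrow> 'b set \<Rightarrow> ('a, 'b set) module" where
  "quot_algebra A I =
    \<lparr>carrier = carrier (A Quot I), mult = mult (A Quot I), one = one (A Quot I),
     zero = zero (A Quot I), add = add (A Quot I),
     smult = (\<lambda>c U. \<Union>x\<in>U. I +>\<^bsub>A\<^esub> (c \<odot>\<^bsub>A\<^esub> x))\<rparr>"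

definition pres_module ::
  "('a, 'k) ring_scheme \<Rightarrow> 'x set \<Rightarrow> ('x \<Rightarrow> 'a) set \<Rightarrow> ('a, ('x \<Rightarrow> 'a) set) module" where
  "pres_module K X S = quot_algebra (free_module K X) (mspan K (free_module K X) S)"

definition pres_gen ::
  "('a, 'k) ring_scheme \<Rightarrow> 'x set \<Rightarrow> ('x \<Rightarrow> 'a) set \<Rightarrow> 'x \<Rightarrow> ('x \<Rightarrow> 'a) set" where
  "pres_gen K X S x = mspan K (free_module K X) S +>\<^bsub>free_module K X\<^esub> unit_vec K x"

text \<open>The linear map from a module given by generators and relations to \<open>Z\<close> that sends the
  generator belonging to \<open>x\<close> to \<open>\<phi> x\<close>, for \<open>\<phi>\<close> compatible with the relations. Its argument \<open>U\<close> is
  a coset.\<close>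

definition pres_lift ::
  "('a, 'k) ring_scheme \<Rightarrow> ('a, 'b, 'z) module_scheme \<Rightarrow> ('x \<Rightarrow> 'b) \<Rightarrow> ('x \<Rightarrow> 'a) set \<Rightarrow> 'b" where
  "pres_lift K Z \<phi> U = the_elem ((\<lambda>p. \<Oplus>\<^bsub>Z\<^esub>x\<in>{x. p x \<noteq> \<zero>\<^bsub>K\<^esub>}. p x \<odot>\<^bsub>Z\<^esub> \<phi> x) ` U)"


section \<open>Tensor products\<close>

definition tensor_rels ::
  "('a, 'k) ring_scheme \<Rightarrow> ('a, 'm, 'y) module_scheme \<Rightarrow> ('a, 'n, 'z) module_scheme
    \<Rightarrow> ('m \<times> 'n \<Rightarrow> 'a) set" where
  "tensor_rels K M N = (let F = free_module K (carrier M \<times> carrier N); e = unit_vec K in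
     {e (x \<oplus>\<^bsub>M\<^esub> x', y) \<ominus>\<^bsub>F\<^esub> (e (x, y) \<oplus>\<^bsub>F\<^esub> e (x', y)) | x x' y.
        x \<in> carrier M \<and> x' \<in> carrier M \<and> y \<in> carrier N}
   \<union> {e (x, y \<oplus>\<^bsub>N\<^esub> y') \<ominus>\<^bsub>F\<^esub> (e (x, y) \<oplus>\<^bsub>F\<^esub> e (x, y')) | x y y'.
        x \<in> carrier M \<and> y \<in> carrier N \<and> y' \<in> carrier N}
   \<union> {e (c \<odot>\<^bsub>M\<^esub> x, y) \<ominus>\<^bsub>F\<^esub> c \<odot>\<^bsub>F\<^esub> e (x, y) | c x y.
        c \<in> carrier K \<and> x \<in> carrier M \<and> y \<in> carrier N}
   \<union> {e (x, c \<odot>\<^bsub>N\<^esub> y) \<ominus>\<^bsub>F\<^esub> c \<odot>\<^bsub>F\<^esub> e (x, y) | c x y.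
        c \<in> carrier K \<and> x \<in> carrier M \<and> y \<in> carrier N})"

definition tensor ::
  "('a, 'k) ring_scheme \<Rightarrow> ('a, 'm, 'y) module_scheme \<Rightarrow> ('a, 'n, 'z) module_scheme
    \<Rightarrow> ('a, ('m \<times> 'n \<Rightarrow> 'a) set) module" where
  "tensor K M N = pres_module K (carrier M \<times> carrier N) (tensor_rels K M N)"

definition tensor_elt ::
  "('a, 'k) ring_scheme \<Rightarrow> ('a, 'm, 'y) module_scheme \<Rightarrow> ('a, 'n, 'z) module_scheme
    \<Rightarrow> 'm \<Rightarrow> 'n \<Rightarrow> ('m \<times> 'n \<Rightarrow> 'a) set" where
  "tensor_elt K M N x y = pres_gen K (carrier M \<times> carrier N) (tensor_rels K M N) (x, y)"

definition tensor_algebra ::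
  "('a, 'k) ring_scheme \<Rightarrow> ('a, 'm, 'y) module_scheme \<Rightarrow> ('a, 'n, 'z) module_scheme
    \<Rightarrow> ('a, ('m \<times> 'n \<Rightarrow> 'a) set) module" where
  "tensor_algebra K A B = (tensor K A B)
    \<lparr>mult := (\<lambda>U V.
       pres_lift K (tensor K A B) (\<lambda>(a, b).
         pres_lift K (tensor K A B) (\<lambda>(a', b').
           tensor_elt K A B (a \<otimes>\<^bsub>A\<^esub> a') (b \<otimes>\<^bsub>B\<^esub> b')) V) U),
     one := tensor_elt K A B \<one>\<^bsub>A\<^esub> \<one>\<^bsub>B\<^esub>\<rparr>"


section \<open>Symmetric square and symmetric algebra\<close>

definition sym_square_rels ::
  "('a, 'k) ring_scheme \<Rightarrow> ('a, 'm, 'z) module_scheme \<Rightarrow> ('m \<times> 'm \<Rightarrow> 'a) set" where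
  "sym_square_rels K M = tensor_rels K M M \<union>
     {unit_vec K (x, y) \<ominus>\<^bsub>free_module K (carrier M \<times> carrier M)\<^esub> unit_vec K (y, x) | x y.
        x \<in> carrier M \<and> y \<in> carrier M}"

definition sym_square ::
  "('a, 'k) ring_scheme \<Rightarrow> ('a, 'm, 'z) module_scheme \<Rightarrow> ('a, ('m \<times> 'm \<Rightarrow> 'a) set) module" where
  "sym_square K M = pres_module K (carrier M \<times> carrier M) (sym_square_rels K M)"

definition sym_elt ::
  "('a, 'k) ring_scheme \<Rightarrow> ('a, 'm, 'z) module_scheme \<Rightarrow> 'm \<Rightarrow> 'm \<Rightarrow> ('m \<times> 'm \<Rightarrow> 'a) set" where
  "sym_elt K M x y = pres_gen K (carrier M \<times> carrier M) (sym_square_rels K M) (x, y)"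

text \<open>The sum of all symmetric powers of \<open>M\<close>: the multiset \<open>{#x\<^sub>1, \<dots>, x\<^sub>n#}\<close> stands for the
  product of the \<open>x\<^sub>i\<close> in the \<open>n\<close>-th power, and the relations say that it is linear in each
  factor.\<close>

definition sym_rels ::
  "('a, 'k) ring_scheme \<Rightarrow> ('a, 'm, 'z) module_scheme \<Rightarrow> ('m multiset \<Rightarrow> 'a) set" where
  "sym_rels K M = (let X = {m. set_mset m \<subseteq> carrier M}; F = free_module K X; e = unit_vec K in
     {e (add_mset (x \<oplus>\<^bsub>M\<^esub> y) m) \<ominus>\<^bsub>F\<^esub> (e (add_mset x m) \<oplus>\<^bsub>F\<^esub> e (add_mset y m)) | x y m.
        x \<in> carrier M \<and> y \<in> carrier M \<and> m \<in> X}
   \<union> {e (add_mset (c \<odot>\<^bsub>M\<^esub> x) m) \<ominus>\<^bsub>F\<^esub> c \<odot>\<^bsub>F\<^esub> e (add_mset x m) | c x m.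
        c \<in> carrier K \<and> x \<in> carrier M \<and> m \<in> X})"

definition sym_monom ::
  "('a, 'k) ring_scheme \<Rightarrow> ('a, 'm, 'z) module_scheme \<Rightarrow> 'm multiset \<Rightarrow> ('m multiset \<Rightarrow> 'a) set" where
  "sym_monom K M = pres_gen K {m. set_mset m \<subseteq> carrier M} (sym_rels K M)"

definition sym_module ::
  "('a, 'k) ring_scheme \<Rightarrow> ('a, 'm, 'z) module_scheme \<Rightarrow> ('a, ('m multiset \<Rightarrow> 'a) set) module" where
  "sym_module K M = pres_module K {m. set_mset m \<subseteq> carrier M} (sym_rels K M)"

definition sym_algebra ::
  "('a, 'k) ring_scheme \<Rightarrow> ('a, 'm, 'z) module_scheme \<Rightarrow> ('a, ('m multiset \<Rightarrow> 'a) set) module" where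
  "sym_algebra K M = (sym_module K M)
    \<lparr>mult := (\<lambda>U V.
       pres_lift K (sym_module K M) (\<lambda>m.
         pres_lift K (sym_module K M) (\<lambda>n. sym_monom K M (m + n)) V) U),
     one := sym_monom K M {#}\<rparr>"


section \<open>Tensors and the shuffle product\<close>

text \<open>The sum of all tensor powers of \<open>V\<close>, where the word \<open>[x\<^sub>1, \<dots>, x\<^sub>n]\<close> stands for the pure
  tensor of the \<open>x\<^sub>i\<close> in the \<open>n\<close>-th power. There is no relation on the empty word, so it spans a
  free module of rank one.\<close>

definition word_rels ::
  "('a, 'k) ring_scheme \<Rightarrow> ('a, 'v, 'z) module_scheme \<Rightarrow> ('v list \<Rightarrow> 'a) set" where
  "word_rels K V = (let W = lists (carrier V); F = free_module K W; e = unit_vec K in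
     {e (u @ (x \<oplus>\<^bsub>V\<^esub> y) # w) \<ominus>\<^bsub>F\<^esub> (e (u @ x # w) \<oplus>\<^bsub>F\<^esub> e (u @ y # w)) | u x y w.
        u \<in> W \<and> x \<in> carrier V \<and> y \<in> carrier V \<and> w \<in> W}
   \<union> {e (u @ (c \<odot>\<^bsub>V\<^esub> x) # w) \<ominus>\<^bsub>F\<^esub> c \<odot>\<^bsub>F\<^esub> e (u @ x # w) | c u x w.
        c \<in> carrier K \<and> u \<in> W \<and> x \<in> carrier V \<and> w \<in> W})"

definition tensors ::
  "('a, 'k) ring_scheme \<Rightarrow> ('a, 'v, 'z) module_scheme \<Rightarrow> ('a, ('v list \<Rightarrow> 'a) set) module" where
  "tensors K V = pres_module K (lists (carrier V)) (word_rels K V)"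

definition pure ::
  "('a, 'k) ring_scheme \<Rightarrow> ('a, 'v, 'z) module_scheme \<Rightarrow> 'v list \<Rightarrow> ('v list \<Rightarrow> 'a) set" where
  "pure K V = pres_gen K (lists (carrier V)) (word_rels K V)"

definition tensor_power ::
  "('a, 'k) ring_scheme \<Rightarrow> ('a, 'v, 'z) module_scheme \<Rightarrow> nat \<Rightarrow> ('v list \<Rightarrow> 'a) set set" where
  "tensor_power K V n = mspan K (tensors K V) {pure K V w | w. w \<in> lists (carrier V) \<and> length w = n}"

definition homogeneous ::
  "('a, 'k) ring_scheme \<Rightarrow> ('a, 'v, 'z) module_scheme \<Rightarrow> ('v list \<Rightarrow> 'a) set \<Rightarrow> bool" where
  "homogeneous K V t \<longleftrightarrow> (\<exists>n. t \<in> tensor_power K V n)"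

definition tensors_plus ::
  "('a, 'k) ring_scheme \<Rightarrow> ('a, 'v, 'z) module_scheme \<Rightarrow> ('a, ('v list \<Rightarrow> 'a) set) module" where
  "tensors_plus K V = (tensors K V)
     \<lparr>carrier := mspan K (tensors K V) (\<Union>n\<in>{1..}. tensor_power K V n)\<rparr>"

definition tensor_cons ::
  "('a, 'k) ring_scheme \<Rightarrow> ('a, 'v, 'z) module_scheme \<Rightarrow> 'v \<Rightarrow> ('v list \<Rightarrow> 'a) set
    \<Rightarrow> ('v list \<Rightarrow> 'a) set" where
  "tensor_cons K V x = pres_lift K (tensors K V) (\<lambda>w. pure K V (x # w))"

fun shuffle_words ::
  "('a, 'k) ring_scheme \<Rightarrow> ('a, 'v, 'z) module_scheme \<Rightarrow> 'v list \<Rightarrow> 'v list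
    \<Rightarrow> ('v list \<Rightarrow> 'a) set" where
  "shuffle_words K V [] w = pure K V w"
| "shuffle_words K V (x # u) [] = pure K V (x # u)"
| "shuffle_words K V (x # u) (y # w) =
     tensor_cons K V x (shuffle_words K V u (y # w))
       \<oplus>\<^bsub>tensors K V\<^esub> tensor_cons K V y (shuffle_words K V (x # u) w)"

definition shuffle_algebra ::
  "('a, 'k) ring_scheme \<Rightarrow> ('a, 'v, 'z) module_scheme \<Rightarrow> ('a, ('v list \<Rightarrow> 'a) set) module" where
  "shuffle_algebra K V = (tensors K V)
    \<lparr>mult := (\<lambda>s t.
       pres_lift K (tensors K V) (\<lambda>u.
         pres_lift K (tensors K V) (\<lambda>w. shuffle_words K V u w) t) s),
     one := pure K V []\<rparr>"


section \<open>The algebras of constants\<close>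

text \<open>In both symmetric algebras, the embedding \<open>\<epsilon>\<close> sends an element to the monomial of degree
  one that it forms, which makes a separate copy of the module unnecessary.\<close>

definition C1 ::
  "('a, 'k) ring_scheme \<Rightarrow> ('a, 'j, 'y) module_scheme \<Rightarrow> ('a, 'v, 'z) module_scheme
    \<Rightarrow> ('a, (('j \<times> ('v list \<Rightarrow> 'a) set \<Rightarrow> 'a) set multiset \<Rightarrow> 'a) set) module" where
  "C1 K J V = sym_algebra K (tensor K J (tensors K V))"

type_synonym ('a, 'v) sym2 =
  "((('v list \<Rightarrow> 'a) set \<times> ('v list \<Rightarrow> 'a) set \<Rightarrow> 'a) set multiset \<Rightarrow> 'a) set"

definition Sym2 ::
  "('a, 'k) ring_scheme \<Rightarrow> ('a, 'v, 'z) module_scheme \<Rightarrow> ('a, ('a, 'v) sym2) module" where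
  "Sym2 K V = sym_algebra K (sym_square K (tensors_plus K V))"

definition eps_Sym2 ::
  "('a, 'k) ring_scheme \<Rightarrow> ('a, 'v, 'z) module_scheme \<Rightarrow> ('v list \<Rightarrow> 'a) set
    \<Rightarrow> ('v list \<Rightarrow> 'a) set \<Rightarrow> ('a, 'v) sym2" where
  "eps_Sym2 K V s t =
     sym_monom K (sym_square K (tensors_plus K V)) {#sym_elt K (tensors_plus K V) s t#}"

text \<open>Here \<open>take i f\<close> and \<open>drop i f\<close> are the paper's \<open>f\<^sub>1\<^sup>i\<close> and \<open>f\<^bsub>i+1\<^esub>\<^sup>n\<close>. On the natural numbers,
  \<open>1 - j\<close> is the maximum of \<open>0\<close> and \<open>1 - j\<close>.\<close>

definition J2_rel ::
  "('a, 'k) ring_scheme \<Rightarrow> ('a, 'v, 'z) module_scheme \<Rightarrow> 'v list \<Rightarrow> 'v list \<Rightarrow> 'v list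
    \<Rightarrow> ('a, 'v) sym2" where
  "J2_rel K V f g h = (let S = Sym2 K V; \<epsilon> = eps_Sym2 K V; p = pure K V; sh = shuffle_words K V in
     (\<epsilon> (sh f g) (p h) \<ominus>\<^bsub>S\<^esub> \<epsilon> (p f) (sh g h))
     \<oplus>\<^bsub>S\<^esub> (\<Oplus>\<^bsub>S\<^esub>j\<in>{0..<length g}.
       (\<Oplus>\<^bsub>S\<^esub>i\<in>{1 - j..<length f}.
          \<epsilon> (p (drop i f)) (p (drop j g)) \<otimes>\<^bsub>S\<^esub> \<epsilon> (sh (take i f) (take j g)) (p h))
       \<ominus>\<^bsub>S\<^esub> (\<Oplus>\<^bsub>S\<^esub>k\<in>{1 - j..<length h}.
          \<epsilon> (p f) (sh (take j g) (take k h)) \<otimes>\<^bsub>S\<^esub> \<epsilon> (p (drop j g)) (p (drop k h)))))"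

definition J2 ::
  "('a, 'k) ring_scheme \<Rightarrow> ('a, 'v, 'z) module_scheme \<Rightarrow> ('a, 'v) sym2 set" where
  "J2 K V = Idl\<^bsub>Sym2 K V\<^esub> {J2_rel K V f g h | f g h.
     f \<in> lists (carrier V) - {[]} \<and> g \<in> lists (carrier V) - {[]} \<and> h \<in> lists (carrier V) - {[]}}"

definition C2 ::
  "('a, 'k) ring_scheme \<Rightarrow> ('a, 'v, 'z) module_scheme \<Rightarrow> ('a, ('a, 'v) sym2 set) module" where
  "C2 K V = quot_algebra (Sym2 K V) (J2 K V)"

definition eps2 ::
  "('a, 'k) ring_scheme \<Rightarrow> ('a, 'v, 'z) module_scheme \<Rightarrow> ('v list \<Rightarrow> 'a) set
    \<Rightarrow> ('v list \<Rightarrow> 'a) set \<Rightarrow> ('a, 'v) sym2 set" where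
  "eps2 K V s t = J2 K V +>\<^bsub>Sym2 K V\<^esub> eps_Sym2 K V s t"


section \<open>The integro-differential ring\<close>

type_synonym ('a, 'v) c2t = "(('a, 'v) sym2 set \<times> ('v list \<Rightarrow> 'a) set \<Rightarrow> 'a) set"

text \<open>The product of \<open>c \<otimes> f\<close> and \<open>d \<otimes> g\<close> for pure tensors \<open>f\<close> and \<open>g\<close>.\<close>

definition C2T_pure_mult ::
  "('a, 'k) ring_scheme \<Rightarrow> ('a, 'v, 'z) module_scheme \<Rightarrow> ('a, 'v) sym2 set \<Rightarrow> ('a, 'v) sym2 set
    \<Rightarrow> 'v list \<Rightarrow> 'v list \<Rightarrow> ('a, 'v) c2t" where
  "C2T_pure_mult K V c d f g = (let C = C2 K V; T = tensors K V; Z = tensor K C T in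
     tensor_elt K C T (c \<otimes>\<^bsub>C\<^esub> d) (shuffle_words K V f g)
     \<oplus>\<^bsub>Z\<^esub> (\<Oplus>\<^bsub>Z\<^esub>i\<in>{0..<length f}. \<Oplus>\<^bsub>Z\<^esub>j\<in>{0..<length g}.
       tensor_elt K C T (c \<otimes>\<^bsub>C\<^esub> d \<otimes>\<^bsub>C\<^esub> eps2 K V (pure K V (drop i f)) (pure K V (drop j g)))
         (shuffle_words K V (take i f) (take j g))))"

definition C2T ::
  "('a, 'k) ring_scheme \<Rightarrow> ('a, 'v, 'z) module_scheme \<Rightarrow> ('a, ('a, 'v) c2t) module" where
  "C2T K V = (let Z = tensor K (C2 K V) (tensors K V) in
     Z\<lparr>mult := (\<lambda>U W.
         pres_lift K Z (\<lambda>(c, s).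
           pres_lift K Z (\<lambda>(d, t).
             pres_lift K Z (\<lambda>f. pres_lift K Z (\<lambda>g. C2T_pure_mult K V c d f g) t) s) W) U),
       one := tensor_elt K (C2 K V) (tensors K V) \<one>\<^bsub>C2 K V\<^esub> (pure K V [])\<rparr>)"

type_synonym 'a idr =
  "(('a \<times> (('a \<times> ('a list \<Rightarrow> 'a) set \<Rightarrow> 'a) set multiset \<Rightarrow> 'a) set \<Rightarrow> 'a) set
    \<times> ('a, 'a) c2t \<Rightarrow> 'a) set"

definition RC1 ::
  "('a, 'r) ring_scheme \<Rightarrow> ('a \<Rightarrow> 'a) \<Rightarrow> ('a \<Rightarrow> 'a)
    \<Rightarrow> ('a, ('a \<times> (('a \<times> ('a list \<Rightarrow> 'a) set \<Rightarrow> 'a) set multiset \<Rightarrow> 'a) set \<Rightarrow> 'a) set) module" where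
  "RC1 R der Q = (let K = constants R der in
     tensor_algebra K (self_algebra R) (C1 K (R_J R Q) (R_T R Q)))"

definition IDR :: "('a, 'r) ring_scheme \<Rightarrow> ('a \<Rightarrow> 'a) \<Rightarrow> ('a \<Rightarrow> 'a) \<Rightarrow> ('a, 'a idr) module" where
  "IDR R der Q = (let K = constants R der in
     tensor_algebra K (RC1 R der Q) (C2T K (R_T R Q)))"

text \<open>The element \<open>r \<otimes> c\<^sub>1 \<otimes> c\<^sub>2 \<otimes> t\<close>.\<close>

definition IDR_elt where
  "IDR_elt R der Q r c1 c2 t = (let K = constants R der; J = R_J R Q; V = R_T R Q in
     tensor_elt K (RC1 R der Q) (C2T K V)
       (tensor_elt K (self_algebra R) (C1 K J V) r c1)
       (tensor_elt K (C2 K V) (tensors K V) c2 t))"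

text \<open>The subring of \<open>IDR\<close> formed by \<open>R \<otimes> C\<^sub>1 \<otimes> C\<^sub>2 \<otimes> C 1\<^sub>T\<close>.\<close>

definition IDR_coeffs :: "('a, 'r) ring_scheme \<Rightarrow> ('a \<Rightarrow> 'a) \<Rightarrow> ('a \<Rightarrow> 'a) \<Rightarrow> ('a, 'a idr) module" where
  "IDR_coeffs R der Q = (let K = constants R der; J = R_J R Q; V = R_T R Q in
     (IDR R der Q)\<lparr>carrier := mspan K (IDR R der Q)
        {IDR_elt R der Q r c1 c2 (c \<odot>\<^bsub>tensors K V\<^esub> pure K V []) | r c1 c2 c.
           r \<in> carrier R \<and> c1 \<in> carrier (C1 K J V) \<and> c2 \<in> carrier (C2 K V) \<and> c \<in> carrier K}\<rparr>)"

end

theory Submission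
  imports Defs
begin

text \<open>The product on \<open>C2 \<otimes> T\<close> is the shuffle product twisted by the pairing \<open>e(f, g) = \<epsilon>(f \<odot> g)\<close>,
  where \<open>e(1, 1) = 1\<close> and \<open>e(1, f) = 0\<close> for \<open>f\<close> of positive length: it is the sum of all
  \<open>e(f'', g'') \<otimes> (f' \<squnion> g')\<close> over the splittings \<open>f = f' f''\<close> and \<open>g = g' g''\<close>. Splitting is
  multiplicative for shuffles, and the relations of \<open>J2\<close> say that \<open>e\<close> is a two-cocycle, hence the
  product is associative. It differs from the shuffle product only by tensors of smaller length.

  As \<open>B\<close> is homogeneous, the shuffle monomials in \<open>B\<close> form a basis of the module \<open>T\<close> that is
  compatible with the grading by length. Over the coefficient ring, the monomials formed with the
  product of \<open>IDR\<close> arise from this basis by a unitriangular transformation with respect to the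
  degree, and so they form a basis as well.\<close>

section \<open>Linear maps\<close>

text \<open>Associativity is treated as a symmetry: since the product is commutative, it suffices
  that \<open>(x y) z\<close> does not change when \<open>x\<close> and \<open>z\<close> are
  exchanged. Written out over splittings into segments, this product is built from one side of the
  cocycle identity and from threefold shuffles, and both are invariant under the exchange.
  Associativity of the shuffle product itself is taken from \<open>algebra_basis\<close>.

  The obstacle to independence is that tensor products over a general ring need not preserve
  injectivity, so neither the map sending \<open>b\<close> to its image in IDR nor the passage from
  a ring of coefficients to its copy in the tensor product is assumed injective. The proof works
  with functionals instead. Reading off the coefficient of a monomial is a linear map on T; it
  extends to \<open>C2 \<otimes> T\<close> and then to IDR, with values in the algebra itself. On
  monomials of no larger degree it takes only the values one and zero, since it does not see shorter
  tensors. Independence follows, and also that distinct elements of \<open>B\<close> have distinct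
  images, unless IDR is the zero ring.\<close>

definition linear_map ::
  "('a, 'k) ring_scheme \<Rightarrow> ('a, 'm, 'y) module_scheme \<Rightarrow> ('a, 'n, 'z) module_scheme
    \<Rightarrow> ('m \<Rightarrow> 'n) \<Rightarrow> bool" where
  "linear_map K M N f \<longleftrightarrow>
     (\<forall>x\<in>carrier M. f x \<in> carrier N) \<and>
     (\<forall>x\<in>carrier M. \<forall>y\<in>carrier M. f (x \<oplus>\<^bsub>M\<^esub> y) = f x \<oplus>\<^bsub>N\<^esub> f y) \<and>
     (\<forall>c\<in>carrier K. \<forall>x\<in>carrier M. f (c \<odot>\<^bsub>M\<^esub> x) = c \<odot>\<^bsub>N\<^esub> f x)"

definition bilinear_map ::
  "('a, 'k) ring_scheme \<Rightarrow> ('a, 'm, 'x) module_scheme \<Rightarrow> ('a, 'n, 'y) module_scheme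
    \<Rightarrow> ('a, 'p, 'z) module_scheme \<Rightarrow> ('m \<Rightarrow> 'n \<Rightarrow> 'p) \<Rightarrow> bool" where
  "bilinear_map K M N P f \<longleftrightarrow>
     (\<forall>x\<in>carrier M. linear_map K N P (f x)) \<and> (\<forall>y\<in>carrier N. linear_map K M P (\<lambda>x. f x y))"

lemma linear_mapI:
  assumes "\<And>x. x \<in> carrier M \<Longrightarrow> f x \<in> carrier N"
    and "\<And>x y. \<lbrakk>x \<in> carrier M; y \<in> carrier M\<rbrakk> \<Longrightarrow> f (x \<oplus>\<^bsub>M\<^esub> y) = f x \<oplus>\<^bsub>N\<^esub> f y"
    and "\<And>c x. \<lbrakk>c \<in> carrier K; x \<in> carrier M\<rbrakk> \<Longrightarrow> f (c \<odot>\<^bsub>M\<^esub> x) = c \<odot>\<^bsub>N\<^esub> f x"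
  shows "linear_map K M N f"
  using assms by (auto simp: linear_map_def)

lemma linear_mapD:
  assumes "linear_map K M N f"
  shows "x \<in> carrier M \<Longrightarrow> f x \<in> carrier N"
    and "\<lbrakk>x \<in> carrier M; y \<in> carrier M\<rbrakk> \<Longrightarrow> f (x \<oplus>\<^bsub>M\<^esub> y) = f x \<oplus>\<^bsub>N\<^esub> f y"
    and "\<lbrakk>c \<in> carrier K; x \<in> carrier M\<rbrakk> \<Longrightarrow> f (c \<odot>\<^bsub>M\<^esub> x) = c \<odot>\<^bsub>N\<^esub> f x"
  using assms by (auto simp: linear_map_def)

lemma bilinear_mapD:
  assumes "bilinear_map K M N P f"
  shows "x \<in> carrier M \<Longrightarrow> linear_map K N P (f x)"
    and "y \<in> carrier N \<Longrightarrow> linear_map K M P (\<lambda>x. f x y)"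
  using assms by (auto simp: bilinear_map_def)

lemma bilinear_map_closed:
  "\<lbrakk>bilinear_map K M N P f; x \<in> carrier M; y \<in> carrier N\<rbrakk> \<Longrightarrow> f x y \<in> carrier P"
  by (auto simp: bilinear_map_def linear_map_def)

lemma module_cring: "module K M \<Longrightarrow> cring K"
  by (simp add: module_def)

lemma linear_map_zero:
  assumes "module K M" "module K N" "linear_map K M N f"
  shows "f \<zero>\<^bsub>M\<^esub> = \<zero>\<^bsub>N\<^esub>"
proof -
  interpret M: module K M by fact
  interpret N: module K N by fact
  have "f (\<zero>\<^bsub>K\<^esub> \<odot>\<^bsub>M\<^esub> \<zero>\<^bsub>M\<^esub>) = \<zero>\<^bsub>K\<^esub> \<odot>\<^bsub>N\<^esub> f \<zero>\<^bsub>M\<^esub>"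
    by (rule linear_mapD(3)[OF assms(3)]) auto
  then show ?thesis
    using linear_mapD(1)[OF assms(3), of "\<zero>\<^bsub>M\<^esub>"] by simp
qed

lemma linear_map_minus:
  assumes "module K M" "module K N" "linear_map K M N f" "x \<in> carrier M" "y \<in> carrier M"
  shows "f (x \<ominus>\<^bsub>M\<^esub> y) = f x \<ominus>\<^bsub>N\<^esub> f y"
proof -
  interpret M: module K M by fact
  interpret N: module K N by fact
  have "\<ominus>\<^bsub>M\<^esub> y = (\<ominus>\<^bsub>K\<^esub> \<one>\<^bsub>K\<^esub>) \<odot>\<^bsub>M\<^esub> y" "\<ominus>\<^bsub>N\<^esub> f y = (\<ominus>\<^bsub>K\<^esub> \<one>\<^bsub>K\<^esub>) \<odot>\<^bsub>N\<^esub> f y"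
    using assms(5) linear_mapD(1)[OF assms(3)] by (simp_all add: M.smult_l_minus N.smult_l_minus)
  then show ?thesis
    using linear_mapD[OF assms(3)] assms(4,5) by (simp add: M.minus_eq N.minus_eq)
qed

lemma (in abelian_group) minus_eq_zero_iff:
  assumes "x \<in> carrier G" "y \<in> carrier G"
  shows "x \<ominus> y = \<zero> \<longleftrightarrow> x = y"
  using assms minus_equality[of x "\<ominus> y"] by (auto simp: minus_eq r_neg)

lemma linear_map_change:
  assumes "linear_map K M N f" "carrier M' = carrier M" "add M' = add M" "smult M' = smult M"
    "carrier N' = carrier N" "add N' = add N" "smult N' = smult N"
  shows "linear_map K M' N' f"
  using assms by (simp add: linear_map_def)

lemma linear_map_cong:
  assumes "module K M" "\<And>x. x \<in> carrier M \<Longrightarrow> f x = g x" "linear_map K M N f"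
  shows "linear_map K M N g"
proof -
  interpret M: module K M by fact
  show ?thesis using assms(2,3) by (simp add: linear_map_def)
qed

lemma linear_map_compose:
  assumes "linear_map K M N f" "linear_map K N P g"
  shows "linear_map K M P (\<lambda>x. g (f x))"
  using assms by (simp add: linear_map_def)

lemma linear_map_const_zero:
  assumes "module K N"
  shows "linear_map K M N (\<lambda>_. \<zero>\<^bsub>N\<^esub>)"
proof -
  interpret N: module K N by fact
  show ?thesis by (rule linear_mapI) auto
qed

lemma linear_map_add:
  assumes "module K N" "linear_map K M N f" "linear_map K M N g"
  shows "linear_map K M N (\<lambda>x. f x \<oplus>\<^bsub>N\<^esub> g x)"
proof -
  interpret N: module K N by fact
  show ?thesis
    using linear_mapD[OF assms(2)] linear_mapD[OF assms(3)]
    by (intro linear_mapI) (auto simp: N.smult_r_distr N.M.a_ac)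
qed

lemma linear_map_smult:
  assumes "module K N" "linear_map K M N f" "a \<in> carrier K"
  shows "linear_map K M N (\<lambda>x. a \<odot>\<^bsub>N\<^esub> f x)"
proof -
  interpret N: module K N by fact
  show ?thesis
  proof (rule linear_mapI)
    fix c x assume *: "c \<in> carrier K" "x \<in> carrier M"
    show "a \<odot>\<^bsub>N\<^esub> f (c \<odot>\<^bsub>M\<^esub> x) = c \<odot>\<^bsub>N\<^esub> (a \<odot>\<^bsub>N\<^esub> f x)"
      using linear_mapD[OF assms(2)] * assms(3)
      by (simp add: N.smult_assoc1[symmetric] N.R.m_comm)
  qed (use linear_mapD[OF assms(2)] assms(3) in \<open>auto simp: N.smult_r_distr\<close>)
qed

lemma linear_map_finsum_param:
  assumes "module K M" "module K N" "finite A" "\<And>a. a \<in> A \<Longrightarrow> linear_map K M N (f a)"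
  shows "linear_map K M N (\<lambda>x. \<Oplus>\<^bsub>N\<^esub>a\<in>A. f a x)"
  using assms(3,4)
proof (induction A)
  case empty
  interpret N: module K N by fact
  show ?case by (simp add: linear_map_const_zero[OF assms(2)])
next
  case (insert a A)
  interpret N: module K N by fact
  have lin: "linear_map K M N (\<lambda>x. f a x \<oplus>\<^bsub>N\<^esub> (\<Oplus>\<^bsub>N\<^esub>b\<in>A. f b x))"
    using insert by (intro linear_map_add[OF assms(2)]) auto
  have "f a x \<oplus>\<^bsub>N\<^esub> (\<Oplus>\<^bsub>N\<^esub>b\<in>A. f b x) = (\<Oplus>\<^bsub>N\<^esub>b\<in>insert a A. f b x)"
    if "x \<in> carrier M" for x
    using insert.hyps insert.prems that
    by (subst N.finsum_insert) (auto intro!: linear_mapD(1)[of K M N])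
  then show ?case by (rule linear_map_cong[OF assms(1) _ lin])
qed

lemma finsum_linear_map:
  assumes "module K M" "module K N" "linear_map K M N f" "finite A" "\<phi> \<in> A \<rightarrow> carrier M"
  shows "f (\<Oplus>\<^bsub>M\<^esub>a\<in>A. \<phi> a) = (\<Oplus>\<^bsub>N\<^esub>a\<in>A. f (\<phi> a))"
proof -
  interpret M: module K M by fact
  interpret N: module K N by fact
  show ?thesis
    using assms(4,5)
  proof (induction A)
    case empty
    show ?case using linear_map_zero[OF assms(1-3)] by simp
  next
    case (insert a A)
    then show ?case using linear_mapD[OF assms(3)]
      by (auto simp: Pi_def)
  qed
qed

lemma submodule_zero: "submodule N K M \<Longrightarrow> \<zero>\<^bsub>M\<^esub> \<in> N"
  using subgroup.one_closed[OF submodule.axioms(1)] by simp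

lemma submodule_mspan:
  assumes "module K M" "S \<subseteq> carrier M"
  shows "submodule (mspan K M S) K M" "S \<subseteq> mspan K M S" "mspan K M S \<subseteq> carrier M"
proof -
  interpret M: module K M by fact
  have c: "submodule (carrier M) K M" by (rule M.carrier_is_submodule)
  show sub: "mspan K M S \<subseteq> carrier M" using c assms(2) by (auto simp: mspan_def)
  show "S \<subseteq> mspan K M S" by (auto simp: mspan_def)
  show "submodule (mspan K M S) K M"
  proof (rule M.submoduleI)
    show "\<zero>\<^bsub>M\<^esub> \<in> mspan K M S"
      unfolding mspan_def by (auto intro: submodule_zero)
  qed (use sub M.submoduleE in \<open>auto simp: mspan_def\<close>)
qed

lemma mspan_minimal: "\<lbrakk>submodule N K M; S \<subseteq> N\<rbrakk> \<Longrightarrow> mspan K M S \<subseteq> N"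
  by (auto simp: mspan_def)

text \<open>There is no case for negatives: they are multiples by minus one.\<close>

lemma mspan_induct [consumes 3, case_names zero add smult gen]:
  assumes "module K M" "S \<subseteq> carrier M" "x \<in> mspan K M S"
    and "P \<zero>\<^bsub>M\<^esub>"
    and "\<And>x y. \<lbrakk>x \<in> carrier M; y \<in> carrier M; P x; P y\<rbrakk> \<Longrightarrow> P (x \<oplus>\<^bsub>M\<^esub> y)"
    and "\<And>c x. \<lbrakk>c \<in> carrier K; x \<in> carrier M; P x\<rbrakk> \<Longrightarrow> P (c \<odot>\<^bsub>M\<^esub> x)"
    and "\<And>x. x \<in> S \<Longrightarrow> P x"
  shows "P x"
proof -
  interpret M: module K M by fact
  have "submodule {x \<in> carrier M. P x} K M"
  proof (rule M.submoduleI)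
    fix a assume a: "a \<in> {x \<in> carrier M. P x}"
    then have "\<ominus>\<^bsub>M\<^esub> a = (\<ominus>\<^bsub>K\<^esub> \<one>\<^bsub>K\<^esub>) \<odot>\<^bsub>M\<^esub> a" by (simp add: M.smult_l_minus)
    then show "\<ominus>\<^bsub>M\<^esub> a \<in> {x \<in> carrier M. P x}" using a assms(6) by simp
  qed (use assms in auto)
  then have "mspan K M S \<subseteq> {x \<in> carrier M. P x}"
    by (rule mspan_minimal) (use assms(2,7) in auto)
  then show ?thesis using assms(3) by auto
qed

lemma linear_map_eq_on_mspan:
  assumes "module K M" "module K N" "S \<subseteq> carrier M"
    and "linear_map K M N f" "linear_map K M N g" "\<And>x. x \<in> S \<Longrightarrow> f x = g x"
    and "x \<in> mspan K M S"
  shows "f x = g x"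
  using assms(1,3,7)
  by (induction rule: mspan_induct)
    (use assms(6) linear_mapD[OF assms(4)] linear_mapD[OF assms(5)]
        linear_map_zero[OF assms(1,2,4)] linear_map_zero[OF assms(1,2,5)] in auto)

text \<open>The arguments are extended from generators to spans one at a time, with the other
  argument held fixed.\<close>

lemma bilinear_map_eq_on_mspan:
  assumes "module K M" "module K N" "module K P" "S \<subseteq> carrier M" "T \<subseteq> carrier N"
    and "bilinear_map K M N P f" "bilinear_map K M N P g"
    and "\<And>x y. \<lbrakk>x \<in> S; y \<in> T\<rbrakk> \<Longrightarrow> f x y = g x y"
    and "x \<in> mspan K M S" "y \<in> mspan K N T"
  shows "f x y = g x y"
proof -
  have y: "y \<in> carrier N" using submodule_mspan(3)[OF assms(2,5)] assms(10) by auto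
  have *: "f s y = g s y" if "s \<in> S" for s
    using assms(4) that
    by (intro linear_map_eq_on_mspan[OF assms(2,3,5) bilinear_mapD(1)[OF assms(6)]
          bilinear_mapD(1)[OF assms(7)] assms(8) assms(10)]) auto
  show ?thesis
    by (rule linear_map_eq_on_mspan[OF assms(1,3,4) bilinear_mapD(2)[OF assms(6) y]
          bilinear_mapD(2)[OF assms(7) y] * assms(9)])
qed

lemma linear_map_image_mspan:
  assumes "module K M" "module K N" "linear_map K M N f" "S \<subseteq> carrier M" "x \<in> mspan K M S"
    and "submodule U K N" "\<And>x. x \<in> S \<Longrightarrow> f x \<in> U"
  shows "f x \<in> U"
proof -
  interpret N: module K N by fact
  have U: "\<zero>\<^bsub>N\<^esub> \<in> U" by (rule submodule_zero[OF assms(6)])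
  show ?thesis using assms(1,4,5)
    by (induction rule: mspan_induct)
      (use assms(7) N.submoduleE[OF assms(6)] U linear_mapD[OF assms(3)]
        linear_map_zero[OF assms(1-3)] in auto)
qed

section \<open>Free modules\<close>

lemma free_module_simps [simp]:
  "zero (free_module K X) = (\<lambda>x. \<zero>\<^bsub>K\<^esub>)"
  "add (free_module K X) p q = (\<lambda>x. p x \<oplus>\<^bsub>K\<^esub> q x)"
  "smult (free_module K X) c p = (\<lambda>x. c \<otimes>\<^bsub>K\<^esub> p x)"
  by (simp_all add: free_module_def)

lemma free_module_carrier:
  "p \<in> carrier (free_module K X) \<longleftrightarrow>
     (\<forall>x. p x \<in> carrier K) \<and> finite {x. p x \<noteq> \<zero>\<^bsub>K\<^esub>} \<and> {x. p x \<noteq> \<zero>\<^bsub>K\<^esub>} \<subseteq> X"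
  by (auto simp: free_module_def)

lemma module_free_module:
  assumes "cring K"
  shows "module K (free_module K X)"
proof -
  interpret K: cring K by fact
  show ?thesis
  proof (rule moduleI)
    show "abelian_group (free_module K X)"
    proof (rule abelian_groupI, goal_cases)
      case (1 p q)
      have "{x. p x \<oplus>\<^bsub>K\<^esub> q x \<noteq> \<zero>\<^bsub>K\<^esub>} \<subseteq> {x. p x \<noteq> \<zero>\<^bsub>K\<^esub>} \<union> {x. q x \<noteq> \<zero>\<^bsub>K\<^esub>}" by auto
      moreover have "finite ({x. p x \<noteq> \<zero>\<^bsub>K\<^esub>} \<union> {x. q x \<noteq> \<zero>\<^bsub>K\<^esub>})"
        using 1 by (simp add: free_module_carrier)
      ultimately have "finite {x. p x \<oplus>\<^bsub>K\<^esub> q x \<noteq> \<zero>\<^bsub>K\<^esub>}" by (rule finite_subset)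
      moreover have "p x \<oplus>\<^bsub>K\<^esub> q x = \<zero>\<^bsub>K\<^esub>" if "x \<notin> X" for x
      proof -
        have "p x = \<zero>\<^bsub>K\<^esub>" "q x = \<zero>\<^bsub>K\<^esub>" using 1 that by (auto simp: free_module_carrier)
        then show ?thesis by simp
      qed
      ultimately show ?case using 1 by (auto simp: free_module_carrier)
    next
      case (6 p)
      let ?q = "\<lambda>x. \<ominus>\<^bsub>K\<^esub> p x"
      have "finite {x. ?q x \<noteq> \<zero>\<^bsub>K\<^esub>}"
        by (rule finite_subset[of _ "{x. p x \<noteq> \<zero>\<^bsub>K\<^esub>}"]) (use 6 in \<open>auto simp: free_module_carrier\<close>)
      then have "?q \<in> carrier (free_module K X)"
        using 6 by (auto simp: free_module_carrier)
      then show ?case using 6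
        by (intro bexI[of _ ?q]) (auto simp: free_module_carrier K.l_neg)
    qed (auto simp: free_module_carrier K.a_ac)
    show "c \<odot>\<^bsub>free_module K X\<^esub> p \<in> carrier (free_module K X)"
      if "c \<in> carrier K" "p \<in> carrier (free_module K X)" for c p
    proof -
      have "finite {x. c \<otimes>\<^bsub>K\<^esub> p x \<noteq> \<zero>\<^bsub>K\<^esub>}"
        by (rule finite_subset[of _ "{x. p x \<noteq> \<zero>\<^bsub>K\<^esub>}"])
          (use that in \<open>auto simp: free_module_carrier\<close>)
      then show ?thesis using that by (auto simp: free_module_carrier)
    qed
  qed (auto simp: free_module_carrier K.l_distr K.r_distr K.m_assoc assms)
qed

lemma unit_vec_closed:
  assumes "cring K" "x \<in> X"
  shows "unit_vec K x \<in> carrier (free_module K X)"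
proof -
  interpret K: cring K by fact
  show ?thesis
    using assms(2) by (auto simp: free_module_carrier unit_vec_def intro: finite_subset[of _ "{x}"])
qed

text \<open>Induction on the size of the support: setting one coefficient to zero shrinks it, and
  the removed part is a multiple of a unit vector.\<close>

lemma mspan_unit_vecs:
  assumes "cring K"
  shows "mspan K (free_module K X) (unit_vec K ` X) = carrier (free_module K X)"
proof -
  interpret K: cring K by fact
  let ?F = "free_module K X"
  have mod: "module K ?F" by (rule module_free_module[OF assms])
  interpret F: module K ?F by fact
  have sub: "unit_vec K ` X \<subseteq> carrier ?F" using unit_vec_closed[OF assms] by auto
  have "p \<in> mspan K ?F (unit_vec K ` X)" if "p \<in> carrier ?F" for p
    using that
  proof (induction "card {x. p x \<noteq> \<zero>\<^bsub>K\<^esub>}" arbitrary: p)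
    case 0
    then have "p = \<zero>\<^bsub>?F\<^esub>" by (auto simp: free_module_carrier)
    then show ?case
      using submodule_zero[OF submodule_mspan(1)[OF mod sub]] by simp
  next
    case (Suc n)
    then obtain x where x: "p x \<noteq> \<zero>\<^bsub>K\<^esub>" by (metis (mono_tags, lifting) Collect_empty_eq card.empty nat.simps(3))
    have x': "x \<in> X" using x Suc.prems by (auto simp: free_module_carrier)
    let ?q = "p(x := \<zero>\<^bsub>K\<^esub>)"
    have supp: "{y. ?q y \<noteq> \<zero>\<^bsub>K\<^esub>} = {y. p y \<noteq> \<zero>\<^bsub>K\<^esub>} - {x}" by auto
    have "?q \<in> carrier ?F" using Suc.prems unfolding free_module_carrier supp by auto
    moreover have "n = card {y. ?q y \<noteq> \<zero>\<^bsub>K\<^esub>}"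
      unfolding supp using Suc(2) Suc.prems x by (simp add: free_module_carrier)
    ultimately have 1: "?q \<in> mspan K ?F (unit_vec K ` X)" using Suc(1) by blast
    have 2: "p x \<odot>\<^bsub>?F\<^esub> unit_vec K x \<in> mspan K ?F (unit_vec K ` X)"
      using Suc.prems x' submodule_mspan(2)[OF mod sub]
      by (intro F.submoduleE(4)[OF submodule_mspan(1)[OF mod sub]]) (auto simp: free_module_carrier)
    have "p = ?q \<oplus>\<^bsub>?F\<^esub> p x \<odot>\<^bsub>?F\<^esub> unit_vec K x"
      using Suc.prems by (auto simp: free_module_carrier unit_vec_def)
    then show ?case
      using F.submoduleE(5)[OF submodule_mspan(1)[OF mod sub] 1 2] by simp
  qed
  then show ?thesis using submodule_mspan(3)[OF mod sub] by auto
qed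

text \<open>The same sum underlies \<open>pres_lift\<close>, on representatives of a coset, and
  \<open>poly_eval\<close>, with the monomials as \<phi>. Its linearity is therefore proved once for
  both.\<close>

definition lin_ext ::
  "('a, 'k) ring_scheme \<Rightarrow> ('a, 'b, 'z) module_scheme \<Rightarrow> ('x \<Rightarrow> 'b) \<Rightarrow> ('x \<Rightarrow> 'a) \<Rightarrow> 'b" where
  "lin_ext K Z \<phi> p = (\<Oplus>\<^bsub>Z\<^esub>x\<in>{x. p x \<noteq> \<zero>\<^bsub>K\<^esub>}. p x \<odot>\<^bsub>Z\<^esub> \<phi> x)"

text \<open>The sums for \<open>p\<close>, \<open>q\<close> and their sum range over three different
  supports; a common finite index set makes them comparable.\<close>

lemma lin_ext_superset:
  assumes "module K Z" "p \<in> carrier (free_module K X)" "\<phi> \<in> X \<rightarrow> carrier Z"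
    and "finite A" "{x. p x \<noteq> \<zero>\<^bsub>K\<^esub>} \<subseteq> A" "A \<subseteq> X"
  shows "lin_ext K Z \<phi> p = (\<Oplus>\<^bsub>Z\<^esub>x\<in>A. p x \<odot>\<^bsub>Z\<^esub> \<phi> x)"
proof -
  interpret Z: module K Z by fact
  show ?thesis
    unfolding lin_ext_def
    using assms(2-6)
    by (intro Z.add.finprod_mono_neutral_cong_left) (auto simp: free_module_carrier Pi_def subset_iff)
qed

lemma lin_ext_linear:
  assumes "module K Z" "\<phi> \<in> X \<rightarrow> carrier Z"
  shows "linear_map K (free_module K X) Z (lin_ext K Z \<phi>)"
proof -
  interpret Z: module K Z by fact
  have mod: "module K (free_module K X)" by (rule module_free_module[OF module_cring[OF assms(1)]])
  interpret F: module K "free_module K X" by fact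
  show ?thesis
  proof (rule linear_mapI)
    fix p assume "p \<in> carrier (free_module K X)"
    then show "lin_ext K Z \<phi> p \<in> carrier Z"
      unfolding lin_ext_def using assms(2)
      by (intro Z.finsum_closed) (auto simp: free_module_carrier Pi_def subset_iff)
  next
    fix p q assume p: "p \<in> carrier (free_module K X)" and q: "q \<in> carrier (free_module K X)"
    let ?A = "{x. p x \<noteq> \<zero>\<^bsub>K\<^esub>} \<union> {x. q x \<noteq> \<zero>\<^bsub>K\<^esub>}"
    have A: "finite ?A" "?A \<subseteq> X" using p q by (auto simp: free_module_carrier)
    have pq: "p \<oplus>\<^bsub>free_module K X\<^esub> q \<in> carrier (free_module K X)" using p q by (rule F.a_closed)
    have "lin_ext K Z \<phi> (p \<oplus>\<^bsub>free_module K X\<^esub> q)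
        = (\<Oplus>\<^bsub>Z\<^esub>x\<in>?A. (p x \<oplus>\<^bsub>K\<^esub> q x) \<odot>\<^bsub>Z\<^esub> \<phi> x)"
      using p q by (subst lin_ext_superset[OF assms(1) pq assms(2) A(1) _ A(2)]) (auto simp: free_module_carrier)
    also have "\<dots> = (\<Oplus>\<^bsub>Z\<^esub>x\<in>?A. p x \<odot>\<^bsub>Z\<^esub> \<phi> x \<oplus>\<^bsub>Z\<^esub> q x \<odot>\<^bsub>Z\<^esub> \<phi> x)"
      using p q A assms(2)
      by (intro Z.finsum_cong') (auto simp: free_module_carrier Z.smult_l_distr Pi_def subset_iff)
    also have "\<dots> = (\<Oplus>\<^bsub>Z\<^esub>x\<in>?A. p x \<odot>\<^bsub>Z\<^esub> \<phi> x) \<oplus>\<^bsub>Z\<^esub> (\<Oplus>\<^bsub>Z\<^esub>x\<in>?A. q x \<odot>\<^bsub>Z\<^esub> \<phi> x)"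
      using p q A assms(2)
      by (intro Z.finsum_addf) (auto simp: free_module_carrier Pi_def subset_iff)
    also have "\<dots> = lin_ext K Z \<phi> p \<oplus>\<^bsub>Z\<^esub> lin_ext K Z \<phi> q"
      by (subst (1 2) lin_ext_superset[OF assms(1) _ assms(2) A(1) _ A(2)]) (use p q in auto)
    finally show "lin_ext K Z \<phi> (p \<oplus>\<^bsub>free_module K X\<^esub> q) = lin_ext K Z \<phi> p \<oplus>\<^bsub>Z\<^esub> lin_ext K Z \<phi> q" .
  next
    fix c p assume c: "c \<in> carrier K" and p: "p \<in> carrier (free_module K X)"
    let ?A = "{x. p x \<noteq> \<zero>\<^bsub>K\<^esub>}"
    have A: "finite ?A" "?A \<subseteq> X" using p by (auto simp: free_module_carrier)
    have cp: "c \<odot>\<^bsub>free_module K X\<^esub> p \<in> carrier (free_module K X)" using c p by (rule F.smult_closed)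
    have "lin_ext K Z \<phi> (c \<odot>\<^bsub>free_module K X\<^esub> p) = (\<Oplus>\<^bsub>Z\<^esub>x\<in>?A. (c \<otimes>\<^bsub>K\<^esub> p x) \<odot>\<^bsub>Z\<^esub> \<phi> x)"
      using c p by (subst lin_ext_superset[OF assms(1) cp assms(2) A(1) _ A(2)]) auto
    also have "\<dots> = (\<Oplus>\<^bsub>Z\<^esub>x\<in>?A. c \<odot>\<^bsub>Z\<^esub> (p x \<odot>\<^bsub>Z\<^esub> \<phi> x))"
      using c p A assms(2)
      by (intro Z.finsum_cong') (auto simp: free_module_carrier Z.smult_assoc1 Pi_def subset_iff)
    also have "\<dots> = c \<odot>\<^bsub>Z\<^esub> lin_ext K Z \<phi> p"
      unfolding lin_ext_def using c p A assms(2)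
      by (intro Z.finsum_smult_ldistr[symmetric]) (auto simp: free_module_carrier Pi_def subset_iff)
    finally show "lin_ext K Z \<phi> (c \<odot>\<^bsub>free_module K X\<^esub> p) = c \<odot>\<^bsub>Z\<^esub> lin_ext K Z \<phi> p" .
  qed
qed

lemma lin_ext_unit_vec:
  assumes "module K Z" "\<phi> \<in> X \<rightarrow> carrier Z" "x \<in> X"
  shows "lin_ext K Z \<phi> (unit_vec K x) = \<phi> x"
proof -
  interpret Z: module K Z by fact
  have "lin_ext K Z \<phi> (unit_vec K x) = (\<Oplus>\<^bsub>Z\<^esub>y\<in>{x}. unit_vec K x y \<odot>\<^bsub>Z\<^esub> \<phi> y)"
    using assms(3)
    by (intro lin_ext_superset[OF assms(1) unit_vec_closed[OF module_cring[OF assms(1)] assms(3)]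
          assms(2)]) (auto simp: unit_vec_def)
  then show ?thesis using assms(2,3) by (auto simp: unit_vec_def Pi_def)
qed

text \<open>Linearity in the family of values, with fixed coefficients.
  \<open>bilinear_pres_lift\<close> needs it for the argument of the inner lift.\<close>

lemma lin_ext_linear_param:
  assumes "module K M" "module K Z" "p \<in> carrier (free_module K X)"
    and "\<And>x. x \<in> X \<Longrightarrow> linear_map K M Z (\<phi> x)"
  shows "linear_map K M Z (\<lambda>v. lin_ext K Z (\<lambda>x. \<phi> x v) p)"
  unfolding lin_ext_def using assms(3,4)
  by (intro linear_map_finsum_param[OF assms(1,2)] linear_map_smult[OF assms(2)])
    (auto simp: free_module_carrier)

section \<open>Modules by generators and relations\<close>

lemma quot_algebra_simps [simp]:
  "carrier (quot_algebra A I) = a_rcosets\<^bsub>A\<^esub> I"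
  "zero (quot_algebra A I) = I"
  "add (quot_algebra A I) = (<+>\<^bsub>A\<^esub>)"
  "mult (quot_algebra A I) = rcoset_mult A I"
  "one (quot_algebra A I) = I +>\<^bsub>A\<^esub> \<one>\<^bsub>A\<^esub>"
  by (simp_all add: quot_algebra_def FactRing_def)

lemma quot_carrierE:
  assumes "U \<in> carrier (quot_algebra A I)"
  obtains x where "x \<in> carrier A" "U = I +>\<^bsub>A\<^esub> x"
  using assms by (auto simp: A_RCOSETS_def')

lemma quot_carrierI: "x \<in> carrier A \<Longrightarrow> I +>\<^bsub>A\<^esub> x \<in> carrier (quot_algebra A I)"
  by (auto simp: A_RCOSETS_def')

lemma abelian_subgroup_submodule:
  assumes "module K M" "submodule N K M"
  shows "abelian_subgroup N M"
proof -
  interpret M: module K M by fact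
  show ?thesis
    by (intro abelian_subgroupI3 additive_subgroup.intro submodule.axioms(1)[OF assms(2)]
        M.M.abelian_group_axioms)
qed

lemma coset_eq_iff:
  assumes "module K M" "submodule N K M" "x \<in> carrier M" "y \<in> carrier M"
  shows "N +>\<^bsub>M\<^esub> x = N +>\<^bsub>M\<^esub> y \<longleftrightarrow> x \<ominus>\<^bsub>M\<^esub> y \<in> N"
proof -
  interpret M: module K M by fact
  interpret N: abelian_subgroup N M by (rule abelian_subgroup_submodule[OF assms(1,2)])
  have sub: "subgroup N (add_monoid M)" by (rule submodule.axioms(1)[OF assms(2)])
  show ?thesis
  proof
    assume "N +>\<^bsub>M\<^esub> x = N +>\<^bsub>M\<^esub> y"
    then have "N +>\<^bsub>M\<^esub> (x \<oplus>\<^bsub>M\<^esub> \<ominus>\<^bsub>M\<^esub> y) = N"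
      using assms(3,4) N.a_subset by (intro M.a_coset_add_inv2)
    then show "x \<ominus>\<^bsub>M\<^esub> y \<in> N"
      unfolding a_minus_def using assms(3,4) by (intro M.a_coset_join1[OF _ _ sub]) auto
  next
    assume "x \<ominus>\<^bsub>M\<^esub> y \<in> N"
    then have "N +>\<^bsub>M\<^esub> (x \<oplus>\<^bsub>M\<^esub> \<ominus>\<^bsub>M\<^esub> y) = N"
      unfolding a_minus_def using assms(3,4) by (intro M.a_coset_join2[OF _ sub]) auto
    then show "N +>\<^bsub>M\<^esub> x = N +>\<^bsub>M\<^esub> y"
      using assms(3,4) N.a_subset by (intro M.a_coset_add_inv1)
  qed
qed

text \<open>The definition takes a union over all representatives of a coset. As the submodule is
  closed under scaling, every member of this union is the same coset.\<close>

lemma quot_smult: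
  assumes "module K M" "submodule N K M" "c \<in> carrier K" "x \<in> carrier M"
  shows "c \<odot>\<^bsub>quot_algebra M N\<^esub> (N +>\<^bsub>M\<^esub> x) = N +>\<^bsub>M\<^esub> (c \<odot>\<^bsub>M\<^esub> x)"
proof -
  interpret M: module K M by fact
  interpret N: abelian_subgroup N M by (rule abelian_subgroup_submodule[OF assms(1,2)])
  have *: "N +>\<^bsub>M\<^esub> (c \<odot>\<^bsub>M\<^esub> y) = N +>\<^bsub>M\<^esub> (c \<odot>\<^bsub>M\<^esub> x)" if y: "y \<in> N +>\<^bsub>M\<^esub> x" for y
  proof -
    obtain h where h: "h \<in> N" "y = h \<oplus>\<^bsub>M\<^esub> x" using y by (auto simp: a_r_coset_def')
    then have hc: "h \<in> carrier M" using N.a_subset by auto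
    have "c \<odot>\<^bsub>M\<^esub> y \<ominus>\<^bsub>M\<^esub> c \<odot>\<^bsub>M\<^esub> x = c \<odot>\<^bsub>M\<^esub> h"
      using h hc assms(3,4) by (simp add: M.smult_r_distr M.minus_eq M.a_assoc M.r_neg)
    moreover have "c \<odot>\<^bsub>M\<^esub> h \<in> N" using M.submoduleE(4)[OF assms(2)] assms(3) h by auto
    ultimately show ?thesis using h hc assms by (subst coset_eq_iff[OF assms(1,2)]) auto
  qed
  have "x \<in> N +>\<^bsub>M\<^esub> x" using N.a_rcos_self assms(4) by simp
  then have "(\<Union>y\<in>N +>\<^bsub>M\<^esub> x. N +>\<^bsub>M\<^esub> (c \<odot>\<^bsub>M\<^esub> y)) = N +>\<^bsub>M\<^esub> (c \<odot>\<^bsub>M\<^esub> x)"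
    by (intro SUP_eq_const *) blast
  then show ?thesis by (simp add: quot_algebra_def)
qed

lemma quot_add:
  assumes "module K M" "submodule N K M" "x \<in> carrier M" "y \<in> carrier M"
  shows "(N +>\<^bsub>M\<^esub> x) \<oplus>\<^bsub>quot_algebra M N\<^esub> (N +>\<^bsub>M\<^esub> y) = N +>\<^bsub>M\<^esub> (x \<oplus>\<^bsub>M\<^esub> y)"
  using abelian_subgroup.a_rcos_sum[OF abelian_subgroup_submodule[OF assms(1,2)]] assms by simp

lemma module_quot_algebra:
  assumes "module K M" "submodule N K M"
  shows "module K (quot_algebra M N)"
proof -
  interpret M: module K M by fact
  interpret N: abelian_subgroup N M by (rule abelian_subgroup_submodule[OF assms(1,2)])
  note add = quot_add[OF assms] and smult = quot_smult[OF assms]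
  show ?thesis
  proof (rule moduleI)
    show "cring K" by (rule module_cring[OF assms(1)])
    show "abelian_group (quot_algebra M N)"
    proof (rule abelian_groupI)
      fix U V assume "U \<in> carrier (quot_algebra M N)" "V \<in> carrier (quot_algebra M N)"
      then show "U \<oplus>\<^bsub>quot_algebra M N\<^esub> V = V \<oplus>\<^bsub>quot_algebra M N\<^esub> U"
        by (elim quot_carrierE) (simp add: add M.a_comm del: quot_algebra_simps)
    next
      fix U assume "U \<in> carrier (quot_algebra M N)"
      then show "\<exists>V\<in>carrier (quot_algebra M N). V \<oplus>\<^bsub>quot_algebra M N\<^esub> U = \<zero>\<^bsub>quot_algebra M N\<^esub>"
        using N.a_setinv_closed N.a_rcosets_inv_mult_group_eq by auto
    qed (simp_all add: N.a_setmult_closed N.a_subgroup_in_rcosets N.a_rcosets_assoc N.rcosets_add_eq)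
  next
    fix c U assume "c \<in> carrier K" "U \<in> carrier (quot_algebra M N)"
    then show "c \<odot>\<^bsub>quot_algebra M N\<^esub> U \<in> carrier (quot_algebra M N)"
      by (elim quot_carrierE) (simp add: smult quot_carrierI del: quot_algebra_simps)
  qed (elim quot_carrierE; simp add: add smult M.smult_l_distr M.smult_r_distr M.smult_assoc1
        del: quot_algebra_simps)+
qed

lemma linear_map_coset:
  assumes "module K M" "submodule N K M"
  shows "linear_map K M (quot_algebra M N) (\<lambda>x. N +>\<^bsub>M\<^esub> x)"
  by (rule linear_mapI)
    (simp_all add: quot_add[OF assms] quot_smult[OF assms] quot_carrierI del: quot_algebra_simps)

lemma coset_zero:
  assumes "module K M" "submodule N K M" "x \<in> N"
  shows "N +>\<^bsub>M\<^esub> x = \<zero>\<^bsub>quot_algebra M N\<^esub>"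
proof -
  interpret M: module K M by fact
  show ?thesis
    using M.a_coset_join2[OF _ submodule.axioms(1)[OF assms(2)] assms(3)]
      subsetD[OF M.submoduleE(1)[OF assms(2)] assms(3)] by simp
qed

lemma mspan_image_coset:
  assumes "module K M" "submodule N K M" "S \<subseteq> carrier M" "mspan K M S = carrier M"
  shows "mspan K (quot_algebra M N) ((\<lambda>x. N +>\<^bsub>M\<^esub> x) ` S) = carrier (quot_algebra M N)"
proof -
  note mod = module_quot_algebra[OF assms(1,2)]
  have sub: "(\<lambda>x. N +>\<^bsub>M\<^esub> x) ` S \<subseteq> carrier (quot_algebra M N)"
    by (rule image_subsetI) (rule quot_carrierI[OF subsetD[OF assms(3)]])
  have *: "N +>\<^bsub>M\<^esub> x \<in> mspan K (quot_algebra M N) ((\<lambda>x. N +>\<^bsub>M\<^esub> x) ` S)" if x: "x \<in> carrier M" for x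
  proof (rule linear_map_image_mspan[OF assms(1) mod linear_map_coset[OF assms(1,2)] assms(3)])
    show "x \<in> mspan K M S" using x assms(4) by simp
    show "submodule (mspan K (quot_algebra M N) ((\<lambda>x. N +>\<^bsub>M\<^esub> x) ` S)) K (quot_algebra M N)"
      by (rule submodule_mspan(1)[OF mod sub])
    show "N +>\<^bsub>M\<^esub> s \<in> mspan K (quot_algebra M N) ((\<lambda>x. N +>\<^bsub>M\<^esub> x) ` S)" if "s \<in> S" for s
      by (rule subsetD[OF submodule_mspan(2)[OF mod sub]]) (rule imageI[OF that])
  qed
  show ?thesis
  proof (intro equalityI subsetI)
    fix U assume "U \<in> carrier (quot_algebra M N)"
    then show "U \<in> mspan K (quot_algebra M N) ((\<lambda>x. N +>\<^bsub>M\<^esub> x) ` S)"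
      by (elim quot_carrierE) (simp only: *)
  qed (rule subsetD[OF submodule_mspan(3)[OF mod sub]])
qed

text \<open>Tensor products, symmetric squares, symmetric algebras and the module of tensors are all
  instances, so that their universal property is proved only once.\<close>

locale presentation =
  fixes K :: "('a, 'k) ring_scheme" and X :: "'x set" and S :: "('x \<Rightarrow> 'a) set"
  assumes K_cring: "cring K" and rels: "S \<subseteq> carrier (free_module K X)"
begin

abbreviation "F \<equiv> free_module K X"
abbreviation "N \<equiv> mspan K F S"
abbreviation "P \<equiv> pres_module K X S"

lemma F_module: "module K F"
  by (rule module_free_module[OF K_cring])

lemma N_submodule: "submodule N K F"
  by (rule submodule_mspan(1)[OF F_module rels])

lemma P_module: "module K P"
  unfolding pres_module_def by (rule module_quot_algebra[OF F_module N_submodule])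

lemma gen_closed: "x \<in> X \<Longrightarrow> pres_gen K X S x \<in> carrier P"
  unfolding pres_module_def pres_gen_def by (intro quot_carrierI unit_vec_closed[OF K_cring])

lemma mspan_gens: "mspan K P (pres_gen K X S ` X) = carrier P"
proof -
  have "pres_gen K X S ` X = (\<lambda>x. N +>\<^bsub>F\<^esub> x) ` unit_vec K ` X"
    by (auto simp: pres_gen_def)
  moreover have "unit_vec K ` X \<subseteq> carrier F"
    by (rule image_subsetI) (rule unit_vec_closed[OF K_cring])
  ultimately show ?thesis
    unfolding pres_module_def
    by (simp only: mspan_image_coset[OF F_module N_submodule _ mspan_unit_vecs[OF K_cring]])
qed

lemma linear_eq:
  assumes "module K Z" "linear_map K P Z f" "linear_map K P Z g"
    and "\<And>x. x \<in> X \<Longrightarrow> f (pres_gen K X S x) = g (pres_gen K X S x)" "U \<in> carrier P"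
  shows "f U = g U"
  by (rule linear_map_eq_on_mspan[OF P_module assms(1) _ assms(2,3), of "pres_gen K X S ` X"])
    (use assms(4,5) gen_closed mspan_gens in auto)

text \<open>The extension of \<phi> kills the relations, hence the submodule generated by them, and
  so it is constant on cosets. The image of a coset is a singleton, and only then does
  \<open>the_elem\<close> mean anything.\<close>

lemma pres_lift_coset:
  assumes "module K Z" "\<phi> \<in> X \<rightarrow> carrier Z" "\<And>s. s \<in> S \<Longrightarrow> lin_ext K Z \<phi> s = \<zero>\<^bsub>Z\<^esub>"
    and "p \<in> carrier F"
  shows "pres_lift K Z \<phi> (N +>\<^bsub>F\<^esub> p) = lin_ext K Z \<phi> p"
proof -
  interpret F: module K F by (rule F_module)
  interpret Z: module K Z by fact
  note lin = lin_ext_linear[OF assms(1,2)]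
  have 0: "lin_ext K Z \<phi> s = \<zero>\<^bsub>Z\<^esub>" if "s \<in> N" for s
    by (rule linear_map_eq_on_mspan[OF F_module assms(1) rels lin
          linear_map_const_zero[OF assms(1)] assms(3) that])
  have "lin_ext K Z \<phi> q = lin_ext K Z \<phi> p" if q: "q \<in> N +>\<^bsub>F\<^esub> p" for q
  proof -
    obtain h where h: "h \<in> N" "q = h \<oplus>\<^bsub>F\<^esub> p" using q by (auto simp: a_r_coset_def')
    then have "h \<in> carrier F" using submodule_mspan(3)[OF F_module rels] by auto
    then show ?thesis
      using linear_mapD(2)[OF lin, of h p] linear_mapD(1)[OF lin assms(4)] assms(4) h 0 by simp
  qed
  moreover have "p \<in> N +>\<^bsub>F\<^esub> p"
    using abelian_subgroup.a_rcos_self[OF abelian_subgroup_submodule[OF F_module N_submodule]] assms(4)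
    by auto
  ultimately have "(lin_ext K Z \<phi>) ` (N +>\<^bsub>F\<^esub> p) = {lin_ext K Z \<phi> p}" by blast
  moreover have "lin_ext K Z \<phi> = (\<lambda>p. \<Oplus>\<^bsub>Z\<^esub>x\<in>{x. p x \<noteq> \<zero>\<^bsub>K\<^esub>}. p x \<odot>\<^bsub>Z\<^esub> \<phi> x)"
    by (auto simp: lin_ext_def)
  ultimately show ?thesis unfolding pres_lift_def by (metis the_elem_eq)
qed

lemma pres_lift_gen:
  assumes "module K Z" "\<phi> \<in> X \<rightarrow> carrier Z" "\<And>s. s \<in> S \<Longrightarrow> lin_ext K Z \<phi> s = \<zero>\<^bsub>Z\<^esub>" "x \<in> X"
  shows "pres_lift K Z \<phi> (pres_gen K X S x) = \<phi> x"
  unfolding pres_gen_def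
  by (simp only: pres_lift_coset[OF assms(1-3) unit_vec_closed[OF K_cring assms(4)]]
      lin_ext_unit_vec[OF assms(1,2,4)])

lemma pres_lift_linear:
  assumes "module K Z" "\<phi> \<in> X \<rightarrow> carrier Z" "\<And>s. s \<in> S \<Longrightarrow> lin_ext K Z \<phi> s = \<zero>\<^bsub>Z\<^esub>"
  shows "linear_map K P Z (pres_lift K Z \<phi>)"
proof -
  interpret F: module K F by (rule F_module)
  note lin = lin_ext_linear[OF assms(1,2)]
  note eq = pres_lift_coset[OF assms]
  show ?thesis
    unfolding pres_module_def
  proof (rule linear_mapI)
    fix U assume "U \<in> carrier (quot_algebra F N)"
    then show "pres_lift K Z \<phi> U \<in> carrier Z"
      by (elim quot_carrierE) (simp only: eq linear_mapD(1)[OF lin])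
  next
    fix U V assume "U \<in> carrier (quot_algebra F N)" "V \<in> carrier (quot_algebra F N)"
    then show "pres_lift K Z \<phi> (U \<oplus>\<^bsub>quot_algebra F N\<^esub> V) = pres_lift K Z \<phi> U \<oplus>\<^bsub>Z\<^esub> pres_lift K Z \<phi> V"
      by (elim quot_carrierE)
        (simp only: eq quot_add[OF F_module N_submodule] F.a_closed linear_mapD(2)[OF lin])
  next
    fix c U assume "c \<in> carrier K" "U \<in> carrier (quot_algebra F N)"
    then show "pres_lift K Z \<phi> (c \<odot>\<^bsub>quot_algebra F N\<^esub> U) = c \<odot>\<^bsub>Z\<^esub> pres_lift K Z \<phi> U"
      by (elim quot_carrierE)
        (simp only: eq quot_smult[OF F_module N_submodule] F.smult_closed linear_mapD(3)[OF lin])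
  qed
qed

lemma lin_ext_gen:
  assumes "p \<in> carrier F"
  shows "lin_ext K P (pres_gen K X S) p = N +>\<^bsub>F\<^esub> p"
proof -
  have 1: "linear_map K F P (lin_ext K P (pres_gen K X S))"
    by (rule lin_ext_linear[OF P_module]) (use gen_closed in auto)
  have 2: "linear_map K F P (\<lambda>p. N +>\<^bsub>F\<^esub> p)"
    unfolding pres_module_def by (rule linear_map_coset[OF F_module N_submodule])
  have 3: "unit_vec K ` X \<subseteq> carrier F"
    by (rule image_subsetI) (rule unit_vec_closed[OF K_cring])
  show ?thesis
  proof (rule linear_map_eq_on_mspan[OF F_module P_module 3 1 2])
    show "p \<in> mspan K F (unit_vec K ` X)" using assms mspan_unit_vecs[OF K_cring] by metis
    show "lin_ext K P (pres_gen K X S) v = N +>\<^bsub>F\<^esub> v" if "v \<in> unit_vec K ` X" for v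
      using that lin_ext_unit_vec[OF P_module _, of "pres_gen K X S" X] gen_closed
      by (auto simp: pres_gen_def)
  qed
qed

text \<open>The counterpart of the lifting property: the generators themselves satisfy the
  relations. Through the equivalences \<open>tensor_rels_killed_iff\<close>,
  \<open>sym_rels_killed_iff\<close> and \<open>word_rels_killed_iff\<close>, this yields the
  linearity properties of \<open>tensor_elt\<close>, \<open>sym_monom\<close> and
  \<open>pure\<close>.\<close>

lemma lin_ext_gen_rel:
  assumes "s \<in> S"
  shows "lin_ext K P (pres_gen K X S) s = \<zero>\<^bsub>P\<^esub>"
proof -
  have "s \<in> N" using submodule_mspan(2)[OF F_module rels] assms by auto
  then show ?thesis
    using rels assms lin_ext_gen coset_zero[OF F_module N_submodule] by (auto simp: pres_module_def)
qed

end

text \<open>The products of the definitions are nested lifts of this shape. The inner lift is well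
  defined by \<open>rel2\<close>. For the outer one, the inner lift must kill the relations
  \<open>S\<close> as a function of \<open>x\<close> for every \<open>V\<close>, whereas
  \<open>rel1\<close> gives this only for generators \<open>V\<close>.\<close>

lemma bilinear_pres_lift:
  assumes P1: "presentation K X S" and P2: "presentation K Y T" and Z: "module K Z"
    and closed: "\<And>x y. \<lbrakk>x \<in> X; y \<in> Y\<rbrakk> \<Longrightarrow> \<Psi> x y \<in> carrier Z"
    and rel1: "\<And>s y. \<lbrakk>s \<in> S; y \<in> Y\<rbrakk> \<Longrightarrow> lin_ext K Z (\<lambda>x. \<Psi> x y) s = \<zero>\<^bsub>Z\<^esub>"
    and rel2: "\<And>t x. \<lbrakk>t \<in> T; x \<in> X\<rbrakk> \<Longrightarrow> lin_ext K Z (\<Psi> x) t = \<zero>\<^bsub>Z\<^esub>"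
  defines "b \<equiv> (\<lambda>U V. pres_lift K Z (\<lambda>x. pres_lift K Z (\<Psi> x) V) U)"
  shows "bilinear_map K (pres_module K X S) (pres_module K Y T) Z b"
    and "\<lbrakk>x \<in> X; y \<in> Y\<rbrakk> \<Longrightarrow> b (pres_gen K X S x) (pres_gen K Y T y) = \<Psi> x y"
proof -
  interpret P1: presentation K X S by fact
  interpret P2: presentation K Y T by fact
  have fin2: "linear_map K P2.P Z (pres_lift K Z (\<Psi> x))" if "x \<in> X" for x
    by (rule P2.pres_lift_linear[OF Z]) (use that closed rel2 in auto)
  have gen2: "pres_lift K Z (\<Psi> x) (pres_gen K Y T y) = \<Psi> x y" if "x \<in> X" "y \<in> Y" for x y
    by (rule P2.pres_lift_gen[OF Z]) (use that closed rel2 in auto)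
  have c1: "(\<lambda>x. pres_lift K Z (\<Psi> x) V) \<in> X \<rightarrow> carrier Z" if "V \<in> carrier P2.P" for V
    using that fin2 linear_mapD(1) by fastforce
  have lin_V: "linear_map K P2.P Z (\<lambda>V. lin_ext K Z (\<lambda>x. pres_lift K Z (\<Psi> x) V) p)"
    if "p \<in> carrier P1.F" for p
    by (rule lin_ext_linear_param[OF P2.P_module Z that fin2])
  \<comment> \<open>The left side is linear in \<open>V\<close>, so \<open>rel1\<close> on the
    generators of the second module suffices.\<close>
  have r1: "lin_ext K Z (\<lambda>x. pres_lift K Z (\<Psi> x) V) s = \<zero>\<^bsub>Z\<^esub>" if s: "s \<in> S" and V: "V \<in> carrier P2.P" for s V
  proof (rule P2.linear_eq[OF Z lin_V linear_map_const_zero[OF Z] _ V])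
    show p: "s \<in> carrier P1.F" using P1.rels s by auto
    fix y assume y: "y \<in> Y"
    have "lin_ext K Z (\<lambda>x. pres_lift K Z (\<Psi> x) (pres_gen K Y T y)) s = lin_ext K Z (\<lambda>x. \<Psi> x y) s"
      unfolding lin_ext_def
      by (rule abelian_monoid.finsum_cong')
        (use Z p y closed in \<open>auto simp: module_def abelian_group_def gen2 free_module_carrier subset_iff
          intro!: module.smult_closed[OF Z]\<close>)
    then show "lin_ext K Z (\<lambda>x. pres_lift K Z (\<Psi> x) (pres_gen K Y T y)) s = \<zero>\<^bsub>Z\<^esub>"
      using rel1 s y by simp
  qed
  have fin1: "linear_map K P1.P Z (\<lambda>U. b U V)" if "V \<in> carrier P2.P" for V
    unfolding b_def by (rule P1.pres_lift_linear[OF Z c1 r1]) (use that in auto)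
  have gen1: "b (pres_gen K X S x) V = pres_lift K Z (\<Psi> x) V" if "x \<in> X" "V \<in> carrier P2.P" for x V
    unfolding b_def by (rule P1.pres_lift_gen[OF Z c1 r1]) (use that in auto)
  show "b (pres_gen K X S x) (pres_gen K Y T y) = \<Psi> x y" if "x \<in> X" "y \<in> Y"
    using that gen1 gen2 P2.gen_closed by simp
  \<comment> \<open>A representative \<open>p\<close> of \<open>U\<close> turns \<open>b U\<close>
    into the combination of the maps \<open>pres_lift K Z (\<Psi> x)\<close> with coefficients
    \<open>p x\<close>, each of which is linear.\<close>
  have "linear_map K P2.P Z (b U)" if U: "U \<in> carrier P1.P" for U
  proof -
    obtain p where p: "p \<in> carrier P1.F" "U = P1.N +>\<^bsub>P1.F\<^esub> p"
      using U unfolding pres_module_def by (rule quot_carrierE)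
    show ?thesis
      unfolding p(2)
    proof (rule linear_map_cong[OF P2.P_module _ lin_V[OF p(1)]])
      fix V assume "V \<in> carrier P2.P"
      then show "lin_ext K Z (\<lambda>x. pres_lift K Z (\<Psi> x) V) p = b (P1.N +>\<^bsub>P1.F\<^esub> p) V"
        unfolding b_def by (intro P1.pres_lift_coset[OF Z c1 r1 p(1), symmetric])
    qed
  qed
  then show "bilinear_map K P1.P P2.P Z b" using fin1 by (simp add: bilinear_map_def)
qed

text \<open>All the axioms are equations between multilinear maps and can be tested on a spanning
  set. Associativity is extended from \<open>G\<close> to the carrier one argument at a time,
  beginning with the last.\<close>

lemma algebra_by_generators:
  assumes M: "module K A" and bil: "bilinear_map K A A A (mult A)"
    and one: "\<one>\<^bsub>A\<^esub> \<in> carrier A" and G: "G \<subseteq> carrier A" "mspan K A G = carrier A"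
    and unit: "\<And>x. x \<in> G \<Longrightarrow> \<one>\<^bsub>A\<^esub> \<otimes>\<^bsub>A\<^esub> x = x"
    and comm: "\<And>x y. \<lbrakk>x \<in> G; y \<in> G\<rbrakk> \<Longrightarrow> x \<otimes>\<^bsub>A\<^esub> y = y \<otimes>\<^bsub>A\<^esub> x"
    and assoc: "\<And>x y z. \<lbrakk>x \<in> G; y \<in> G; z \<in> G\<rbrakk> \<Longrightarrow> (x \<otimes>\<^bsub>A\<^esub> y) \<otimes>\<^bsub>A\<^esub> z = x \<otimes>\<^bsub>A\<^esub> (y \<otimes>\<^bsub>A\<^esub> z)"
  shows "algebra K A"
proof -
  interpret M: module K A by fact
  note closed = bilinear_map_closed[OF bil]
  note lin1 = bilinear_mapD(1)[OF bil] and lin2 = bilinear_mapD(2)[OF bil]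
  have flip: "bilinear_map K A A A (\<lambda>x y. y \<otimes>\<^bsub>A\<^esub> x)"
    using bil by (simp add: bilinear_map_def)
  have comm': "x \<otimes>\<^bsub>A\<^esub> y = y \<otimes>\<^bsub>A\<^esub> x" if "x \<in> carrier A" "y \<in> carrier A" for x y
    by (rule bilinear_map_eq_on_mspan[OF M M M G(1) G(1) bil flip comm]) (use that G in auto)
  have unit': "\<one>\<^bsub>A\<^esub> \<otimes>\<^bsub>A\<^esub> x = x" if "x \<in> carrier A" for x
    by (rule linear_map_eq_on_mspan[OF M M G(1) lin1[OF one] _ unit])
      (use that G in \<open>auto simp: linear_map_def\<close>)
  have assoc1: "(x \<otimes>\<^bsub>A\<^esub> y) \<otimes>\<^bsub>A\<^esub> z = x \<otimes>\<^bsub>A\<^esub> (y \<otimes>\<^bsub>A\<^esub> z)"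
    if "x \<in> G" "y \<in> G" "z \<in> carrier A" for x y z
  proof (rule linear_map_eq_on_mspan[OF M M G(1) lin1 linear_map_compose[OF lin1 lin1] assoc])
    show "x \<otimes>\<^bsub>A\<^esub> y \<in> carrier A" using that G(1) by (auto intro!: closed)
  qed (use that G in auto)
  have assoc2: "(x \<otimes>\<^bsub>A\<^esub> y) \<otimes>\<^bsub>A\<^esub> z = x \<otimes>\<^bsub>A\<^esub> (y \<otimes>\<^bsub>A\<^esub> z)"
    if "x \<in> G" "y \<in> carrier A" "z \<in> carrier A" for x y z
  proof (rule linear_map_eq_on_mspan[OF M M G(1) linear_map_compose[OF lin1 lin2]
        linear_map_compose[OF lin2 lin1] assoc1])
  qed (use that G in auto)
  have assoc': "(x \<otimes>\<^bsub>A\<^esub> y) \<otimes>\<^bsub>A\<^esub> z = x \<otimes>\<^bsub>A\<^esub> (y \<otimes>\<^bsub>A\<^esub> z)"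
    if "x \<in> carrier A" "y \<in> carrier A" "z \<in> carrier A" for x y z
  proof (rule linear_map_eq_on_mspan[OF M M G(1) linear_map_compose[OF lin2 lin2] lin2 assoc2])
    show "y \<otimes>\<^bsub>A\<^esub> z \<in> carrier A" using that by (auto intro!: closed)
  qed (use that G in auto)
  have "cring A"
  proof (rule cringI)
    show "abelian_group A" ..
    show "Group.comm_monoid A"
      by (rule comm_monoidI) (use closed one assoc' unit' comm' in auto)
  qed (use linear_mapD(2)[OF lin2] in auto)
  then show ?thesis
    by (intro algebraI module_cring[OF M])
      (auto simp: M.smult_l_distr M.smult_r_distr M.smult_assoc1 linear_mapD(3)[OF lin2])
qed

lemma bilinear_mult:
  assumes "algebra K A"
  shows "bilinear_map K A A A (mult A)"
proof -
  interpret A: algebra K A by fact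
  have "x \<otimes>\<^bsub>A\<^esub> (c \<odot>\<^bsub>A\<^esub> y) = c \<odot>\<^bsub>A\<^esub> (x \<otimes>\<^bsub>A\<^esub> y)"
    if "c \<in> carrier K" "x \<in> carrier A" "y \<in> carrier A" for c x y
    using that A.smult_assoc2[of c y x] by (simp add: A.m_comm)
  then show ?thesis
    by (auto simp: bilinear_map_def linear_map_def A.smult_assoc2 A.l_distr A.r_distr)
qed

section \<open>Sums indexed by lists\<close>

primrec lsum :: "('b, 'z) ring_scheme \<Rightarrow> ('x \<Rightarrow> 'b) \<Rightarrow> 'x list \<Rightarrow> 'b" where
  "lsum M \<phi> [] = \<zero>\<^bsub>M\<^esub>"
| "lsum M \<phi> (x # xs) = \<phi> x \<oplus>\<^bsub>M\<^esub> lsum M \<phi> xs"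

lemma lsum_map [simp]: "lsum M \<phi> (map f xs) = lsum M (\<lambda>x. \<phi> (f x)) xs"
  by (induction xs) auto

lemma lsum_cong: "(\<And>x. x \<in> set xs \<Longrightarrow> \<phi> x = \<psi> x) \<Longrightarrow> lsum M \<phi> xs = lsum M \<psi> xs"
  by (induction xs) auto

context abelian_monoid
begin

lemma lsum_closed [simp]:
  "(\<And>x. x \<in> set xs \<Longrightarrow> \<phi> x \<in> carrier G) \<Longrightarrow> lsum G \<phi> xs \<in> carrier G"
  by (induction xs) auto

lemma lsum_append [simp]:
  assumes "\<And>x. x \<in> set xs \<Longrightarrow> \<phi> x \<in> carrier G" "\<And>x. x \<in> set ys \<Longrightarrow> \<phi> x \<in> carrier G"
  shows "lsum G \<phi> (xs @ ys) = lsum G \<phi> xs \<oplus> lsum G \<phi> ys"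
  using assms by (induction xs) (auto simp: a_assoc)

lemma lsum_zero: "(\<And>x. x \<in> set xs \<Longrightarrow> \<phi> x = \<zero>) \<Longrightarrow> lsum G \<phi> xs = \<zero>"
  by (induction xs) auto

lemma lsum_add:
  assumes "\<And>x. x \<in> set xs \<Longrightarrow> \<phi> x \<in> carrier G" "\<And>x. x \<in> set xs \<Longrightarrow> \<psi> x \<in> carrier G"
  shows "lsum G (\<lambda>x. \<phi> x \<oplus> \<psi> x) xs = lsum G \<phi> xs \<oplus> lsum G \<psi> xs"
  using assms by (induction xs) (auto simp: a_ac)

lemma lsum_swap:
  assumes "\<And>x y. \<lbrakk>x \<in> set xs; y \<in> set ys\<rbrakk> \<Longrightarrow> \<phi> x y \<in> carrier G"
  shows "lsum G (\<lambda>x. lsum G (\<phi> x) ys) xs = lsum G (\<lambda>y. lsum G (\<lambda>x. \<phi> x y) xs) ys"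
  using assms
proof (induction xs)
  case Nil
  show ?case by (simp add: lsum_zero)
next
  case (Cons x xs)
  then show ?case by (simp add: lsum_add)
qed

text \<open>Connects the sums over index intervals in \<open>J2_rel\<close> and
  \<open>C2T_pure_mult\<close> with sums over lists.\<close>

lemma finsum_eq_lsum:
  assumes "\<And>i. i \<in> {a..<b} \<Longrightarrow> \<phi> i \<in> carrier G"
  shows "finsum G \<phi> {a..<b} = lsum G \<phi> [a..<b]"
proof -
  have "finsum G \<phi> (set xs) = lsum G \<phi> xs" if "distinct xs" "\<And>i. i \<in> set xs \<Longrightarrow> \<phi> i \<in> carrier G" for xs
    using that by (induction xs) (auto simp: Pi_def)
  from this[of "[a..<b]"] show ?thesis using assms by simp
qed

end

lemma linear_map_lsum:
  assumes "module K M" "module K N" "linear_map K M N f" "\<And>x. x \<in> set xs \<Longrightarrow> \<phi> x \<in> carrier M"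
  shows "f (lsum M \<phi> xs) = lsum N (\<lambda>x. f (\<phi> x)) xs"
proof -
  interpret M: module K M by fact
  show ?thesis
    using assms(4)
  proof (induction xs)
    case Nil
    show ?case using linear_map_zero[OF assms(1-3)] by simp
  next
    case (Cons x xs)
    then show ?case using linear_mapD(2)[OF assms(3), of "\<phi> x" "lsum M \<phi> xs"] by auto
  qed
qed

lemma linear_map_lsum_param:
  assumes "module K N" "\<And>a. a \<in> set xs \<Longrightarrow> linear_map K M N (f a)"
  shows "linear_map K M N (\<lambda>x. lsum N (\<lambda>a. f a x) xs)"
  using assms(2)
  by (induction xs) (simp_all add: linear_map_const_zero[OF assms(1)] linear_map_add[OF assms(1)])

section \<open>Deconcatenation and shuffles of words\<close>

text \<open>The deconcatenation coproduct of a word. The recursive form serves inductions;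
  \<open>splits_eq\<close> gives the form by indices that occurs in the definitions.\<close>

primrec splits :: "'v list \<Rightarrow> ('v list \<times> 'v list) list" where
  "splits [] = [([], [])]"
| "splits (x # w) = ([], x # w) # map (\<lambda>p. (x # fst p, snd p)) (splits w)"

text \<open>A list rather than a set: one word can arise from several interleavings and has to be
  counted with its multiplicity.\<close>

fun shuffle_list :: "'v list \<Rightarrow> 'v list \<Rightarrow> 'v list list" where
  "shuffle_list [] w = [w]"
| "shuffle_list (x # u) [] = [x # u]"
| "shuffle_list (x # u) (y # w) =
     map ((#) x) (shuffle_list u (y # w)) @ map ((#) y) (shuffle_list (x # u) w)"

lemma splits_eq: "splits w = map (\<lambda>i. (take i w, drop i w)) [0..<Suc (length w)]"
proof (induction w)
  case (Cons x w)
  have "[0..<Suc (length (x # w))] = 0 # map Suc [0..<Suc (length w)]"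
    by (simp add: upt_conv_Cons map_Suc_upt del: upt_Suc)
  then show ?case using Cons by (simp del: upt_Suc)
qed simp

lemma shuffle_list_Nil2 [simp]: "shuffle_list w [] = [w]"
  by (cases w) auto

text \<open>A cut of a word with a marked letter \<open>x\<close> falls either before or behind
  \<open>x\<close>. This isolates the dependence on \<open>x\<close> in
  \<open>word_multilinear_splits\<close>.\<close>

lemma splits_append_Cons:
  "splits (u @ x # w) =
     map (\<lambda>p. (fst p, snd p @ x # w)) (splits u) @ map (\<lambda>p. (u @ x # fst p, snd p)) (splits w)"
  by (induction u) auto

lemma append_splits: "p \<in> set (splits w) \<Longrightarrow> fst p @ snd p = w"
  by (induction w arbitrary: p) auto

lemma lists_splits:
  assumes "p \<in> set (splits w)" "w \<in> lists A"
  shows "fst p \<in> lists A" "snd p \<in> lists A"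
  using append_splits[OF assms(1)] assms(2) append_in_lists_conv by metis+

lemma set_shuffle_list: "w \<in> set (shuffle_list u v) \<Longrightarrow> set w = set u \<union> set v"
  by (induction u v arbitrary: w rule: shuffle_list.induct) auto

lemma lists_shuffle_list:
  "\<lbrakk>w \<in> set (shuffle_list u v); u \<in> lists A; v \<in> lists A\<rbrakk> \<Longrightarrow> w \<in> lists A"
  using set_shuffle_list by (fastforce simp: in_lists_conv_set)

lemma length_shuffle_list: "w \<in> set (shuffle_list u v) \<Longrightarrow> length w = length u + length v"
  by (induction u v arbitrary: w rule: shuffle_list.induct) auto

context abelian_monoid
begin

text \<open>Deconcatenation is multiplicative for the shuffle product.\<close>

lemma lsum_splits_shuffle:
  assumes "\<And>u v. F u v \<in> carrier G"
  shows "lsum G (\<lambda>w. lsum G (\<lambda>r. F (fst r) (snd r)) (splits w)) (shuffle_list f g) =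
    lsum G (\<lambda>p. lsum G (\<lambda>q. lsum G (\<lambda>u. lsum G (\<lambda>v. F u v)
      (shuffle_list (snd p) (snd q))) (shuffle_list (fst p) (fst q))) (splits g)) (splits f)"
  using assms
proof (induction f g arbitrary: F rule: shuffle_list.induct)
  case (3 x f y g)
  \<comment> \<open>The induction is over arbitrary \<open>F\<close>: the leading letter that the
    recursion takes off is absorbed into the first argument of \<open>F\<close>.\<close>
  have IH1: "lsum G (\<lambda>w. lsum G (\<lambda>r. F (x # fst r) (snd r)) (splits w)) (shuffle_list f (y # g)) =
    lsum G (\<lambda>p. lsum G (\<lambda>q. lsum G (\<lambda>u. lsum G (\<lambda>v. F (x # u) v)
      (shuffle_list (snd p) (snd q))) (shuffle_list (fst p) (fst q))) (splits (y # g))) (splits f)"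
    by (rule "3.IH"(1)) (rule 3(3))
  have IH2: "lsum G (\<lambda>w. lsum G (\<lambda>r. F (y # fst r) (snd r)) (splits w)) (shuffle_list (x # f) g) =
    lsum G (\<lambda>p. lsum G (\<lambda>q. lsum G (\<lambda>u. lsum G (\<lambda>v. F (y # u) v)
      (shuffle_list (snd p) (snd q))) (shuffle_list (fst p) (fst q))) (splits g)) (splits (x # f))"
    by (rule "3.IH"(2)) (rule 3(3))
  show ?case
    using "3.prems" IH1 IH2 by (simp add: lsum_add a_ac)
qed simp_all

text \<open>Both sides run over the ways to cut a word into three segments. As before, the induction
  absorbs the leading letter into \<open>F\<close>.\<close>

lemma lsum_splits_coassoc:
  assumes "\<And>a b c. F a b c \<in> carrier G"
  shows "lsum G (\<lambda>p. lsum G (\<lambda>q. F (fst q) (snd q) (snd p)) (splits (fst p))) (splits w) =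
    lsum G (\<lambda>p. lsum G (\<lambda>q. F (fst p) (fst q) (snd q)) (splits (snd p))) (splits w)"
  using assms
proof (induction w arbitrary: F)
  case (Cons x w)
  have IH: "lsum G (\<lambda>p. lsum G (\<lambda>q. F (x # fst q) (snd q) (snd p)) (splits (fst p))) (splits w) =
    lsum G (\<lambda>p. lsum G (\<lambda>q. F (x # fst p) (fst q) (snd q)) (splits (snd p))) (splits w)"
    by (rule Cons.IH) (rule Cons.prems)
  show ?case using Cons.prems IH by (simp add: lsum_add a_ac)
qed simp

end

section \<open>Relations in free modules, read as equations\<close>

lemma ball_Collect3:
  "(\<forall>s\<in>{f x y z | x y z. P x y z}. Q s) \<longleftrightarrow> (\<forall>x y z. P x y z \<longrightarrow> Q (f x y z))"
  by blast

lemma free_minus_closed: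
  assumes "cring K" "p \<in> carrier (free_module K X)" "q \<in> carrier (free_module K X)"
  shows "p \<ominus>\<^bsub>free_module K X\<^esub> q \<in> carrier (free_module K X)"
proof -
  interpret F: module K "free_module K X" by (rule module_free_module[OF assms(1)])
  show ?thesis by (rule F.minus_closed[OF assms(2,3)])
qed

lemma free_add_closed:
  assumes "cring K" "p \<in> carrier (free_module K X)" "q \<in> carrier (free_module K X)"
  shows "p \<oplus>\<^bsub>free_module K X\<^esub> q \<in> carrier (free_module K X)"
proof -
  interpret F: module K "free_module K X" by (rule module_free_module[OF assms(1)])
  show ?thesis by (rule F.a_closed[OF assms(2,3)])
qed

lemma free_smult_closed:
  assumes "cring K" "c \<in> carrier K" "q \<in> carrier (free_module K X)"
  shows "c \<odot>\<^bsub>free_module K X\<^esub> q \<in> carrier (free_module K X)"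
proof -
  interpret F: module K "free_module K X" by (rule module_free_module[OF assms(1)])
  show ?thesis by (rule F.smult_closed[OF assms(2,3)])
qed

lemmas free_closed = free_minus_closed free_add_closed free_smult_closed unit_vec_closed

lemma lin_ext_minus_eq_zero_iff:
  assumes "module K Z" "\<phi> \<in> X \<rightarrow> carrier Z" "p \<in> carrier (free_module K X)" "q \<in> carrier (free_module K X)"
  shows "lin_ext K Z \<phi> (p \<ominus>\<^bsub>free_module K X\<^esub> q) = \<zero>\<^bsub>Z\<^esub> \<longleftrightarrow> lin_ext K Z \<phi> p = lin_ext K Z \<phi> q"
proof -
  interpret Z: module K Z by fact
  note lin = lin_ext_linear[OF assms(1,2)]
  show ?thesis
    unfolding linear_map_minus[OF module_free_module[OF module_cring[OF assms(1)]] assms(1) lin assms(3,4)]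
    by (rule Z.M.minus_eq_zero_iff[OF linear_mapD(1)[OF lin assms(3)] linear_mapD(1)[OF lin assms(4)]])
qed

lemma lin_ext_additivity_rel:
  assumes "module K Z" "\<phi> \<in> X \<rightarrow> carrier Z" "x \<in> X" "y \<in> X" "z \<in> X"
  shows "lin_ext K Z \<phi> (unit_vec K x \<ominus>\<^bsub>free_module K X\<^esub> (unit_vec K y \<oplus>\<^bsub>free_module K X\<^esub> unit_vec K z)) = \<zero>\<^bsub>Z\<^esub>
    \<longleftrightarrow> \<phi> x = \<phi> y \<oplus>\<^bsub>Z\<^esub> \<phi> z"
proof -
  note K = module_cring[OF assms(1)]
  note e = unit_vec_closed[OF K]
  show ?thesis
    unfolding lin_ext_minus_eq_zero_iff[OF assms(1,2) e[OF assms(3)] free_add_closed[OF K e[OF assms(4)] e[OF assms(5)]]]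
      linear_mapD(2)[OF lin_ext_linear[OF assms(1,2)] e[OF assms(4)] e[OF assms(5)]]
    by (simp only: lin_ext_unit_vec[OF assms(1,2)] assms(3-5))
qed

lemma lin_ext_scaling_rel:
  assumes "module K Z" "\<phi> \<in> X \<rightarrow> carrier Z" "x \<in> X" "y \<in> X" "c \<in> carrier K"
  shows "lin_ext K Z \<phi> (unit_vec K x \<ominus>\<^bsub>free_module K X\<^esub> c \<odot>\<^bsub>free_module K X\<^esub> unit_vec K y) = \<zero>\<^bsub>Z\<^esub>
    \<longleftrightarrow> \<phi> x = c \<odot>\<^bsub>Z\<^esub> \<phi> y"
proof -
  note K = module_cring[OF assms(1)]
  note e = unit_vec_closed[OF K]
  show ?thesis
    unfolding lin_ext_minus_eq_zero_iff[OF assms(1,2) e[OF assms(3)] free_smult_closed[OF K assms(5) e[OF assms(4)]]]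
      linear_mapD(3)[OF lin_ext_linear[OF assms(1,2)] assms(5) e[OF assms(4)]]
    by (simp only: lin_ext_unit_vec[OF assms(1,2)] assms(3,4))
qed

lemma lin_ext_swap_rel:
  assumes "module K Z" "\<phi> \<in> X \<rightarrow> carrier Z" "x \<in> X" "y \<in> X"
  shows "lin_ext K Z \<phi> (unit_vec K x \<ominus>\<^bsub>free_module K X\<^esub> unit_vec K y) = \<zero>\<^bsub>Z\<^esub> \<longleftrightarrow> \<phi> x = \<phi> y"
  unfolding lin_ext_minus_eq_zero_iff[OF assms(1,2) unit_vec_closed[OF module_cring[OF assms(1)] assms(3)]
      unit_vec_closed[OF module_cring[OF assms(1)] assms(4)]]
  by (simp only: lin_ext_unit_vec[OF assms(1,2)] assms(3,4))

section \<open>Tensor products\<close>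

context
  fixes K :: "('a, 'k) ring_scheme" and M :: "('a, 'm, 'y) module_scheme" and N :: "('a, 'n, 'z) module_scheme"
  assumes M: "module K M" and N: "module K N"
begin

interpretation M: module K M by (rule M)
interpretation N: module K N by (rule N)

lemma tensor_presentation: "presentation K (carrier M \<times> carrier N) (tensor_rels K M N)"
proof (rule presentation.intro)
  show K: "cring K" by (rule module_cring[OF M])
  show "tensor_rels K M N \<subseteq> carrier (free_module K (carrier M \<times> carrier N))"
    unfolding tensor_rels_def Let_def
    by (auto simp del: free_module_simps intro!: free_closed[OF K])
qed

lemma module_tensor: "module K (tensor K M N)"
  unfolding tensor_def by (rule presentation.P_module[OF tensor_presentation])

text \<open>Both directions are used: from right to left to lift a bilinear map to the tensor
  product, and from left to right to obtain the bilinearity of \<open>tensor_elt\<close>.\<close>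

lemma tensor_rels_killed_iff:
  assumes Z: "module K Z" and \<phi>: "\<phi> \<in> carrier M \<times> carrier N \<rightarrow> carrier Z"
  shows "(\<forall>s\<in>tensor_rels K M N. lin_ext K Z \<phi> s = \<zero>\<^bsub>Z\<^esub>) \<longleftrightarrow> bilinear_map K M N Z (\<lambda>x y. \<phi> (x, y))"
proof -
  have closed: "\<phi> (x, y) \<in> carrier Z" if "x \<in> carrier M" "y \<in> carrier N" for x y
    using \<phi> that by auto
  have "(\<forall>s\<in>tensor_rels K M N. lin_ext K Z \<phi> s = \<zero>\<^bsub>Z\<^esub>) \<longleftrightarrow>
    (\<forall>x x' y. x \<in> carrier M \<and> x' \<in> carrier M \<and> y \<in> carrier N \<longrightarrow>
        \<phi> (x \<oplus>\<^bsub>M\<^esub> x', y) = \<phi> (x, y) \<oplus>\<^bsub>Z\<^esub> \<phi> (x', y)) \<and>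
    (\<forall>x y y'. x \<in> carrier M \<and> y \<in> carrier N \<and> y' \<in> carrier N \<longrightarrow>
        \<phi> (x, y \<oplus>\<^bsub>N\<^esub> y') = \<phi> (x, y) \<oplus>\<^bsub>Z\<^esub> \<phi> (x, y')) \<and>
    (\<forall>c x y. c \<in> carrier K \<and> x \<in> carrier M \<and> y \<in> carrier N \<longrightarrow>
        \<phi> (c \<odot>\<^bsub>M\<^esub> x, y) = c \<odot>\<^bsub>Z\<^esub> \<phi> (x, y)) \<and>
    (\<forall>c x y. c \<in> carrier K \<and> x \<in> carrier M \<and> y \<in> carrier N \<longrightarrow>
        \<phi> (x, c \<odot>\<^bsub>N\<^esub> y) = c \<odot>\<^bsub>Z\<^esub> \<phi> (x, y))"
    (is "_ \<longleftrightarrow> ?A1 \<and> ?A2 \<and> ?A3 \<and> ?A4")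
  proof -
    let ?F = "free_module K (carrier M \<times> carrier N)" and ?e = "unit_vec K"
    have 1: "(\<forall>s\<in>{?e (x \<oplus>\<^bsub>M\<^esub> x', y) \<ominus>\<^bsub>?F\<^esub> (?e (x, y) \<oplus>\<^bsub>?F\<^esub> ?e (x', y)) | x x' y.
        x \<in> carrier M \<and> x' \<in> carrier M \<and> y \<in> carrier N}. lin_ext K Z \<phi> s = \<zero>\<^bsub>Z\<^esub>) \<longleftrightarrow> ?A1"
      unfolding ball_Collect3
      by (intro all_cong1 imp_cong refl lin_ext_additivity_rel[OF Z \<phi>]) auto
    have 2: "(\<forall>s\<in>{?e (x, y \<oplus>\<^bsub>N\<^esub> y') \<ominus>\<^bsub>?F\<^esub> (?e (x, y) \<oplus>\<^bsub>?F\<^esub> ?e (x, y')) | x y y'.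
        x \<in> carrier M \<and> y \<in> carrier N \<and> y' \<in> carrier N}. lin_ext K Z \<phi> s = \<zero>\<^bsub>Z\<^esub>) \<longleftrightarrow> ?A2"
      unfolding ball_Collect3
      by (intro all_cong1 imp_cong refl lin_ext_additivity_rel[OF Z \<phi>]) auto
    have 3: "(\<forall>s\<in>{?e (c \<odot>\<^bsub>M\<^esub> x, y) \<ominus>\<^bsub>?F\<^esub> c \<odot>\<^bsub>?F\<^esub> ?e (x, y) | c x y.
        c \<in> carrier K \<and> x \<in> carrier M \<and> y \<in> carrier N}. lin_ext K Z \<phi> s = \<zero>\<^bsub>Z\<^esub>) \<longleftrightarrow> ?A3"
      unfolding ball_Collect3
      by (intro all_cong1 imp_cong refl lin_ext_scaling_rel[OF Z \<phi>]) auto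
    have 4: "(\<forall>s\<in>{?e (x, c \<odot>\<^bsub>N\<^esub> y) \<ominus>\<^bsub>?F\<^esub> c \<odot>\<^bsub>?F\<^esub> ?e (x, y) | c x y.
        c \<in> carrier K \<and> x \<in> carrier M \<and> y \<in> carrier N}. lin_ext K Z \<phi> s = \<zero>\<^bsub>Z\<^esub>) \<longleftrightarrow> ?A4"
      unfolding ball_Collect3
      by (intro all_cong1 imp_cong refl lin_ext_scaling_rel[OF Z \<phi>]) auto
    show ?thesis unfolding tensor_rels_def Let_def ball_Un 1 2 3 4 by simp
  qed
  then show ?thesis
    unfolding bilinear_map_def linear_map_def using closed by auto
qed

lemma bilinear_tensor_elt: "bilinear_map K M N (tensor K M N) (tensor_elt K M N)"
proof -
  interpret P: presentation K "carrier M \<times> carrier N" "tensor_rels K M N" by (rule tensor_presentation)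
  have "bilinear_map K M N P.P (\<lambda>x y. pres_gen K (carrier M \<times> carrier N) (tensor_rels K M N) (x, y))"
    by (subst tensor_rels_killed_iff[OF P.P_module, symmetric]) (use P.gen_closed P.lin_ext_gen_rel in auto)
  then show ?thesis by (simp add: tensor_def tensor_elt_def[abs_def])
qed

text \<open>Stated for spanning sets of the factors because \<open>C2 \<otimes> T\<close> is to be
  spanned by tensors whose second factor is pure. The second factor is extended first, with the
  first one still in \<open>G\<close>.\<close>

lemma mspan_tensor_elts:
  assumes "G \<subseteq> carrier M" "mspan K M G = carrier M" "H \<subseteq> carrier N" "mspan K N H = carrier N"
  shows "mspan K (tensor K M N) {tensor_elt K M N x y | x y. x \<in> G \<and> y \<in> H} = carrier (tensor K M N)"
    (is "?L = ?R")
proof -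
  interpret P: presentation K "carrier M \<times> carrier N" "tensor_rels K M N" by (rule tensor_presentation)
  note bil = bilinear_tensor_elt
  let ?S = "{tensor_elt K M N x y | x y. x \<in> G \<and> y \<in> H}"
  have S: "?S \<subseteq> carrier (tensor K M N)"
    using assms(1,3) by (auto intro!: bilinear_map_closed[OF bil])
  note sm = submodule_mspan[OF module_tensor S]
  have 1: "tensor_elt K M N x y \<in> ?L" if "x \<in> G" "y \<in> carrier N" for x y
  proof (rule linear_map_image_mspan[OF N module_tensor bilinear_mapD(1)[OF bil] assms(3) _ sm(1)])
    show "x \<in> carrier M" "y \<in> mspan K N H" using that assms by auto
    show "tensor_elt K M N x h \<in> ?L" if "h \<in> H" for h
      using sm(2) that \<open>x \<in> G\<close> by blast
  qed
  have 2: "tensor_elt K M N x y \<in> ?L" if "x \<in> carrier M" "y \<in> carrier N" for x y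
    by (rule linear_map_image_mspan[OF M module_tensor bilinear_mapD(2)[OF bil that(2)] assms(1) _ sm(1)])
      (use that assms 1 in auto)
  have "mspan K (tensor K M N) (pres_gen K (carrier M \<times> carrier N) (tensor_rels K M N) ` (carrier M \<times> carrier N)) \<subseteq> ?L"
    by (rule mspan_minimal[OF sm(1)]) (use 2 in \<open>auto simp: tensor_elt_def\<close>)
  then show ?thesis
    using P.mspan_gens sm(3) by (simp add: tensor_def)
qed

lemma mspan_tensor_all:
  "mspan K (tensor K M N) {tensor_elt K M N x y | x y. x \<in> carrier M \<and> y \<in> carrier N} = carrier (tensor K M N)"
  using submodule_mspan(2,3)[OF M order_refl] submodule_mspan(2,3)[OF N order_refl]
  by (intro mspan_tensor_elts) auto

lemma tensor_lift:
  assumes Z: "module K Z" and b: "bilinear_map K M N Z b"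
  shows "linear_map K (tensor K M N) Z (pres_lift K Z (\<lambda>(x, y). b x y))"
    and "\<lbrakk>x \<in> carrier M; y \<in> carrier N\<rbrakk> \<Longrightarrow>
      pres_lift K Z (\<lambda>(x, y). b x y) (tensor_elt K M N x y) = b x y"
proof -
  interpret P: presentation K "carrier M \<times> carrier N" "tensor_rels K M N" by (rule tensor_presentation)
  have \<phi>: "(\<lambda>(x, y). b x y) \<in> carrier M \<times> carrier N \<rightarrow> carrier Z"
    using bilinear_map_closed[OF b] by auto
  have kill: "\<And>s. s \<in> tensor_rels K M N \<Longrightarrow> lin_ext K Z (\<lambda>(x, y). b x y) s = \<zero>\<^bsub>Z\<^esub>"
    using b tensor_rels_killed_iff[OF Z \<phi>] by simp
  show "linear_map K (tensor K M N) Z (pres_lift K Z (\<lambda>(x, y). b x y))"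
    unfolding tensor_def by (rule P.pres_lift_linear[OF Z \<phi> kill])
  show "pres_lift K Z (\<lambda>(x, y). b x y) (tensor_elt K M N x y) = b x y"
    if "x \<in> carrier M" "y \<in> carrier N"
    unfolding tensor_elt_def using P.pres_lift_gen[OF Z \<phi> kill, of "(x, y)"] that by simp
qed

lemma tensor_linear_eq:
  assumes "module K Z" "linear_map K (tensor K M N) Z f" "linear_map K (tensor K M N) Z g"
    and "\<And>x y. \<lbrakk>x \<in> carrier M; y \<in> carrier N\<rbrakk> \<Longrightarrow> f (tensor_elt K M N x y) = g (tensor_elt K M N x y)"
    and "U \<in> carrier (tensor K M N)"
  shows "f U = g U"
  using presentation.linear_eq[OF tensor_presentation assms(1), of f g] assms(2-5)
  by (auto simp: tensor_def tensor_elt_def)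

end

text \<open>The nested lifts have the shape of the products of \<open>tensor_algebra\<close> and
  \<open>C2T\<close>. Linearity of \<Psi> in its first two arguments makes the outer lift well
  defined, and linearity in the last two the inner one.\<close>

lemma tensor_bilinear_lift:
  assumes "module K M" "module K N" "module K M'" "module K N'" "module K Z"
    and closed: "\<And>x y x' y'. \<lbrakk>x \<in> carrier M; y \<in> carrier N; x' \<in> carrier M'; y' \<in> carrier N'\<rbrakk>
      \<Longrightarrow> \<Psi> x y x' y' \<in> carrier Z"
    and b1: "\<And>x' y'. \<lbrakk>x' \<in> carrier M'; y' \<in> carrier N'\<rbrakk> \<Longrightarrow> bilinear_map K M N Z (\<lambda>x y. \<Psi> x y x' y')"
    and b2: "\<And>x y. \<lbrakk>x \<in> carrier M; y \<in> carrier N\<rbrakk> \<Longrightarrow> bilinear_map K M' N' Z (\<Psi> x y)"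
  defines "b \<equiv> (\<lambda>U V. pres_lift K Z (\<lambda>(x, y). pres_lift K Z (\<lambda>(x', y'). \<Psi> x y x' y') V) U)"
  shows "bilinear_map K (tensor K M N) (tensor K M' N') Z b"
    and "\<lbrakk>x \<in> carrier M; y \<in> carrier N; x' \<in> carrier M'; y' \<in> carrier N'\<rbrakk> \<Longrightarrow>
      b (tensor_elt K M N x y) (tensor_elt K M' N' x' y') = \<Psi> x y x' y'"
proof -
  let ?\<Psi> = "\<lambda>p q. \<Psi> (fst p) (snd p) (fst q) (snd q)"
  have b: "b = (\<lambda>U V. pres_lift K Z (\<lambda>p. pres_lift K Z (?\<Psi> p) V) U)"
    unfolding b_def by (simp add: case_prod_unfold)
  note P1 = tensor_presentation[OF assms(1,2)] and P2 = tensor_presentation[OF assms(3,4)]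
  have r1: "lin_ext K Z (\<lambda>p. ?\<Psi> p q) s = \<zero>\<^bsub>Z\<^esub>"
    if "s \<in> tensor_rels K M N" "q \<in> carrier M' \<times> carrier N'" for s q
  proof -
    have "(\<lambda>p. ?\<Psi> p q) \<in> carrier M \<times> carrier N \<rightarrow> carrier Z" using closed that(2) by auto
    from tensor_rels_killed_iff[OF assms(1,2,5) this] b1 that show ?thesis by auto
  qed
  have r2: "lin_ext K Z (?\<Psi> p) s = \<zero>\<^bsub>Z\<^esub>"
    if "s \<in> tensor_rels K M' N'" "p \<in> carrier M \<times> carrier N" for s p
  proof -
    have "?\<Psi> p \<in> carrier M' \<times> carrier N' \<rightarrow> carrier Z" using closed that(2) by auto
    from tensor_rels_killed_iff[OF assms(3,4,5) this] b2 that show ?thesis by auto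
  qed
  have c: "?\<Psi> p q \<in> carrier Z" if "p \<in> carrier M \<times> carrier N" "q \<in> carrier M' \<times> carrier N'" for p q
    using closed that by auto
  show "bilinear_map K (tensor K M N) (tensor K M' N') Z b"
    unfolding b tensor_def by (rule bilinear_pres_lift(1)[OF P1 P2 assms(5) c r1 r2])
  show "b (tensor_elt K M N x y) (tensor_elt K M' N' x' y') = \<Psi> x y x' y'"
    if "x \<in> carrier M" "y \<in> carrier N" "x' \<in> carrier M'" "y' \<in> carrier N'"
    unfolding b tensor_elt_def
    using bilinear_pres_lift(2)[OF P1 P2 assms(5) c r1 r2, of "(x, y)" "(x', y')"] that by simp
qed

text \<open>The algebras are modules in which \<open>mult\<close> and \<open>one\<close> have been
  overwritten; the notions listed here depend only on the additive structure and the
  scalars.\<close>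

lemma mult_one_update [simp]:
  fixes M :: "('a, 'm, 'z) module_scheme" and m o1
  defines "M' \<equiv> M\<lparr>mult := m, one := o1\<rparr>"
  shows "module K M' \<longleftrightarrow> module K M" "submodule H K M' \<longleftrightarrow> submodule H K M"
    "mspan K M' = mspan K M"
    "linear_map K M' Z = linear_map K M Z" "linear_map K L M' = linear_map K L M"
    "bilinear_map K M' P Q = bilinear_map K M P Q" "bilinear_map K P M' Q = bilinear_map K P M Q"
    "bilinear_map K P Q M' = bilinear_map K P Q M"
proof -
  have sm: "submodule H K M' \<longleftrightarrow> submodule H K M" for H
    unfolding submodule_def submodule_axioms_def subgroup_def by (simp add: M'_def m_inv_def)
  show "submodule H K M' \<longleftrightarrow> submodule H K M" by (rule sm)
  show "mspan K M' = mspan K M" by (simp add: mspan_def sm fun_eq_iff)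
  show "module K M' \<longleftrightarrow> module K M"
    unfolding module_def module_axioms_def abelian_group_def abelian_monoid_def
      abelian_group_axioms_def comm_group_def group_def comm_monoid_def monoid_def
      comm_monoid_axioms_def group_axioms_def
    by (simp add: M'_def Units_def)
qed (auto simp: linear_map_def bilinear_map_def fun_eq_iff M'_def)

lemma bilinear_map_compose:
  assumes "bilinear_map K M N P f" "linear_map K M' M g" "linear_map K N' N h"
  shows "bilinear_map K M' N' P (\<lambda>x y. f (g x) (h y))"
  using assms(1) linear_mapD[OF assms(2)] linear_mapD[OF assms(3)]
  by (simp add: bilinear_map_def linear_map_def)

lemma linear_bilinear_compose:
  assumes "bilinear_map K M N P f" "linear_map K P P' g"
  shows "bilinear_map K M N P' (\<lambda>x y. g (f x y))"
  using assms by (auto simp: bilinear_map_def intro: linear_map_compose)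

lemma linear_map_id: "linear_map K M M (\<lambda>x. x)"
  by (simp add: linear_map_def)

context
  fixes K :: "('a, 'k) ring_scheme" and A :: "('a, 'm, 'y) module_scheme" and B :: "('a, 'n, 'z) module_scheme"
  assumes A: "algebra K A" and B: "algebra K B"
begin

interpretation A: algebra K A by (rule A)
interpretation B: algebra K B by (rule B)

lemma tensor_algebra_simps [simp]:
  "carrier (tensor_algebra K A B) = carrier (tensor K A B)"
  "zero (tensor_algebra K A B) = zero (tensor K A B)"
  "add (tensor_algebra K A B) = add (tensor K A B)"
  "smult (tensor_algebra K A B) = smult (tensor K A B)"
  "one (tensor_algebra K A B) = tensor_elt K A B \<one>\<^bsub>A\<^esub> \<one>\<^bsub>B\<^esub>"
  by (simp_all add: tensor_algebra_def)

lemma tensor_mult_bilinear_aux: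
  "\<lbrakk>x' \<in> carrier A; y' \<in> carrier B\<rbrakk> \<Longrightarrow>
    bilinear_map K A B (tensor K A B) (\<lambda>x y. tensor_elt K A B (x \<otimes>\<^bsub>A\<^esub> x') (y \<otimes>\<^bsub>B\<^esub> y'))"
  "\<lbrakk>x \<in> carrier A; y \<in> carrier B\<rbrakk> \<Longrightarrow>
    bilinear_map K A B (tensor K A B) (\<lambda>x' y'. tensor_elt K A B (x \<otimes>\<^bsub>A\<^esub> x') (y \<otimes>\<^bsub>B\<^esub> y'))"
  using bilinear_mapD[OF bilinear_mult[OF A]] bilinear_mapD[OF bilinear_mult[OF B]]
  by (auto intro!: bilinear_map_compose[OF bilinear_tensor_elt[OF A.module B.module]])

lemma tensor_mult_closed_aux:
  "\<lbrakk>x \<in> carrier A; y \<in> carrier B; x' \<in> carrier A; y' \<in> carrier B\<rbrakk>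
    \<Longrightarrow> tensor_elt K A B (x \<otimes>\<^bsub>A\<^esub> x') (y \<otimes>\<^bsub>B\<^esub> y') \<in> carrier (tensor K A B)"
  by (intro bilinear_map_closed[OF bilinear_tensor_elt[OF A.module B.module]] A.m_closed B.m_closed)

lemma tensor_algebra_bilinear:
  "bilinear_map K (tensor K A B) (tensor K A B) (tensor K A B) (mult (tensor_algebra K A B))"
  using tensor_bilinear_lift(1)[OF A.module B.module A.module B.module module_tensor[OF A.module B.module]
      tensor_mult_closed_aux tensor_mult_bilinear_aux]
  by (simp add: tensor_algebra_def)

lemma tensor_algebra_mult:
  assumes "x \<in> carrier A" "y \<in> carrier B" "x' \<in> carrier A" "y' \<in> carrier B"
  shows "tensor_elt K A B x y \<otimes>\<^bsub>tensor_algebra K A B\<^esub> tensor_elt K A B x' y'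
    = tensor_elt K A B (x \<otimes>\<^bsub>A\<^esub> x') (y \<otimes>\<^bsub>B\<^esub> y')"
  using tensor_bilinear_lift(2)[OF A.module B.module A.module B.module module_tensor[OF A.module B.module]
      tensor_mult_closed_aux tensor_mult_bilinear_aux assms]
  by (simp add: tensor_algebra_def)

text \<open>On pure tensors the laws hold factor by factor, and these tensors span.\<close>

lemma algebra_tensor_algebra: "algebra K (tensor_algebra K A B)"
proof -
  let ?G = "{tensor_elt K A B x y | x y. x \<in> carrier A \<and> y \<in> carrier B}"
  have eq: "tensor_algebra K A B = (tensor K A B)\<lparr>mult := mult (tensor_algebra K A B), one := one (tensor_algebra K A B)\<rparr>"
    by (simp add: tensor_algebra_def)
  have mod: "module K (tensor_algebra K A B)"
    by (subst eq, subst mult_one_update) (rule module_tensor[OF A.module B.module])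
  note cl = bilinear_map_closed[OF bilinear_tensor_elt[OF A.module B.module]]
  show ?thesis
  proof (rule algebra_by_generators[OF mod, of ?G])
    show "bilinear_map K (tensor_algebra K A B) (tensor_algebra K A B) (tensor_algebra K A B)
        (mult (tensor_algebra K A B))"
      using tensor_algebra_bilinear by (simp add: bilinear_map_def linear_map_def)
    show "mspan K (tensor_algebra K A B) ?G = carrier (tensor_algebra K A B)"
      by (subst eq, subst mult_one_update) (simp add: mspan_tensor_all[OF A.module B.module])
    fix U V W assume U: "U \<in> ?G" and V: "V \<in> ?G" and W: "W \<in> ?G"
    show "U \<otimes>\<^bsub>tensor_algebra K A B\<^esub> V = V \<otimes>\<^bsub>tensor_algebra K A B\<^esub> U"
      using U V by (auto simp: tensor_algebra_mult A.m_comm B.m_comm)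
    show "U \<otimes>\<^bsub>tensor_algebra K A B\<^esub> V \<otimes>\<^bsub>tensor_algebra K A B\<^esub> W
        = U \<otimes>\<^bsub>tensor_algebra K A B\<^esub> (V \<otimes>\<^bsub>tensor_algebra K A B\<^esub> W)"
      using U V W by (auto simp: tensor_algebra_mult A.m_assoc B.m_assoc)
  qed (auto simp: tensor_algebra_mult intro!: cl)
qed

end

section \<open>Quotients of algebras\<close>

lemma ideal_submodule:
  assumes "algebra K A" "ideal I A"
  shows "submodule I K A"
proof -
  interpret A: algebra K A by fact
  interpret I: ideal I A by fact
  show ?thesis
  proof (rule A.submoduleI)
    fix c x assume c: "c \<in> carrier K" and x: "x \<in> I"
    have xc: "x \<in> carrier A" using x I.Icarr by simp
    \<comment> \<open>An ideal absorbs products, so scaling by \<open>c\<close> is rewritten as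
      multiplication by \<open>c \<odot> \<one>\<close>.\<close>
    have "c \<odot>\<^bsub>A\<^esub> x = (c \<odot>\<^bsub>A\<^esub> \<one>\<^bsub>A\<^esub>) \<otimes>\<^bsub>A\<^esub> x"
      using c xc A.smult_assoc2[of c "\<one>\<^bsub>A\<^esub>" x] by simp
    then show "c \<odot>\<^bsub>A\<^esub> x \<in> I" using c x by (simp add: I.I_l_closed)
  qed (use I.a_subset in auto)
qed

lemma algebra_quot_algebra:
  assumes "algebra K A" "ideal I A"
  shows "algebra K (quot_algebra A I)"
proof -
  interpret A: algebra K A by fact
  interpret I: ideal I A by fact
  note sub = ideal_submodule[OF assms]
  note mod = module_quot_algebra[OF A.module sub]
  note rules = I.rcoset_mult_add quot_add[OF A.module sub] quot_smult[OF A.module sub]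
  have mult: "U \<otimes>\<^bsub>quot_algebra A I\<^esub> V = rcoset_mult A I U V" for U V by simp
  have span: "mspan K (quot_algebra A I) (carrier (quot_algebra A I)) = carrier (quot_algebra A I)"
    by (rule equalityI[OF submodule_mspan(3)[OF mod order_refl] submodule_mspan(2)[OF mod order_refl]])
  have comm2: "x \<otimes>\<^bsub>A\<^esub> (c \<odot>\<^bsub>A\<^esub> y) = c \<odot>\<^bsub>A\<^esub> (x \<otimes>\<^bsub>A\<^esub> y)" if "c \<in> carrier K" "x \<in> carrier A" "y \<in> carrier A" for c x y
    using linear_mapD(3)[OF bilinear_mapD(1)[OF bilinear_mult[OF assms(1)] that(2)] that(1,3)] .
  have bil: "bilinear_map K (quot_algebra A I) (quot_algebra A I) (quot_algebra A I) (mult (quot_algebra A I))"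
    unfolding bilinear_map_def
    by (intro conjI ballI linear_mapI; elim quot_carrierE;
        simp add: rules mult quot_carrierI A.l_distr A.r_distr A.smult_assoc2 comm2 del: quot_algebra_simps)
  have one: "\<one>\<^bsub>quot_algebra A I\<^esub> = I +>\<^bsub>A\<^esub> \<one>\<^bsub>A\<^esub>" by simp
  show ?thesis
  proof (rule algebra_by_generators[OF mod bil _ order_refl span])
    fix U V W assume "U \<in> carrier (quot_algebra A I)" "V \<in> carrier (quot_algebra A I)"
      "W \<in> carrier (quot_algebra A I)"
    then show "U \<otimes>\<^bsub>quot_algebra A I\<^esub> V \<otimes>\<^bsub>quot_algebra A I\<^esub> W
        = U \<otimes>\<^bsub>quot_algebra A I\<^esub> (V \<otimes>\<^bsub>quot_algebra A I\<^esub> W)"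
      by (elim quot_carrierE) (simp add: rules mult A.m_assoc del: quot_algebra_simps)
  qed ((elim quot_carrierE)?; simp add: rules mult one quot_carrierI A.m_comm del: quot_algebra_simps)+
qed

lemma quot_algebra_mult:
  assumes "ideal I A" "x \<in> carrier A" "y \<in> carrier A"
  shows "(I +>\<^bsub>A\<^esub> x) \<otimes>\<^bsub>quot_algebra A I\<^esub> (I +>\<^bsub>A\<^esub> y) = I +>\<^bsub>A\<^esub> (x \<otimes>\<^bsub>A\<^esub> y)"
  using ideal.rcoset_mult_add[OF assms] by simp

section \<open>Symmetric squares and symmetric algebras\<close>

lemma ball_Collect4:
  "(\<forall>s\<in>{f x y z w | x y z w. P x y z w}. Q s) \<longleftrightarrow> (\<forall>x y z w. P x y z w \<longrightarrow> Q (f x y z w))"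
  by blast

context
  fixes K :: "('a, 'k) ring_scheme" and M :: "('a, 'm, 'y) module_scheme"
  assumes M: "module K M"
begin

interpretation M: module K M by (rule M)

lemma sym_square_presentation: "presentation K (carrier M \<times> carrier M) (sym_square_rels K M)"
proof (rule presentation.intro)
  show K: "cring K" by (rule module_cring[OF M])
  show "sym_square_rels K M \<subseteq> carrier (free_module K (carrier M \<times> carrier M))"
    unfolding sym_square_rels_def
    using presentation.rels[OF tensor_presentation[OF M M]]
    by (auto simp del: free_module_simps intro!: free_closed[OF K])
qed

lemma module_sym_square: "module K (sym_square K M)"
  unfolding sym_square_def by (rule presentation.P_module[OF sym_square_presentation])

lemma bilinear_sym_elt: "bilinear_map K M M (sym_square K M) (sym_elt K M)"
proof -
  interpret P: presentation K "carrier M \<times> carrier M" "sym_square_rels K M" by (rule sym_square_presentation)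
  have "bilinear_map K M M P.P (\<lambda>x y. pres_gen K (carrier M \<times> carrier M) (sym_square_rels K M) (x, y))"
    by (subst tensor_rels_killed_iff[OF M M P.P_module, symmetric])
      (use P.gen_closed P.lin_ext_gen_rel in \<open>auto simp: sym_square_rels_def\<close>)
  then show ?thesis by (simp add: sym_square_def sym_elt_def[abs_def])
qed

lemma sym_elt_commute:
  assumes "x \<in> carrier M" "y \<in> carrier M"
  shows "sym_elt K M x y = sym_elt K M y x"
proof -
  interpret P: presentation K "carrier M \<times> carrier M" "sym_square_rels K M" by (rule sym_square_presentation)
  let ?g = "pres_gen K (carrier M \<times> carrier M) (sym_square_rels K M)"
  have "?g \<in> carrier M \<times> carrier M \<rightarrow> carrier P.P" using P.gen_closed by auto
  from lin_ext_swap_rel[OF P.P_module this, of "(x, y)" "(y, x)"]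
  have "lin_ext K P.P ?g (unit_vec K (x, y) \<ominus>\<^bsub>P.F\<^esub> unit_vec K (y, x)) = \<zero>\<^bsub>P.P\<^esub>
      \<longleftrightarrow> ?g (x, y) = ?g (y, x)"
    using assms by simp
  moreover have "unit_vec K (x, y) \<ominus>\<^bsub>P.F\<^esub> unit_vec K (y, x) \<in> sym_square_rels K M"
    unfolding sym_square_rels_def using assms by blast
  ultimately show ?thesis using P.lin_ext_gen_rel by (simp add: sym_elt_def)
qed

lemma sym_presentation: "presentation K {m. set_mset m \<subseteq> carrier M} (sym_rels K M)"
proof (rule presentation.intro)
  show K: "cring K" by (rule module_cring[OF M])
  show "sym_rels K M \<subseteq> carrier (free_module K {m. set_mset m \<subseteq> carrier M})"
    unfolding sym_rels_def Let_def
    by (auto simp del: free_module_simps intro!: free_closed[OF K])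
qed

text \<open>A multiset has no order, so linearity in one distinguished element already expresses
  linearity in every factor.\<close>

lemma sym_rels_killed_iff:
  assumes Z: "module K Z" and \<phi>: "\<phi> \<in> {m. set_mset m \<subseteq> carrier M} \<rightarrow> carrier Z"
  shows "(\<forall>s\<in>sym_rels K M. lin_ext K Z \<phi> s = \<zero>\<^bsub>Z\<^esub>) \<longleftrightarrow>
    (\<forall>m. set_mset m \<subseteq> carrier M \<longrightarrow> linear_map K M Z (\<lambda>x. \<phi> (add_mset x m)))"
proof -
  let ?X = "{m. set_mset m \<subseteq> carrier M}" and ?e = "unit_vec K"
  let ?F = "free_module K ?X"
  have 1: "(\<forall>s\<in>{?e (add_mset (x \<oplus>\<^bsub>M\<^esub> y) m) \<ominus>\<^bsub>?F\<^esub> (?e (add_mset x m) \<oplus>\<^bsub>?F\<^esub> ?e (add_mset y m)) | x y m.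
        x \<in> carrier M \<and> y \<in> carrier M \<and> m \<in> ?X}. lin_ext K Z \<phi> s = \<zero>\<^bsub>Z\<^esub>) \<longleftrightarrow>
    (\<forall>x y m. x \<in> carrier M \<and> y \<in> carrier M \<and> m \<in> ?X \<longrightarrow>
      \<phi> (add_mset (x \<oplus>\<^bsub>M\<^esub> y) m) = \<phi> (add_mset x m) \<oplus>\<^bsub>Z\<^esub> \<phi> (add_mset y m))"
    unfolding ball_Collect3
    by (intro all_cong1 imp_cong refl lin_ext_additivity_rel[OF Z \<phi>]) auto
  have 2: "(\<forall>s\<in>{?e (add_mset (c \<odot>\<^bsub>M\<^esub> x) m) \<ominus>\<^bsub>?F\<^esub> c \<odot>\<^bsub>?F\<^esub> ?e (add_mset x m) | c x m.
        c \<in> carrier K \<and> x \<in> carrier M \<and> m \<in> ?X}. lin_ext K Z \<phi> s = \<zero>\<^bsub>Z\<^esub>) \<longleftrightarrow>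
    (\<forall>c x m. c \<in> carrier K \<and> x \<in> carrier M \<and> m \<in> ?X \<longrightarrow>
      \<phi> (add_mset (c \<odot>\<^bsub>M\<^esub> x) m) = c \<odot>\<^bsub>Z\<^esub> \<phi> (add_mset x m))"
    unfolding ball_Collect3
    by (intro all_cong1 imp_cong refl lin_ext_scaling_rel[OF Z \<phi>]) auto
  have "\<phi> (add_mset x m) \<in> carrier Z" if "x \<in> carrier M" "set_mset m \<subseteq> carrier M" for x m
    using that by (intro funcset_mem[OF \<phi>]) auto
  then show ?thesis
    unfolding sym_rels_def Let_def ball_Un 1 2 linear_map_def by auto
qed

lemma module_sym_module: "module K (sym_module K M)"
  unfolding sym_module_def by (rule presentation.P_module[OF sym_presentation])

lemma sym_monom_closed: "set_mset m \<subseteq> carrier M \<Longrightarrow> sym_monom K M m \<in> carrier (sym_module K M)"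
  unfolding sym_monom_def sym_module_def by (intro presentation.gen_closed[OF sym_presentation]) auto

lemma sym_monom_linear:
  assumes "set_mset m \<subseteq> carrier M"
  shows "linear_map K M (sym_module K M) (\<lambda>x. sym_monom K M (add_mset x m))"
proof -
  have "sym_monom K M \<in> {m. set_mset m \<subseteq> carrier M} \<rightarrow> carrier (sym_module K M)"
    using sym_monom_closed by auto
  from sym_rels_killed_iff[OF module_sym_module this]
  show ?thesis using assms presentation.lin_ext_gen_rel[OF sym_presentation]
    by (simp add: sym_monom_def sym_module_def)
qed

lemma sym_algebra_simps [simp]:
  "carrier (sym_algebra K M) = carrier (sym_module K M)"
  "zero (sym_algebra K M) = zero (sym_module K M)"
  "add (sym_algebra K M) = add (sym_module K M)"
  "smult (sym_algebra K M) = smult (sym_module K M)"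
  "one (sym_algebra K M) = sym_monom K M {#}"
  by (simp_all add: sym_algebra_def)

lemma sym_algebra_bilinear:
  "bilinear_map K (sym_module K M) (sym_module K M) (sym_module K M) (mult (sym_algebra K M))"
  and sym_algebra_mult:
  "\<lbrakk>set_mset m \<subseteq> carrier M; set_mset n \<subseteq> carrier M\<rbrakk> \<Longrightarrow>
    sym_monom K M m \<otimes>\<^bsub>sym_algebra K M\<^esub> sym_monom K M n = sym_monom K M (m + n)"
proof -
  let ?X = "{m. set_mset m \<subseteq> carrier M}"
  have c: "sym_monom K M (m + n) \<in> carrier (sym_module K M)" if "m \<in> ?X" "n \<in> ?X" for m n
    using that by (intro sym_monom_closed) auto
  have r1: "lin_ext K (sym_module K M) (\<lambda>m. sym_monom K M (m + n)) s = \<zero>\<^bsub>sym_module K M\<^esub>"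
    if "s \<in> sym_rels K M" "n \<in> ?X" for s n
  proof -
    have "(\<lambda>m. sym_monom K M (m + n)) \<in> ?X \<rightarrow> carrier (sym_module K M)" using c that by auto
    from sym_rels_killed_iff[OF module_sym_module this] that show ?thesis
      using sym_monom_linear by auto
  qed
  \<comment> \<open>Addition of multisets is commutative, which reduces the second argument to the
    first.\<close>
  have r2: "lin_ext K (sym_module K M) (\<lambda>m. sym_monom K M (n + m)) s = \<zero>\<^bsub>sym_module K M\<^esub>"
    if "s \<in> sym_rels K M" "n \<in> ?X" for s n
    using r1[OF that] by (simp add: add.commute)
  note P = sym_presentation
  show "bilinear_map K (sym_module K M) (sym_module K M) (sym_module K M) (mult (sym_algebra K M))"
    using bilinear_pres_lift(1)[OF P P module_sym_module c r1 r2]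
    by (simp add: sym_algebra_def sym_module_def)
  show "sym_monom K M m \<otimes>\<^bsub>sym_algebra K M\<^esub> sym_monom K M n = sym_monom K M (m + n)"
    if "set_mset m \<subseteq> carrier M" "set_mset n \<subseteq> carrier M"
    using bilinear_pres_lift(2)[OF P P module_sym_module c r1 r2, of m n] that
    by (simp add: sym_algebra_def sym_monom_def)
qed

lemma algebra_sym_algebra: "algebra K (sym_algebra K M)"
proof -
  let ?X = "{m. set_mset m \<subseteq> carrier M}"
  let ?G = "sym_monom K M ` ?X"
  have eq: "sym_algebra K M = (sym_module K M)\<lparr>mult := mult (sym_algebra K M), one := one (sym_algebra K M)\<rparr>"
    by (simp add: sym_algebra_def)
  have mod: "module K (sym_algebra K M)"
    by (subst eq, subst mult_one_update) (rule module_sym_module)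
  show ?thesis
  proof (rule algebra_by_generators[OF mod, of ?G])
    show "bilinear_map K (sym_algebra K M) (sym_algebra K M) (sym_algebra K M) (mult (sym_algebra K M))"
      using sym_algebra_bilinear by (simp add: bilinear_map_def linear_map_def)
    show "mspan K (sym_algebra K M) ?G = carrier (sym_algebra K M)"
      using presentation.mspan_gens[OF sym_presentation]
      by (subst eq, subst mult_one_update) (simp add: sym_module_def sym_monom_def[abs_def])
  qed (auto simp: sym_algebra_mult ac_simps intro!: sym_monom_closed)
qed

end

section \<open>Words\<close>

text \<open>One condition for words of all lengths: a single letter varies between fixed contexts
  \<open>u\<close> and \<open>w\<close>. The empty word is only required to go into
  \<open>Z\<close>, in accordance with \<open>word_rels\<close>, none of whose relations involves
  it.\<close>

definition word_multilinear ::
  "('a, 'k) ring_scheme \<Rightarrow> ('a, 'v, 'y) module_scheme \<Rightarrow> ('a, 'b, 'z) module_scheme \<Rightarrow> ('v list \<Rightarrow> 'b) \<Rightarrow> bool" where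
  "word_multilinear K V Z \<phi> \<longleftrightarrow> (\<forall>w\<in>lists (carrier V). \<phi> w \<in> carrier Z) \<and>
     (\<forall>u\<in>lists (carrier V). \<forall>w\<in>lists (carrier V). linear_map K V Z (\<lambda>x. \<phi> (u @ x # w)))"

lemma word_multilinearI:
  assumes "\<And>w. w \<in> lists (carrier V) \<Longrightarrow> \<phi> w \<in> carrier Z"
    and "\<And>u x y w. \<lbrakk>u \<in> lists (carrier V); x \<in> carrier V; y \<in> carrier V; w \<in> lists (carrier V)\<rbrakk>
      \<Longrightarrow> \<phi> (u @ (x \<oplus>\<^bsub>V\<^esub> y) # w) = \<phi> (u @ x # w) \<oplus>\<^bsub>Z\<^esub> \<phi> (u @ y # w)"
    and "\<And>c u x w. \<lbrakk>c \<in> carrier K; u \<in> lists (carrier V); x \<in> carrier V; w \<in> lists (carrier V)\<rbrakk>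
      \<Longrightarrow> \<phi> (u @ (c \<odot>\<^bsub>V\<^esub> x) # w) = c \<odot>\<^bsub>Z\<^esub> \<phi> (u @ x # w)"
  shows "word_multilinear K V Z \<phi>"
  unfolding word_multilinear_def
proof (intro conjI ballI linear_mapI)
  show "\<phi> w \<in> carrier Z" if "w \<in> lists (carrier V)" for w using that by (rule assms(1))
  show "\<phi> (u @ x # w) \<in> carrier Z" if "u \<in> lists (carrier V)" "w \<in> lists (carrier V)" "x \<in> carrier V" for u w x
    by (rule assms(1)) (use that in simp)
qed (rule assms(2,3); assumption)+

lemma word_multilinearD:
  assumes "word_multilinear K V Z \<phi>"
  shows "w \<in> lists (carrier V) \<Longrightarrow> \<phi> w \<in> carrier Z"
    and "\<lbrakk>u \<in> lists (carrier V); w \<in> lists (carrier V)\<rbrakk> \<Longrightarrow> linear_map K V Z (\<lambda>x. \<phi> (u @ x # w))"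
  using assms unfolding word_multilinear_def by blast+

context
  fixes K :: "('a, 'k) ring_scheme" and V :: "('a, 'v, 'y) module_scheme"
  assumes V: "module K V"
begin

interpretation V: module K V by (rule V)

lemma word_presentation: "presentation K (lists (carrier V)) (word_rels K V)"
proof (rule presentation.intro)
  show K: "cring K" by (rule module_cring[OF V])
  show "word_rels K V \<subseteq> carrier (free_module K (lists (carrier V)))"
    unfolding word_rels_def Let_def
    by (auto simp del: free_module_simps intro!: free_closed[OF K])
qed

lemma module_tensors: "module K (tensors K V)"
  unfolding tensors_def by (rule presentation.P_module[OF word_presentation])

lemma word_rels_killed_iff:
  assumes Z: "module K Z" and \<phi>: "\<phi> \<in> lists (carrier V) \<rightarrow> carrier Z"
  shows "(\<forall>s\<in>word_rels K V. lin_ext K Z \<phi> s = \<zero>\<^bsub>Z\<^esub>) \<longleftrightarrow> word_multilinear K V Z \<phi>"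
proof -
  let ?W = "lists (carrier V)" and ?e = "unit_vec K"
  let ?F = "free_module K ?W"
  have 1: "(\<forall>s\<in>{?e (u @ (x \<oplus>\<^bsub>V\<^esub> y) # w) \<ominus>\<^bsub>?F\<^esub> (?e (u @ x # w) \<oplus>\<^bsub>?F\<^esub> ?e (u @ y # w)) | u x y w.
        u \<in> ?W \<and> x \<in> carrier V \<and> y \<in> carrier V \<and> w \<in> ?W}. lin_ext K Z \<phi> s = \<zero>\<^bsub>Z\<^esub>) \<longleftrightarrow>
    (\<forall>u x y w. u \<in> ?W \<and> x \<in> carrier V \<and> y \<in> carrier V \<and> w \<in> ?W \<longrightarrow>
        \<phi> (u @ (x \<oplus>\<^bsub>V\<^esub> y) # w) = \<phi> (u @ x # w) \<oplus>\<^bsub>Z\<^esub> \<phi> (u @ y # w))"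
    unfolding ball_Collect4
    by (intro all_cong1 imp_cong refl lin_ext_additivity_rel[OF Z \<phi>]) auto
  have 2: "(\<forall>s\<in>{?e (u @ (c \<odot>\<^bsub>V\<^esub> x) # w) \<ominus>\<^bsub>?F\<^esub> c \<odot>\<^bsub>?F\<^esub> ?e (u @ x # w) | c u x w.
        c \<in> carrier K \<and> u \<in> ?W \<and> x \<in> carrier V \<and> w \<in> ?W}. lin_ext K Z \<phi> s = \<zero>\<^bsub>Z\<^esub>) \<longleftrightarrow>
    (\<forall>c u x w. c \<in> carrier K \<and> u \<in> ?W \<and> x \<in> carrier V \<and> w \<in> ?W \<longrightarrow>
        \<phi> (u @ (c \<odot>\<^bsub>V\<^esub> x) # w) = c \<odot>\<^bsub>Z\<^esub> \<phi> (u @ x # w))"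
    unfolding ball_Collect4
    by (intro all_cong1 imp_cong refl lin_ext_scaling_rel[OF Z \<phi>]) auto
  have c: "\<phi> w \<in> carrier Z" if "w \<in> ?W" for w using \<phi> that by auto
  have "word_multilinear K V Z \<phi> \<longleftrightarrow>
    (\<forall>u x y w. u \<in> ?W \<and> x \<in> carrier V \<and> y \<in> carrier V \<and> w \<in> ?W \<longrightarrow>
        \<phi> (u @ (x \<oplus>\<^bsub>V\<^esub> y) # w) = \<phi> (u @ x # w) \<oplus>\<^bsub>Z\<^esub> \<phi> (u @ y # w)) \<and>
    (\<forall>c u x w. c \<in> carrier K \<and> u \<in> ?W \<and> x \<in> carrier V \<and> w \<in> ?W \<longrightarrow>
        \<phi> (u @ (c \<odot>\<^bsub>V\<^esub> x) # w) = c \<odot>\<^bsub>Z\<^esub> \<phi> (u @ x # w))"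
    (is "_ = (?A \<and> ?B)")
  proof (intro iffI conjI allI impI)
    fix u x y w assume *: "word_multilinear K V Z \<phi>"
      "u \<in> ?W \<and> x \<in> carrier V \<and> y \<in> carrier V \<and> w \<in> ?W"
    show "\<phi> (u @ (x \<oplus>\<^bsub>V\<^esub> y) # w) = \<phi> (u @ x # w) \<oplus>\<^bsub>Z\<^esub> \<phi> (u @ y # w)"
      by (rule linear_mapD(2)[OF word_multilinearD(2)[OF *(1)]]) (use *(2) in simp_all)
  next
    fix c u x w assume *: "word_multilinear K V Z \<phi>"
      "c \<in> carrier K \<and> u \<in> ?W \<and> x \<in> carrier V \<and> w \<in> ?W"
    show "\<phi> (u @ (c \<odot>\<^bsub>V\<^esub> x) # w) = c \<odot>\<^bsub>Z\<^esub> \<phi> (u @ x # w)"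
      by (rule linear_mapD(3)[OF word_multilinearD(2)[OF *(1)]]) (use *(2) in simp_all)
  next
    assume *: "?A \<and> ?B"
    show "word_multilinear K V Z \<phi>"
      by (rule word_multilinearI) (use * c in simp_all)
  qed
  then show ?thesis
    unfolding word_rels_def Let_def ball_Un 1 2 by simp
qed

lemma pure_closed: "w \<in> lists (carrier V) \<Longrightarrow> pure K V w \<in> carrier (tensors K V)"
  unfolding pure_def tensors_def by (rule presentation.gen_closed[OF word_presentation])

lemma pure_multilinear: "word_multilinear K V (tensors K V) (pure K V)"
proof -
  have "pure K V \<in> lists (carrier V) \<rightarrow> carrier (tensors K V)"
    using pure_closed by auto
  from word_rels_killed_iff[OF module_tensors this]
  show ?thesis using presentation.lin_ext_gen_rel[OF word_presentation]
    by (simp add: pure_def tensors_def)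
qed

lemma mspan_pure: "mspan K (tensors K V) (pure K V ` lists (carrier V)) = carrier (tensors K V)"
  unfolding pure_def tensors_def by (rule presentation.mspan_gens[OF word_presentation])

lemma tensors_lift:
  assumes Z: "module K Z" and \<phi>: "word_multilinear K V Z \<phi>"
  shows "linear_map K (tensors K V) Z (pres_lift K Z \<phi>)"
    and "w \<in> lists (carrier V) \<Longrightarrow> pres_lift K Z \<phi> (pure K V w) = \<phi> w"
proof -
  interpret P: presentation K "lists (carrier V)" "word_rels K V" by (rule word_presentation)
  have c: "\<phi> \<in> lists (carrier V) \<rightarrow> carrier Z" using \<phi> by (auto simp: word_multilinear_def)
  have kill: "\<And>s. s \<in> word_rels K V \<Longrightarrow> lin_ext K Z \<phi> s = \<zero>\<^bsub>Z\<^esub>"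
    using \<phi> word_rels_killed_iff[OF Z c] by simp
  show "linear_map K (tensors K V) Z (pres_lift K Z \<phi>)"
    unfolding tensors_def by (rule P.pres_lift_linear[OF Z c kill])
  show "pres_lift K Z \<phi> (pure K V w) = \<phi> w" if "w \<in> lists (carrier V)"
    unfolding pure_def by (rule P.pres_lift_gen[OF Z c kill that])
qed

lemma tensors_bilinear_lift:
  assumes Z: "module K Z"
    and 1: "\<And>w. w \<in> lists (carrier V) \<Longrightarrow> word_multilinear K V Z (\<lambda>u. \<Psi> u w)"
    and 2: "\<And>u. u \<in> lists (carrier V) \<Longrightarrow> word_multilinear K V Z (\<Psi> u)"
  defines "b \<equiv> (\<lambda>s t. pres_lift K Z (\<lambda>u. pres_lift K Z (\<Psi> u) t) s)"
  shows "bilinear_map K (tensors K V) (tensors K V) Z b"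
    and "\<lbrakk>u \<in> lists (carrier V); w \<in> lists (carrier V)\<rbrakk> \<Longrightarrow> b (pure K V u) (pure K V w) = \<Psi> u w"
proof -
  note P = word_presentation
  have c: "\<Psi> u w \<in> carrier Z" if "u \<in> lists (carrier V)" "w \<in> lists (carrier V)" for u w
    using 2[OF that(1)] that(2) by (auto simp: word_multilinear_def)
  have r1: "lin_ext K Z (\<lambda>u. \<Psi> u w) s = \<zero>\<^bsub>Z\<^esub>"
    if "s \<in> word_rels K V" "w \<in> lists (carrier V)" for s w
  proof -
    have "(\<lambda>u. \<Psi> u w) \<in> lists (carrier V) \<rightarrow> carrier Z" using c that(2) by auto
    from word_rels_killed_iff[OF Z this] 1 that show ?thesis by auto
  qed
  have r2: "lin_ext K Z (\<Psi> u) s = \<zero>\<^bsub>Z\<^esub>"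
    if "s \<in> word_rels K V" "u \<in> lists (carrier V)" for s u
  proof -
    have "\<Psi> u \<in> lists (carrier V) \<rightarrow> carrier Z" using c that(2) by auto
    from word_rels_killed_iff[OF Z this] 2 that show ?thesis by auto
  qed
  show "bilinear_map K (tensors K V) (tensors K V) Z b"
    unfolding tensors_def b_def by (rule bilinear_pres_lift(1)[OF P P Z c r1 r2])
  show "b (pure K V u) (pure K V w) = \<Psi> u w" if "u \<in> lists (carrier V)" "w \<in> lists (carrier V)"
    unfolding pure_def b_def by (rule bilinear_pres_lift(2)[OF P P Z c r1 r2 that])
qed

lemma tensors_linear_eq:
  assumes "module K Z" "linear_map K (tensors K V) Z f" "linear_map K (tensors K V) Z g"
    and "\<And>w. w \<in> lists (carrier V) \<Longrightarrow> f (pure K V w) = g (pure K V w)"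
    and "t \<in> carrier (tensors K V)"
  shows "f t = g t"
  using presentation.linear_eq[OF word_presentation assms(1), of f g] assms(2-5)
  by (auto simp: tensors_def pure_def)

end

section \<open>Multilinear functions on words\<close>

lemma word_multilinear_cong:
  assumes "word_multilinear K V Z \<phi>" "module K V" "\<And>w. w \<in> lists (carrier V) \<Longrightarrow> \<phi> w = \<psi> w"
  shows "word_multilinear K V Z \<psi>"
proof -
  interpret V: module K V by fact
  show ?thesis
    unfolding word_multilinear_def
  proof (intro conjI ballI)
    show "\<psi> w \<in> carrier Z" if "w \<in> lists (carrier V)" for w
      using word_multilinearD(1)[OF assms(1) that] assms(3)[OF that] by simp
    show "linear_map K V Z (\<lambda>x. \<psi> (u @ x # w))" if "u \<in> lists (carrier V)" "w \<in> lists (carrier V)" for u w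
      by (rule linear_map_cong[OF assms(2) assms(3) word_multilinearD(2)[OF assms(1) that]])
        (use that in simp)
  qed
qed

lemma word_multilinear_Cons:
  assumes "word_multilinear K V Z \<phi>" "x \<in> carrier V"
  shows "word_multilinear K V Z (\<lambda>w. \<phi> (x # w))"
  unfolding word_multilinear_def
proof (intro conjI ballI)
  show "\<phi> (x # w) \<in> carrier Z" if "w \<in> lists (carrier V)" for w
    by (rule word_multilinearD(1)[OF assms(1)]) (use that assms(2) in simp)
  show "linear_map K V Z (\<lambda>y. \<phi> (x # u @ y # w))" if "u \<in> lists (carrier V)" "w \<in> lists (carrier V)" for u w
    using word_multilinearD(2)[OF assms(1), of "x # u" w] that assms(2) by simp
qed

lemma word_multilinear_lsum:
  assumes "module K Z" "\<And>a. a \<in> set xs \<Longrightarrow> word_multilinear K V Z (\<phi> a)"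
  shows "word_multilinear K V Z (\<lambda>w. lsum Z (\<lambda>a. \<phi> a w) xs)"
proof -
  interpret Z: module K Z by fact
  show ?thesis
    unfolding word_multilinear_def
  proof (intro conjI ballI)
    show "lsum Z (\<lambda>a. \<phi> a w) xs \<in> carrier Z" if "w \<in> lists (carrier V)" for w
      by (rule Z.lsum_closed) (rule word_multilinearD(1)[OF assms(2) that])
    show "linear_map K V Z (\<lambda>x. lsum Z (\<lambda>a. \<phi> a (u @ x # w)) xs)"
      if "u \<in> lists (carrier V)" "w \<in> lists (carrier V)" for u w
      by (rule linear_map_lsum_param[OF assms(1)]) (rule word_multilinearD(2)[OF assms(2) that])
  qed
qed

lemma word_multilinear_linear:
  assumes "word_multilinear K V M \<phi>" "linear_map K M N f"
  shows "word_multilinear K V N (\<lambda>w. f (\<phi> w))"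
  unfolding word_multilinear_def
  by (intro conjI ballI linear_mapD(1)[OF assms(2)] linear_map_compose[OF _ assms(2)]
      word_multilinearD[OF assms(1)])

text \<open>Every cut leaves the varying letter in exactly one of the two parts, so it is enough
  that \<Phi> is multilinear in each part separately.\<close>

lemma word_multilinear_splits:
  assumes V: "module K V" and Z: "module K Z"
    and 1: "\<And>v. v \<in> lists (carrier V) \<Longrightarrow> word_multilinear K V Z (\<lambda>u. \<Phi> u v)"
    and 2: "\<And>u. u \<in> lists (carrier V) \<Longrightarrow> word_multilinear K V Z (\<Phi> u)"
  shows "word_multilinear K V Z (\<lambda>w. lsum Z (\<lambda>p. \<Phi> (fst p) (snd p)) (splits w))"
proof -
  interpret Z: module K Z by fact
  have c: "\<Phi> u v \<in> carrier Z" if "u \<in> lists (carrier V)" "v \<in> lists (carrier V)" for u v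
    using word_multilinearD(1)[OF 2] that by blast
  have c': "\<Phi> (fst p) (snd p) \<in> carrier Z" if "p \<in> set (splits w)" "w \<in> lists (carrier V)" for p w
    using lists_splits[OF that] by (rule c)
  show ?thesis
    unfolding word_multilinear_def
  proof (intro conjI ballI)
    show "lsum Z (\<lambda>p. \<Phi> (fst p) (snd p)) (splits w) \<in> carrier Z" if "w \<in> lists (carrier V)" for w
      by (rule Z.lsum_closed) (rule c'[OF _ that])
    fix u w assume u: "u \<in> lists (carrier V)" and w: "w \<in> lists (carrier V)"
    have lin: "linear_map K V Z (\<lambda>x.
        lsum Z (\<lambda>p. \<Phi> (fst p) (snd p @ x # w)) (splits u) \<oplus>\<^bsub>Z\<^esub>
        lsum Z (\<lambda>p. \<Phi> (u @ x # fst p) (snd p)) (splits w))"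
    proof (intro linear_map_add[OF Z] linear_map_lsum_param[OF Z])
      show "linear_map K V Z (\<lambda>x. \<Phi> (fst p) (snd p @ x # w))" if "p \<in> set (splits u)" for p
        using word_multilinearD(2)[OF 2[OF lists_splits(1)[OF that u]] lists_splits(2)[OF that u] w] .
      show "linear_map K V Z (\<lambda>x. \<Phi> (u @ x # fst p) (snd p))" if "p \<in> set (splits w)" for p
        using word_multilinearD(2)[OF 1[OF lists_splits(2)[OF that w]] u lists_splits(1)[OF that w]] .
    qed
    show "linear_map K V Z (\<lambda>x. lsum Z (\<lambda>p. \<Phi> (fst p) (snd p)) (splits (u @ x # w)))"
    proof (rule linear_map_cong[OF V _ lin])
      show "lsum Z (\<lambda>p. \<Phi> (fst p) (snd p @ x # w)) (splits u) \<oplus>\<^bsub>Z\<^esub>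
          lsum Z (\<lambda>p. \<Phi> (u @ x # fst p) (snd p)) (splits w)
          = lsum Z (\<lambda>p. \<Phi> (fst p) (snd p)) (splits (u @ x # w))" if x: "x \<in> carrier V" for x
      proof -
        have "\<Phi> (fst p) (snd p @ x # w) \<in> carrier Z" if "p \<in> set (splits u)" for p
          using lists_splits[OF that u] x w by (intro c) auto
        moreover have "\<Phi> (u @ x # fst p) (snd p) \<in> carrier Z" if "p \<in> set (splits w)" for p
          using lists_splits[OF that w] x u by (intro c) auto
        ultimately show ?thesis
          unfolding splits_append_Cons by (subst Z.lsum_append) auto
      qed
    qed
  qed
qed

text \<open>The two lists contain the same words in a different order, hence the symmetry is stated
  for sums over them.\<close>

lemma (in abelian_monoid) lsum_shuffle_commute:
  assumes "\<And>w. w \<in> lists A \<Longrightarrow> \<phi> w \<in> carrier G" "u \<in> lists A" "v \<in> lists A"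
  shows "lsum G \<phi> (shuffle_list u v) = lsum G \<phi> (shuffle_list v u)"
  using assms
proof (induction u v arbitrary: \<phi> rule: shuffle_list.induct)
  case (3 x u y w)
  have c: "\<phi> (x # z) \<in> carrier G" "\<phi> (y # z) \<in> carrier G" if "z \<in> lists A" for z
    using that 3(4,5) by (auto intro!: 3(3))
  have c2: "\<phi> (x # z) \<in> carrier G"
    if "z \<in> set (shuffle_list u (y # w)) \<or> z \<in> set (shuffle_list (y # w) u)" for z
    using that 3(4,5) by (intro c) (auto dest!: set_shuffle_list)
  have c3: "\<phi> (y # z) \<in> carrier G"
    if "z \<in> set (shuffle_list (x # u) w) \<or> z \<in> set (shuffle_list w (x # u))" for z
    using that 3(4,5) by (intro c) (auto dest!: set_shuffle_list)
  have "lsum G (\<lambda>z. \<phi> (x # z)) (shuffle_list u (y # w)) = lsum G (\<lambda>z. \<phi> (x # z)) (shuffle_list (y # w) u)"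
    by (rule "3.IH"(1)) (use c 3(4,5) in auto)
  moreover have "lsum G (\<lambda>z. \<phi> (y # z)) (shuffle_list (x # u) w) = lsum G (\<lambda>z. \<phi> (y # z)) (shuffle_list w (x # u))"
    by (rule "3.IH"(2)) (use c 3(4,5) in auto)
  moreover have "lsum G \<phi> (shuffle_list (x # u) (y # w)) =
      lsum G (\<lambda>z. \<phi> (x # z)) (shuffle_list u (y # w)) \<oplus> lsum G (\<lambda>z. \<phi> (y # z)) (shuffle_list (x # u) w)"
    unfolding shuffle_list.simps by (subst lsum_append) (auto intro: c2 c3)
  moreover have "lsum G \<phi> (shuffle_list (y # w) (x # u)) =
      lsum G (\<lambda>z. \<phi> (y # z)) (shuffle_list w (x # u)) \<oplus> lsum G (\<lambda>z. \<phi> (x # z)) (shuffle_list (y # w) u)"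
    unfolding shuffle_list.simps by (subst lsum_append) (auto intro: c2 c3)
  ultimately show ?case using c2 c3 by (simp add: a_comm)
qed simp_all

text \<open>Each interleaving contains the varying letter exactly once, so every summand is linear
  in it. The second argument is reduced to the first by symmetry.\<close>

lemma word_multilinear_shuffle:
  assumes V: "module K V" and Z: "module K Z" and \<phi>: "word_multilinear K V Z \<phi>" and v: "v \<in> lists (carrier V)"
  shows "word_multilinear K V Z (\<lambda>u. lsum Z \<phi> (shuffle_list u v))"
    and "word_multilinear K V Z (\<lambda>u. lsum Z \<phi> (shuffle_list v u))"
proof -
  interpret Z: module K Z by fact
  have cl: "lsum Z \<phi> (shuffle_list u v) \<in> carrier Z"
    if "word_multilinear K V Z \<phi>" "u \<in> lists (carrier V)" "v \<in> lists (carrier V)" for \<phi> u v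
    by (rule Z.lsum_closed, rule word_multilinearD(1)[OF that(1)],
        rule lists_shuffle_list[OF _ that(2,3)])
  have cl1: "\<phi> w \<in> carrier Z" if "word_multilinear K V Z \<phi>" "set w \<subseteq> carrier V" for \<phi> w
    by (rule word_multilinearD(1)[OF that(1)]) (use that(2) in auto)
  \<comment> \<open>The function \<phi> is arbitrary in the induction because each step of the
    shuffle recursion prefixes a letter to its argument.\<close>
  have lin: "linear_map K V Z (\<lambda>x. lsum Z \<phi> (shuffle_list (u @ x # w) v))"
    if "word_multilinear K V Z \<phi>" "u \<in> lists (carrier V)" "w \<in> lists (carrier V)" "v \<in> lists (carrier V)" for \<phi> u w v
    using that
  proof (induction u v arbitrary: \<phi> rule: shuffle_list.induct)
    case (1 v)
    then show ?case
    \<comment> \<open>The varying letter is now the first of its word. A second recursion takes off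
      letters of \<open>v\<close> until the varying letter has been placed.\<close>
    proof (induction v arbitrary: \<phi>)
      case Nil
      have "linear_map K V Z (\<lambda>x. \<phi> (x # w))"
        using word_multilinearD(2)[OF Nil.prems(1), of "[]" w] Nil.prems(3) by simp
      from linear_map_add[OF Z this linear_map_const_zero[OF Z]] show ?case by simp
    next
      case (Cons y v)
      have y: "y \<in> carrier V" "v \<in> lists (carrier V)" using Cons.prems by auto
      have 1: "linear_map K V Z (\<lambda>x. lsum Z (\<lambda>z. \<phi> (x # z)) (shuffle_list w (y # v)))"
      proof (rule linear_map_lsum_param[OF Z])
        fix z assume "z \<in> set (shuffle_list w (y # v))"
        then have "z \<in> lists (carrier V)"
          by (rule lists_shuffle_list) (use Cons.prems in auto)
        then show "linear_map K V Z (\<lambda>x. \<phi> (x # z))"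
          using word_multilinearD(2)[OF Cons.prems(1), of "[]" z] by simp
      qed
      have 2: "linear_map K V Z (\<lambda>x. lsum Z (\<lambda>z. \<phi> (y # z)) (shuffle_list ([] @ x # w) v))"
        by (rule Cons.IH[OF word_multilinear_Cons[OF Cons.prems(1) y(1)] _ _ y(2)]) (use Cons.prems in auto)
      show ?case
      proof (rule linear_map_cong[OF V _ linear_map_add[OF Z 1 2]])
        fix x assume x: "x \<in> carrier V"
        show "lsum Z (\<lambda>z. \<phi> (x # z)) (shuffle_list w (y # v)) \<oplus>\<^bsub>Z\<^esub>
          lsum Z (\<lambda>z. \<phi> (y # z)) (shuffle_list ([] @ x # w) v) = lsum Z \<phi> (shuffle_list ([] @ x # w) (y # v))"
          unfolding append_Nil shuffle_list.simps
          by (subst Z.lsum_append) (use Cons.prems(3) x y in \<open>auto intro!: cl1[OF Cons.prems(1)] dest!: set_shuffle_list\<close>)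
      qed
    qed
  next
    case (2 a u)
    have "linear_map K V Z (\<lambda>x. \<phi> ((a # u) @ x # w))"
      by (rule word_multilinearD(2)[OF 2(1,2,3)])
    from linear_map_add[OF Z this linear_map_const_zero[OF Z]] show ?case by simp
  next
    case (3 a u y v)
    have y: "a \<in> carrier V" "u \<in> lists (carrier V)" "y \<in> carrier V" "v \<in> lists (carrier V)"
      "w \<in> lists (carrier V)" using 3(4,5,6) by auto
    have 1: "linear_map K V Z (\<lambda>x. lsum Z (\<lambda>z. \<phi> (a # z)) (shuffle_list (u @ x # w) (y # v)))"
      by (rule "3.IH"(1)[OF word_multilinear_Cons[OF 3(3) y(1)]]) (use y in auto)
    have 2: "linear_map K V Z (\<lambda>x. lsum Z (\<lambda>z. \<phi> (y # z)) (shuffle_list ((a # u) @ x # w) v))"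
      by (rule "3.IH"(2)[OF word_multilinear_Cons[OF 3(3) y(3)]]) (use y in auto)
    show ?case
    proof (rule linear_map_cong[OF V _ linear_map_add[OF Z 1 2]])
      fix x assume x: "x \<in> carrier V"
      have c: "u @ x # w \<in> lists (carrier V)" "a # u @ x # w \<in> lists (carrier V)" using x y by auto
      show "lsum Z (\<lambda>z. \<phi> (a # z)) (shuffle_list (u @ x # w) (y # v)) \<oplus>\<^bsub>Z\<^esub>
        lsum Z (\<lambda>z. \<phi> (y # z)) (shuffle_list ((a # u) @ x # w) v)
        = lsum Z \<phi> (shuffle_list ((a # u) @ x # w) (y # v))"
        unfolding append_Cons shuffle_list.simps
        by (subst Z.lsum_append) (use x y in \<open>auto intro!: cl1[OF 3(3)] dest!: set_shuffle_list\<close>)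
    qed
  qed
  show *: "word_multilinear K V Z (\<lambda>u. lsum Z \<phi> (shuffle_list u v))"
    unfolding word_multilinear_def
    by (intro conjI ballI) (rule cl[OF \<phi> _ v] lin[OF \<phi> _ _ v]; assumption)+
  show "word_multilinear K V Z (\<lambda>u. lsum Z \<phi> (shuffle_list v u))"
    by (rule word_multilinear_cong[OF * V])
      (rule Z.lsum_shuffle_commute[OF word_multilinearD(1)[OF \<phi>]]; (assumption | rule v))
qed

text \<open>Such sums arise when one of the words is empty: a \<open>pairing\<close> with the empty
  word then vanishes at all cuts but an extreme one.\<close>

lemma (in abelian_monoid) lsum_splits_first:
  assumes "\<And>p. \<lbrakk>p \<in> set (splits w); fst p \<noteq> []\<rbrakk> \<Longrightarrow> \<phi> p = \<zero>" "\<phi> ([], w) \<in> carrier G"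
  shows "lsum G \<phi> (splits w) = \<phi> ([], w)"
proof (cases w)
  case (Cons x v)
  have "lsum G (\<lambda>p. \<phi> (x # fst p, snd p)) (splits v) = \<zero>"
    by (rule lsum_zero) (rule assms(1), auto simp: Cons)
  then show ?thesis using assms(2) by (simp add: Cons)
qed (use assms(2) in simp)

lemma (in abelian_monoid) lsum_splits_last:
  assumes "\<And>p. \<lbrakk>p \<in> set (splits w); snd p \<noteq> []\<rbrakk> \<Longrightarrow> \<phi> p = \<zero>" "\<phi> (w, []) \<in> carrier G"
  shows "lsum G \<phi> (splits w) = \<phi> (w, [])"
  using assms
proof (induction w arbitrary: \<phi>)
  case (Cons x w)
  have "lsum G (\<lambda>p. \<phi> (x # fst p, snd p)) (splits w) = \<phi> (x # w, [])"
    using Cons.IH[of "\<lambda>p. \<phi> (x # fst p, snd p)"] Cons.prems by auto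
  moreover have "\<phi> ([], x # w) = \<zero>" by (rule Cons.prems(1)) auto
  ultimately show ?case using Cons.prems(2) by simp
qed simp

text \<open>The laws of the shuffle product enter as \<open>shuffle_alg\<close>; in the theorem they
  are part of \<open>algebra_basis\<close>. The laws of the twisted product are proved from them and
  from the relations of \<open>J2\<close>.\<close>

locale shuffle_context =
  fixes K :: "('a, 'k) ring_scheme" and V :: "('a, 'v, 'y) module_scheme"
  assumes V_module: "module K V" and shuffle_alg: "algebra K (shuffle_algebra K V)"
begin

abbreviation "T \<equiv> tensors K V"
abbreviation "W \<equiv> lists (carrier V)"
abbreviation "C \<equiv> C2 K V"

sublocale K: cring K by (rule module_cring[OF V_module])
sublocale T: module K T by (rule module_tensors[OF V_module])

lemma T_module: "module K T"
  by (rule module_tensors[OF V_module])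

lemma tensor_cons_linear:
  assumes "x \<in> carrier V"
  shows "linear_map K T T (tensor_cons K V x)"
  unfolding tensor_cons_def
  by (rule tensors_lift(1)[OF V_module T_module word_multilinear_Cons[OF pure_multilinear[OF V_module] assms]])

lemma tensor_cons_pure:
  assumes "x \<in> carrier V" "w \<in> W"
  shows "tensor_cons K V x (pure K V w) = pure K V (x # w)"
  unfolding tensor_cons_def
  by (rule tensors_lift(2)[OF V_module T_module word_multilinear_Cons[OF pure_multilinear[OF V_module] assms(1)] assms(2)])

lemma pure_closed': "w \<in> W \<Longrightarrow> pure K V w \<in> carrier T"
  by (rule pure_closed[OF V_module])

lemma pure_shuffle_closed:
  assumes "u \<in> W" "w \<in> W" "z \<in> set (shuffle_list u w)"
  shows "pure K V z \<in> carrier T"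
  by (rule pure_closed'[OF lists_shuffle_list[OF assms(3,1,2)]])

text \<open>Replaces the recursion through \<open>tensor_cons\<close> inside the module by a sum
  over a list of words. The later arguments about cuts and shuffles are then purely
  combinatorial.\<close>

lemma shuffle_words_eq:
  assumes "u \<in> W" "w \<in> W"
  shows "shuffle_words K V u w = lsum T (pure K V) (shuffle_list u w)"
  using assms
proof (induction u w rule: shuffle_list.induct)
  case (1 w)
  then show ?case using pure_closed'[of w] by (simp del: in_lists_conv_set)
next
  case (2 x u)
  then show ?case using pure_closed'[of "x # u"] by (simp del: in_lists_conv_set)
next
  case (3 x u y w)
  have c: "x \<in> carrier V" "u \<in> W" "y # w \<in> W" "y \<in> carrier V" "x # u \<in> W" "w \<in> W"
    using 3(3,4) by auto
  have cons: "tensor_cons K V a (lsum T (pure K V) (shuffle_list u w))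
      = lsum T (pure K V) (map ((#) a) (shuffle_list u w))"
    if "a \<in> carrier V" "u \<in> W" "w \<in> W" for a u w
  proof -
    have "tensor_cons K V a (lsum T (pure K V) (shuffle_list u w))
        = lsum T (\<lambda>z. tensor_cons K V a (pure K V z)) (shuffle_list u w)"
      by (rule linear_map_lsum[OF T_module T_module tensor_cons_linear[OF that(1)]])
        (rule pure_shuffle_closed[OF that(2,3)])
    also have "\<dots> = lsum T (\<lambda>z. pure K V (a # z)) (shuffle_list u w)"
      by (rule lsum_cong) (rule tensor_cons_pure[OF that(1) lists_shuffle_list[OF _ that(2,3)]])
    finally show ?thesis by simp
  qed
  have cl: "pure K V z \<in> carrier T" if "z \<in> set (map ((#) a) (shuffle_list u w))"
    "a \<in> carrier V" "u \<in> W" "w \<in> W" for z a u w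
    using that by (auto intro!: pure_closed' dest!: set_shuffle_list)
  show ?case
    unfolding shuffle_words.simps shuffle_list.simps
      "3.IH"(1)[OF c(2,3)] "3.IH"(2)[OF c(5,6)] cons[OF c(1,2,3)] cons[OF c(4,5,6)]
    by (rule T.lsum_append[symmetric]) (erule cl; rule c)+
qed

lemma shuffle_words_multilinear:
  assumes "w \<in> W"
  shows "word_multilinear K V T (\<lambda>u. shuffle_words K V u w)"
    and "word_multilinear K V T (shuffle_words K V w)"
proof -
  note m = word_multilinear_shuffle[OF V_module T_module pure_multilinear[OF V_module] assms]
  show "word_multilinear K V T (\<lambda>u. shuffle_words K V u w)"
    by (rule word_multilinear_cong[OF m(1) V_module]) (rule shuffle_words_eq[symmetric, OF _ assms])
  show "word_multilinear K V T (shuffle_words K V w)"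
    by (rule word_multilinear_cong[OF m(2) V_module]) (rule shuffle_words_eq[symmetric, OF assms])
qed

abbreviation "Sh \<equiv> shuffle_algebra K V"

lemma shuffle_algebra_simps [simp]:
  "carrier Sh = carrier T" "zero Sh = zero T" "add Sh = add T" "smult Sh = smult T"
  "one Sh = pure K V []"
  by (simp_all add: shuffle_algebra_def)

lemma shuffle_bilinear: "bilinear_map K T T T (mult Sh)"
  and shuffle_pure: "\<lbrakk>u \<in> W; w \<in> W\<rbrakk> \<Longrightarrow> pure K V u \<otimes>\<^bsub>Sh\<^esub> pure K V w = shuffle_words K V u w"
  using tensors_bilinear_lift[OF V_module T_module shuffle_words_multilinear]
  by (simp_all add: shuffle_algebra_def)

sublocale Sh: algebra K Sh by (rule shuffle_alg)

section \<open>Positive degree tensors and the algebra of constants\<close>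

abbreviation "TP \<equiv> tensors_plus K V"

lemma tensor_power_subset: "{pure K V w | w. w \<in> W \<and> length w = n} \<subseteq> carrier T"
  using pure_closed' by blast

lemma pure_in_tensor_power: "\<lbrakk>w \<in> W; length w = n\<rbrakk> \<Longrightarrow> pure K V w \<in> tensor_power K V n"
  unfolding tensor_power_def using submodule_mspan(2)[OF T_module tensor_power_subset] by blast

lemma tensor_power_submodule: "submodule (tensor_power K V n) K T"
  unfolding tensor_power_def by (rule submodule_mspan(1)[OF T_module tensor_power_subset])

lemma tensor_power_closed: "t \<in> tensor_power K V n \<Longrightarrow> t \<in> carrier T"
  using submodule_mspan(3)[OF T_module tensor_power_subset] unfolding tensor_power_def by blast

lemma plus_subset: "(\<Union>n\<in>{1..}. tensor_power K V n) \<subseteq> carrier T"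
  using tensor_power_closed by blast

lemma TP_module: "module K TP"
  unfolding tensors_plus_def
  by (rule submodule.submodule_is_module[OF submodule_mspan(1)[OF T_module plus_subset] T_module])

lemma TP_simps [simp]: "zero TP = zero T" "add TP = add T" "smult TP = smult T"
  by (simp_all add: tensors_plus_def)

lemma pure_TP:
  assumes "w \<in> W" "w \<noteq> []"
  shows "pure K V w \<in> carrier TP"
proof -
  have "pure K V w \<in> (\<Union>n\<in>{1..}. tensor_power K V n)"
    using pure_in_tensor_power[OF assms(1) refl] assms(2) by (auto simp: Suc_le_eq)
  then show ?thesis
    unfolding tensors_plus_def using submodule_mspan(2)[OF T_module plus_subset] by auto
qed

lemma lsum_TP: "lsum TP \<phi> xs = lsum T \<phi> xs"
  by (induction xs) auto

sublocale TP: module K TP by (rule TP_module)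

lemma shuffle_words_TP:
  assumes "u \<in> W" "w \<in> W" "u \<noteq> [] \<or> w \<noteq> []"
  shows "shuffle_words K V u w \<in> carrier TP"
  unfolding shuffle_words_eq[OF assms(1,2)] lsum_TP[symmetric]
proof (rule TP.lsum_closed)
  fix z assume z: "z \<in> set (shuffle_list u w)"
  show "pure K V z \<in> carrier TP"
    by (rule pure_TP[OF lists_shuffle_list[OF z assms(1,2)]])
      (use length_shuffle_list[OF z] assms(3) in auto)
qed

section \<open>The algebra C2 and its defining relations\<close>

abbreviation "SQ \<equiv> sym_square K TP"
abbreviation "S2 \<equiv> Sym2 K V"

lemma SQ_module: "module K SQ"
  by (rule module_sym_square[OF TP_module])

lemma S2_algebra: "algebra K S2"
  unfolding Sym2_def by (rule algebra_sym_algebra[OF SQ_module])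

sublocale S2: algebra K S2 by (rule S2_algebra)

lemma eps_Sym2_bilinear: "bilinear_map K TP TP S2 (eps_Sym2 K V)"
proof -
  have "linear_map K SQ S2 (\<lambda>x. sym_monom K SQ (add_mset x {#}))"
    using sym_monom_linear[OF SQ_module, of "{#}"]
    by (simp add: Sym2_def linear_map_def sym_algebra_simps[OF SQ_module])
  from linear_bilinear_compose[OF bilinear_sym_elt[OF TP_module] this]
  show ?thesis by (simp add: eps_Sym2_def[abs_def])
qed

text \<open>The pairing is available only for tensors of positive degree. The upper bounds keep the
  suffixes nonempty, and the lower bound \<open>1 - j\<close> prevents both prefixes from being
  empty, so that their shuffle has positive degree.\<close>

lemma J2_rel_closed:
  assumes "f \<in> W" "g \<in> W" "h \<in> W" "f \<noteq> []" "g \<noteq> []" "h \<noteq> []"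
  shows "eps_Sym2 K V (shuffle_words K V f g) (pure K V h) \<in> carrier S2"
    and "eps_Sym2 K V (pure K V f) (shuffle_words K V g h) \<in> carrier S2"
    and "\<lbrakk>j < length g; i \<in> {1 - j..<length f}\<rbrakk> \<Longrightarrow>
      eps_Sym2 K V (pure K V (drop i f)) (pure K V (drop j g)) \<in> carrier S2 \<and>
      eps_Sym2 K V (shuffle_words K V (take i f) (take j g)) (pure K V h) \<in> carrier S2"
    and "\<lbrakk>j < length g; k \<in> {1 - j..<length h}\<rbrakk> \<Longrightarrow>
      eps_Sym2 K V (pure K V f) (shuffle_words K V (take j g) (take k h)) \<in> carrier S2 \<and>
      eps_Sym2 K V (pure K V (drop j g)) (pure K V (drop k h)) \<in> carrier S2"
proof -
  note cl = bilinear_map_closed[OF eps_Sym2_bilinear]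
  have td: "take i w \<in> W" "drop i w \<in> W" if "w \<in> W" for i w
    using that by (auto dest: in_set_takeD in_set_dropD)
  show "eps_Sym2 K V (shuffle_words K V f g) (pure K V h) \<in> carrier S2"
    "eps_Sym2 K V (pure K V f) (shuffle_words K V g h) \<in> carrier S2"
    using assms by (intro cl shuffle_words_TP pure_TP; simp)+
  show "eps_Sym2 K V (pure K V (drop i f)) (pure K V (drop j g)) \<in> carrier S2 \<and>
      eps_Sym2 K V (shuffle_words K V (take i f) (take j g)) (pure K V h) \<in> carrier S2"
    if "j < length g" "i \<in> {1 - j..<length f}"
    by (intro conjI cl shuffle_words_TP pure_TP td assms) (use that assms in \<open>auto\<close>)
  show "eps_Sym2 K V (pure K V f) (shuffle_words K V (take j g) (take k h)) \<in> carrier S2 \<and>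
      eps_Sym2 K V (pure K V (drop j g)) (pure K V (drop k h)) \<in> carrier S2"
    if "j < length g" "k \<in> {1 - j..<length h}"
    by (intro conjI cl shuffle_words_TP pure_TP td assms) (use that assms in \<open>auto\<close>)
qed

definition J2_left where
  "J2_left f g h j i = eps_Sym2 K V (pure K V (drop i f)) (pure K V (drop j g))
     \<otimes>\<^bsub>S2\<^esub> eps_Sym2 K V (shuffle_words K V (take i f) (take j g)) (pure K V h)"

definition J2_right where
  "J2_right f g h j k = eps_Sym2 K V (pure K V f) (shuffle_words K V (take j g) (take k h))
     \<otimes>\<^bsub>S2\<^esub> eps_Sym2 K V (pure K V (drop j g)) (pure K V (drop k h))"

lemma J2_summands_closed:
  assumes "f \<in> W" "g \<in> W" "h \<in> W" "f \<noteq> []" "g \<noteq> []" "h \<noteq> []" "j < length g"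
  shows "i \<in> {1 - j..<length f} \<Longrightarrow> J2_left f g h j i \<in> carrier S2"
    and "k \<in> {1 - j..<length h} \<Longrightarrow> J2_right f g h j k \<in> carrier S2"
    and "(\<Oplus>\<^bsub>S2\<^esub>i\<in>{1 - j..<length f}. J2_left f g h j i) \<in> carrier S2"
    and "(\<Oplus>\<^bsub>S2\<^esub>k\<in>{1 - j..<length h}. J2_right f g h j k) \<in> carrier S2"
proof -
  show 1: "J2_left f g h j i \<in> carrier S2" if "i \<in> {1 - j..<length f}" for i
    unfolding J2_left_def using J2_rel_closed(3)[OF assms(1-6) assms(7) that] by simp
  show 2: "J2_right f g h j k \<in> carrier S2" if "k \<in> {1 - j..<length h}" for k
    unfolding J2_right_def using J2_rel_closed(4)[OF assms(1-6) assms(7) that] by simp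
  show "(\<Oplus>\<^bsub>S2\<^esub>i\<in>{1 - j..<length f}. J2_left f g h j i) \<in> carrier S2"
    "(\<Oplus>\<^bsub>S2\<^esub>k\<in>{1 - j..<length h}. J2_right f g h j k) \<in> carrier S2"
    using 1 2 by (auto intro!: S2.finsum_closed)
qed

lemma J2_rel_eq:
  "J2_rel K V f g h =
     (eps_Sym2 K V (shuffle_words K V f g) (pure K V h) \<ominus>\<^bsub>S2\<^esub> eps_Sym2 K V (pure K V f) (shuffle_words K V g h))
     \<oplus>\<^bsub>S2\<^esub> (\<Oplus>\<^bsub>S2\<^esub>j\<in>{0..<length g}. (\<Oplus>\<^bsub>S2\<^esub>i\<in>{1 - j..<length f}. J2_left f g h j i)
        \<ominus>\<^bsub>S2\<^esub> (\<Oplus>\<^bsub>S2\<^esub>k\<in>{1 - j..<length h}. J2_right f g h j k))"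
  by (simp add: J2_rel_def Let_def J2_left_def J2_right_def)

lemma J2_rel_in_carrier:
  assumes "f \<in> W" "g \<in> W" "h \<in> W" "f \<noteq> []" "g \<noteq> []" "h \<noteq> []"
  shows "J2_rel K V f g h \<in> carrier S2"
  unfolding J2_rel_eq
  using J2_rel_closed(1,2)[OF assms] J2_summands_closed(3,4)[OF assms]
  by (intro S2.a_closed S2.minus_closed S2.finsum_closed) auto

lemma J2_gens: "{J2_rel K V f g h | f g h. f \<in> W - {[]} \<and> g \<in> W - {[]} \<and> h \<in> W - {[]}} \<subseteq> carrier S2"
  using J2_rel_in_carrier by blast

lemma J2_ideal: "ideal (J2 K V) S2"
  unfolding J2_def by (rule S2.genideal_ideal[OF J2_gens])

lemma C_algebra: "algebra K C"
  unfolding C2_def by (rule algebra_quot_algebra[OF S2_algebra J2_ideal])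

sublocale C: algebra K C by (rule C_algebra)

abbreviation "\<pi> \<equiv> (\<lambda>x. J2 K V +>\<^bsub>S2\<^esub> x)"

lemma \<pi>_linear: "linear_map K S2 C \<pi>"
  unfolding C2_def by (rule linear_map_coset[OF S2.module ideal_submodule[OF S2_algebra J2_ideal]])

lemma \<pi>_closed: "x \<in> carrier S2 \<Longrightarrow> \<pi> x \<in> carrier C"
  by (rule linear_mapD(1)[OF \<pi>_linear])

lemma \<pi>_mult: "\<lbrakk>x \<in> carrier S2; y \<in> carrier S2\<rbrakk> \<Longrightarrow> \<pi> (x \<otimes>\<^bsub>S2\<^esub> y) = \<pi> x \<otimes>\<^bsub>C\<^esub> \<pi> y"
  unfolding C2_def by (rule quot_algebra_mult[OF J2_ideal, symmetric])

lemma \<pi>_minus: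
  assumes "x \<in> carrier S2" "y \<in> carrier S2"
  shows "\<pi> (x \<ominus>\<^bsub>S2\<^esub> y) = \<pi> x \<ominus>\<^bsub>C\<^esub> \<pi> y"
  by (rule linear_map_minus[OF S2.module C.module \<pi>_linear assms])

lemma eps2_eq: "eps2 K V s t = \<pi> (eps_Sym2 K V s t)"
  by (simp add: eps2_def)

lemma eps2_bilinear: "bilinear_map K TP TP C (eps2 K V)"
  using linear_bilinear_compose[OF eps_Sym2_bilinear \<pi>_linear] by (simp add: eps2_def[abs_def])

lemma eps2_commute:
  assumes "s \<in> carrier TP" "t \<in> carrier TP"
  shows "eps2 K V s t = eps2 K V t s"
  by (simp add: eps2_def eps_Sym2_def sym_elt_commute[OF TP_module assms])

text \<open>The generator of the ideal becomes zero in C2. Collecting its positive and its negative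
  terms on different sides gives an equation without subtraction, whose two sides can be matched
  with \<open>cocycle_sum\<close>.\<close>

lemma eps2_relation:
  assumes "f \<in> W" "g \<in> W" "h \<in> W" "f \<noteq> []" "g \<noteq> []" "h \<noteq> []"
  shows "eps2 K V (shuffle_words K V f g) (pure K V h)
      \<oplus>\<^bsub>C\<^esub> lsum C (\<lambda>j. lsum C (\<lambda>i. eps2 K V (pure K V (drop i f)) (pure K V (drop j g)) \<otimes>\<^bsub>C\<^esub>
          eps2 K V (shuffle_words K V (take i f) (take j g)) (pure K V h)) [1 - j..<length f]) [0..<length g]
    = eps2 K V (pure K V f) (shuffle_words K V g h)
      \<oplus>\<^bsub>C\<^esub> lsum C (\<lambda>j. lsum C (\<lambda>k. eps2 K V (pure K V f) (shuffle_words K V (take j g) (take k h)) \<otimes>\<^bsub>C\<^esub>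
          eps2 K V (pure K V (drop j g)) (pure K V (drop k h))) [1 - j..<length h]) [0..<length g]"
proof -
  note c = J2_rel_closed[OF assms] and s = J2_summands_closed[OF assms]
  let ?L = "\<lambda>j. \<Oplus>\<^bsub>S2\<^esub>i\<in>{1 - j..<length f}. J2_left f g h j i"
  let ?R = "\<lambda>j. \<Oplus>\<^bsub>S2\<^esub>k\<in>{1 - j..<length h}. J2_right f g h j k"
  let ?a = "\<pi> (eps_Sym2 K V (shuffle_words K V f g) (pure K V h))"
  let ?b = "\<pi> (eps_Sym2 K V (pure K V f) (shuffle_words K V g h))"
  have "J2_rel K V f g h \<in> J2 K V"
    unfolding J2_def using S2.genideal_self[OF J2_gens] assms by blast
  then have 0: "\<pi> (J2_rel K V f g h) = \<zero>\<^bsub>C\<^esub>"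
    unfolding C2_def by (rule coset_zero[OF S2.module ideal_submodule[OF S2_algebra J2_ideal]])
  have L: "\<pi> (?L j) = lsum C (\<lambda>i. \<pi> (J2_left f g h j i)) [1 - j..<length f]" if "j < length g" for j
  proof -
    have "\<pi> (?L j) = (\<Oplus>\<^bsub>C\<^esub>i\<in>{1 - j..<length f}. \<pi> (J2_left f g h j i))"
      by (rule finsum_linear_map[OF S2.module C.module \<pi>_linear]) (use s(1)[OF that] in auto)
    also have "\<dots> = lsum C (\<lambda>i. \<pi> (J2_left f g h j i)) [1 - j..<length f]"
      by (rule C.finsum_eq_lsum) (rule \<pi>_closed[OF s(1)[OF that]])
    finally show ?thesis .
  qed
  have R: "\<pi> (?R j) = lsum C (\<lambda>i. \<pi> (J2_right f g h j i)) [1 - j..<length h]" if "j < length g" for j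
  proof -
    have "\<pi> (?R j) = (\<Oplus>\<^bsub>C\<^esub>i\<in>{1 - j..<length h}. \<pi> (J2_right f g h j i))"
      by (rule finsum_linear_map[OF S2.module C.module \<pi>_linear]) (use s(2)[OF that] in auto)
    also have "\<dots> = lsum C (\<lambda>i. \<pi> (J2_right f g h j i)) [1 - j..<length h]"
      by (rule C.finsum_eq_lsum) (rule \<pi>_closed[OF s(2)[OF that]])
    finally show ?thesis .
  qed
  have cl: "\<pi> (?L j) \<in> carrier C" "\<pi> (?R j) \<in> carrier C" if "j < length g" for j
    using \<pi>_closed s(3,4)[OF that] by auto
  have ab: "?a \<in> carrier C" "?b \<in> carrier C" using \<pi>_closed c(1,2) by auto
  have sumL: "lsum C (\<lambda>j. \<pi> (?L j)) [0..<length g] \<in> carrier C"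
    and sumR: "lsum C (\<lambda>j. \<pi> (?R j)) [0..<length g] \<in> carrier C"
    by (rule C.lsum_closed, rule cl, simp)+
  have "\<zero>\<^bsub>C\<^esub> = (?a \<ominus>\<^bsub>C\<^esub> ?b) \<oplus>\<^bsub>C\<^esub> \<pi> (\<Oplus>\<^bsub>S2\<^esub>j\<in>{0..<length g}. ?L j \<ominus>\<^bsub>S2\<^esub> ?R j)"
    unfolding 0[symmetric] J2_rel_eq \<pi>_minus[OF c(1,2), symmetric]
    by (rule linear_mapD(2)[OF \<pi>_linear])
      (use c(1,2) s(3,4) in \<open>auto intro!: S2.minus_closed S2.finsum_closed\<close>)
  also have "\<pi> (\<Oplus>\<^bsub>S2\<^esub>j\<in>{0..<length g}. ?L j \<ominus>\<^bsub>S2\<^esub> ?R j) = (\<Oplus>\<^bsub>C\<^esub>j\<in>{0..<length g}. \<pi> (?L j \<ominus>\<^bsub>S2\<^esub> ?R j))"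
    by (rule finsum_linear_map[OF S2.module C.module \<pi>_linear]) (use s(3,4) in auto)
  also have "\<dots> = (\<Oplus>\<^bsub>C\<^esub>j\<in>{0..<length g}. \<pi> (?L j) \<ominus>\<^bsub>C\<^esub> \<pi> (?R j))"
    by (rule C.finsum_cong') (use s(3,4) cl in \<open>auto simp: \<pi>_minus\<close>)
  also have "\<dots> = lsum C (\<lambda>j. \<pi> (?L j) \<ominus>\<^bsub>C\<^esub> \<pi> (?R j)) [0..<length g]"
    by (rule C.finsum_eq_lsum) (use cl in auto)
  also have "lsum C (\<lambda>j. \<pi> (?L j) \<ominus>\<^bsub>C\<^esub> \<pi> (?R j)) [0..<length g]
      = lsum C (\<lambda>j. \<pi> (?L j)) [0..<length g] \<ominus>\<^bsub>C\<^esub> lsum C (\<lambda>j. \<pi> (?R j)) [0..<length g]"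
    (is "?l = ?m \<ominus>\<^bsub>C\<^esub> ?n")
  proof -
    have "?l \<oplus>\<^bsub>C\<^esub> ?n = lsum C (\<lambda>j. (\<pi> (?L j) \<ominus>\<^bsub>C\<^esub> \<pi> (?R j)) \<oplus>\<^bsub>C\<^esub> \<pi> (?R j)) [0..<length g]"
      by (rule C.lsum_add[symmetric]) (use cl in auto)
    also have "\<dots> = ?m"
      by (rule lsum_cong) (use cl in \<open>simp add: C.minus_eq C.a_assoc C.l_neg\<close>)
    finally have *: "?l \<oplus>\<^bsub>C\<^esub> ?n = ?m" .
    have "?l \<in> carrier C" by (rule C.lsum_closed) (use cl in auto)
    then show ?thesis unfolding *[symmetric] using sumR by (simp add: C.minus_eq C.a_assoc C.r_neg)
  qed
  \<comment> \<open>So far zero has been written as (a - b) + (m - n), where m and n are the two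
    double sums; adding b + n gives the two-sided form.\<close>
  finally have "?b \<oplus>\<^bsub>C\<^esub> ?n = (?b \<oplus>\<^bsub>C\<^esub> ?n) \<oplus>\<^bsub>C\<^esub> ((?a \<ominus>\<^bsub>C\<^esub> ?b) \<oplus>\<^bsub>C\<^esub> (?m \<ominus>\<^bsub>C\<^esub> ?n))"
    using ab sumR sumL by simp
  also have "\<dots> = ?a \<oplus>\<^bsub>C\<^esub> ?m"
  proof -
    have "(b \<oplus>\<^bsub>C\<^esub> n) \<oplus>\<^bsub>C\<^esub> ((a \<ominus>\<^bsub>C\<^esub> b) \<oplus>\<^bsub>C\<^esub> (m \<ominus>\<^bsub>C\<^esub> n)) = a \<oplus>\<^bsub>C\<^esub> m"
      if "a \<in> carrier C" "b \<in> carrier C" "m \<in> carrier C" "n \<in> carrier C" for a b m n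
    proof -
      have "(b \<oplus>\<^bsub>C\<^esub> n) \<oplus>\<^bsub>C\<^esub> ((a \<ominus>\<^bsub>C\<^esub> b) \<oplus>\<^bsub>C\<^esub> (m \<ominus>\<^bsub>C\<^esub> n))
          = (a \<oplus>\<^bsub>C\<^esub> m) \<oplus>\<^bsub>C\<^esub> ((b \<ominus>\<^bsub>C\<^esub> b) \<oplus>\<^bsub>C\<^esub> (n \<ominus>\<^bsub>C\<^esub> n))"
        using that by (simp add: C.minus_eq C.a_ac)
      then show ?thesis using that by (simp add: C.minus_eq C.r_neg)
    qed
    then show ?thesis using ab sumL sumR by blast
  qed
  finally have main: "?a \<oplus>\<^bsub>C\<^esub> ?m = ?b \<oplus>\<^bsub>C\<^esub> ?n" by simp
  have "?m = lsum C (\<lambda>j. lsum C (\<lambda>i. eps2 K V (pure K V (drop i f)) (pure K V (drop j g)) \<otimes>\<^bsub>C\<^esub>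
          eps2 K V (shuffle_words K V (take i f) (take j g)) (pure K V h)) [1 - j..<length f]) [0..<length g]"
  proof (rule lsum_cong)
    fix j assume "j \<in> set [0..<length g]"
    then have j: "j < length g" by simp
    show "\<pi> (?L j) = lsum C (\<lambda>i. eps2 K V (pure K V (drop i f)) (pure K V (drop j g)) \<otimes>\<^bsub>C\<^esub>
          eps2 K V (shuffle_words K V (take i f) (take j g)) (pure K V h)) [1 - j..<length f]"
      by (subst L[OF j], rule lsum_cong)
        (use c(3)[OF j] in \<open>auto simp: J2_left_def eps2_eq intro!: \<pi>_mult\<close>)
  qed
  moreover have "?n = lsum C (\<lambda>j. lsum C (\<lambda>k. eps2 K V (pure K V f) (shuffle_words K V (take j g) (take k h)) \<otimes>\<^bsub>C\<^esub>
          eps2 K V (pure K V (drop j g)) (pure K V (drop k h))) [1 - j..<length h]) [0..<length g]"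
  proof (rule lsum_cong)
    fix j assume "j \<in> set [0..<length g]"
    then have j: "j < length g" by simp
    show "\<pi> (?R j) = lsum C (\<lambda>k. eps2 K V (pure K V f) (shuffle_words K V (take j g) (take k h)) \<otimes>\<^bsub>C\<^esub>
          eps2 K V (pure K V (drop j g)) (pure K V (drop k h))) [1 - j..<length h]"
      by (subst R[OF j], rule lsum_cong)
        (use c(4)[OF j] in \<open>auto simp: J2_right_def eps2_eq intro!: \<pi>_mult\<close>)
  qed
  ultimately show ?thesis using main by (simp add: eps2_eq)
qed


section \<open>The cocycle identity\<close>

text \<open>The versions \<open>pure0\<close> of \<open>pure\<close> and \<open>pairing\<close> of \<open>eps2\<close> are extended by zero to words outside \<open>W\<close>,
  so that sums over words need no side conditions. On empty words, \<open>pairing\<close> is the unit or zero,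
  which turns the product on \<open>C2T\<close> into a single sum over all pairs of splittings.\<close>

definition pure0 :: "'v list \<Rightarrow> ('v list \<Rightarrow> 'a) set" where
  "pure0 w = (if w \<in> W then pure K V w else \<zero>\<^bsub>T\<^esub>)"

definition pairing :: "'v list \<Rightarrow> 'v list \<Rightarrow> ('a, 'v) sym2 set" where
  "pairing u v = (if u \<in> W \<and> v \<in> W then
     (if u = [] then (if v = [] then \<one>\<^bsub>C\<^esub> else \<zero>\<^bsub>C\<^esub>) else if v = [] then \<zero>\<^bsub>C\<^esub> else eps2 K V (pure K V u) (pure K V v))
     else \<zero>\<^bsub>C\<^esub>)"

text \<open>The value e(u \<squnion> v, w), by linear extension in the first argument.\<close>

definition pairing_shuffle :: "'v list \<Rightarrow> 'v list \<Rightarrow> 'v list \<Rightarrow> ('a, 'v) sym2 set" where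
  "pairing_shuffle u v w = lsum C (\<lambda>x. pairing x w) (shuffle_list u v)"

text \<open>One side of the two-cocycle condition: e(f'', g'') e(f' \<squnion> g', h), summed over
  the cuts f = f' f'' and g = g' g''.\<close>

definition cocycle_sum :: "'v list \<Rightarrow> 'v list \<Rightarrow> 'v list \<Rightarrow> ('a, 'v) sym2 set" where
  "cocycle_sum f g h = lsum C (\<lambda>p. lsum C (\<lambda>q. pairing (snd p) (snd q) \<otimes>\<^bsub>C\<^esub> pairing_shuffle (fst p) (fst q) h) (splits g)) (splits f)"

lemma pure0_closed [simp]: "pure0 w \<in> carrier T"
  using pure_closed' by (simp add: pure0_def del: in_lists_conv_set)

lemma pairing_closed [simp]: "pairing u v \<in> carrier C"
  using bilinear_map_closed[OF eps2_bilinear pure_TP pure_TP, of u v]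
  by (simp add: pairing_def del: in_lists_conv_set)

lemma pairing_shuffle_closed [simp]: "pairing_shuffle u v w \<in> carrier C"
  by (simp add: pairing_shuffle_def)

lemma cocycle_sum_closed [simp]: "cocycle_sum f g h \<in> carrier C"
  by (simp add: cocycle_sum_def)

lemma pairing_simps:
  "pairing [] [] = \<one>\<^bsub>C\<^esub>"
  "w \<noteq> [] \<Longrightarrow> pairing [] w = \<zero>\<^bsub>C\<^esub>"
  "w \<noteq> [] \<Longrightarrow> pairing w [] = \<zero>\<^bsub>C\<^esub>"
  "\<lbrakk>u \<in> W; v \<in> W; u \<noteq> []; v \<noteq> []\<rbrakk> \<Longrightarrow> pairing u v = eps2 K V (pure K V u) (pure K V v)"
  by (simp_all add: pairing_def)

lemma pairing_commute: "pairing u v = pairing v u"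
  using eps2_commute[OF pure_TP pure_TP, of u v] by (simp add: pairing_def del: in_lists_conv_set)

lemma pairing_shuffle_Nil: "pairing_shuffle [] v w = pairing v w" "pairing_shuffle v [] w = pairing v w"
  by (simp_all add: pairing_shuffle_def)

lemma pairing_shuffle_empty_right: "pairing_shuffle u v [] = (if u = [] \<and> v = [] then \<one>\<^bsub>C\<^esub> else \<zero>\<^bsub>C\<^esub>)"
proof (cases "u = [] \<and> v = []")
  case False
  have "pairing x [] = \<zero>\<^bsub>C\<^esub>" if "x \<in> set (shuffle_list u v)" for x
    using length_shuffle_list[OF that] False by (intro pairing_simps) auto
  then have "pairing_shuffle u v [] = \<zero>\<^bsub>C\<^esub>" unfolding pairing_shuffle_def by (rule C.lsum_zero)
  then show ?thesis using False by (simp only: if_False)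
qed (simp add: pairing_shuffle_def pairing_simps)

lemma pairing_shuffle_eq_eps2:
  assumes "u \<in> W" "v \<in> W" "w \<in> W" "w \<noteq> []" "u \<noteq> [] \<or> v \<noteq> []"
  shows "pairing_shuffle u v w = eps2 K V (shuffle_words K V u v) (pure K V w)"
proof -
  have W: "pure K V x \<in> carrier TP" "pairing x w = eps2 K V (pure K V x) (pure K V w)"
    if x: "x \<in> set (shuffle_list u v)" for x
  proof -
    have "x \<in> W" by (rule lists_shuffle_list[OF x assms(1,2)])
    moreover have "x \<noteq> []" using length_shuffle_list[OF x] assms(5) by auto
    ultimately show "pure K V x \<in> carrier TP" "pairing x w = eps2 K V (pure K V x) (pure K V w)"
      by (rule pure_TP, rule pairing_simps(4)[OF _ assms(3) _ assms(4)])
  qed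
  have "eps2 K V (lsum TP (pure K V) (shuffle_list u v)) (pure K V w)
      = lsum C (\<lambda>x. eps2 K V (pure K V x) (pure K V w)) (shuffle_list u v)"
    by (rule linear_map_lsum[OF TP_module C.module bilinear_mapD(2)[OF eps2_bilinear pure_TP[OF assms(3,4)]]])
      (rule W)
  also have "\<dots> = pairing_shuffle u v w"
    unfolding pairing_shuffle_def by (rule lsum_cong) (simp add: W)
  finally show ?thesis by (simp add: shuffle_words_eq[OF assms(1,2)] lsum_TP)
qed

lemma td_W: "w \<in> W \<Longrightarrow> take i w \<in> W" "w \<in> W \<Longrightarrow> drop i w \<in> W"
  by (auto dest: in_set_takeD in_set_dropD)

text \<open>The values of \<open>pairing\<close> at the empty word account for the difference in
  form. Cutting both \<open>f\<close> and \<open>g\<close> at the end gives the isolated term;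
  cutting just one of them at the end gives zero, as does cutting both at the beginning. The double
  sum over the remaining cuts is the one of \<open>J2_rel\<close>.\<close>

lemma cocycle_sum_nonempty:
  assumes W: "f \<in> W" "g \<in> W" "h \<in> W" and ne: "f \<noteq> []" "g \<noteq> []" "h \<noteq> []"
  shows "cocycle_sum f g h = eps2 K V (shuffle_words K V f g) (pure K V h)
      \<oplus>\<^bsub>C\<^esub> lsum C (\<lambda>j. lsum C (\<lambda>i. eps2 K V (pure K V (drop i f)) (pure K V (drop j g)) \<otimes>\<^bsub>C\<^esub>
          eps2 K V (shuffle_words K V (take i f) (take j g)) (pure K V h)) [1 - j..<length f]) [0..<length g]"
proof -
  define G where "G i j = pairing (drop i f) (drop j g) \<otimes>\<^bsub>C\<^esub> pairing_shuffle (take i f) (take j g) h" for i j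
  have [simp]: "G i j \<in> carrier C" for i j by (simp add: G_def)
  let ?n = "length f" and ?m = "length g"
  have "cocycle_sum f g h = lsum C (\<lambda>i. lsum C (\<lambda>j. G i j) [0..<Suc ?m]) [0..<Suc ?n]"
    unfolding cocycle_sum_def splits_eq lsum_map fst_conv snd_conv G_def by simp
  also have "\<dots> = lsum C (\<lambda>j. lsum C (\<lambda>i. G i j) [0..<Suc ?n]) [0..<Suc ?m]"
    by (rule C.lsum_swap) simp
  also have "\<dots> = lsum C (\<lambda>i. G i ?m) [0..<Suc ?n] \<oplus>\<^bsub>C\<^esub> lsum C (\<lambda>j. lsum C (\<lambda>i. G i j) [0..<Suc ?n]) [0..<?m]"
    (is "_ = _ \<oplus>\<^bsub>C\<^esub> ?R")
    unfolding upt_Suc_append[OF zero_le, of ?m] by (subst C.lsum_append) (simp_all add: C.a_comm del: upt_Suc)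
  also have "lsum C (\<lambda>i. G i ?m) [0..<Suc ?n] = eps2 K V (shuffle_words K V f g) (pure K V h)"
  proof -
    \<comment> \<open>A cut of \<open>g\<close> at its end leaves an empty suffix, which pairs to
      zero with every nonempty suffix of \<open>f\<close>.\<close>
    have "lsum C (\<lambda>i. G i ?m) [0..<?n] = \<zero>\<^bsub>C\<^esub>"
      by (rule C.lsum_zero) (simp add: G_def pairing_simps)
    moreover have "G ?n ?m = eps2 K V (shuffle_words K V f g) (pure K V h)"
      using pairing_shuffle_eq_eps2[OF W] pairing_shuffle_closed[of f g h] ne by (simp add: G_def pairing_simps del: pairing_shuffle_closed)
    moreover have "eps2 K V (shuffle_words K V f g) (pure K V h) \<in> carrier C"
      using calculation(2) \<open>G ?n ?m \<in> carrier C\<close> by simp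
    ultimately show ?thesis
      unfolding upt_Suc_append[OF zero_le] by (subst C.lsum_append) simp_all
  qed
  also have "lsum C (\<lambda>j. lsum C (\<lambda>i. G i j) [0..<Suc ?n]) [0..<?m]
      = lsum C (\<lambda>j. lsum C (\<lambda>i. eps2 K V (pure K V (drop i f)) (pure K V (drop j g)) \<otimes>\<^bsub>C\<^esub>
          eps2 K V (shuffle_words K V (take i f) (take j g)) (pure K V h)) [1 - j..<?n]) [0..<?m]"
  proof (rule lsum_cong)
    fix j assume "j \<in> set [0..<?m]"
    then have j: "j < ?m" by simp
    have "lsum C (\<lambda>i. G i j) [0..<Suc ?n] = lsum C (\<lambda>i. G i j) [0..<?n]"
    proof -
      have "G ?n j = \<zero>\<^bsub>C\<^esub>" using j by (simp add: G_def pairing_simps)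
      then show ?thesis unfolding upt_Suc_append[OF zero_le] by (subst C.lsum_append) simp_all
    qed
    also have "\<dots> = lsum C (\<lambda>i. G i j) [1 - j..<?n]"
    proof (cases "j = 0")
      case True
      \<comment> \<open>Here both prefixes are empty and \<open>pairing [] h\<close> vanishes. This
        is why the index starts at \<open>1 - j\<close>.\<close>
      have "G 0 0 = \<zero>\<^bsub>C\<^esub>" using ne by (simp add: G_def pairing_shuffle_Nil pairing_simps)
      moreover have "[0..<?n] = 0 # [1..<?n]" using ne by (simp add: upt_conv_Cons)
      ultimately show ?thesis using True by simp
    qed simp
    also have "\<dots> = lsum C (\<lambda>i. eps2 K V (pure K V (drop i f)) (pure K V (drop j g)) \<otimes>\<^bsub>C\<^esub>
          eps2 K V (shuffle_words K V (take i f) (take j g)) (pure K V h)) [1 - j..<?n]"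
    proof (rule lsum_cong)
      fix i assume "i \<in> set [1 - j..<?n]"
      then have i: "1 - j \<le> i" "i < ?n" by auto
      have "pairing (drop i f) (drop j g) = eps2 K V (pure K V (drop i f)) (pure K V (drop j g))"
        by (intro pairing_simps(4) td_W W) (use i j in auto)
      moreover have "pairing_shuffle (take i f) (take j g) h = eps2 K V (shuffle_words K V (take i f) (take j g)) (pure K V h)"
        by (intro pairing_shuffle_eq_eps2 td_W W) (use i j ne in auto)
      ultimately show "G i j = eps2 K V (pure K V (drop i f)) (pure K V (drop j g)) \<otimes>\<^bsub>C\<^esub>
          eps2 K V (shuffle_words K V (take i f) (take j g)) (pure K V h)"
        by (simp add: G_def)
    qed
    finally show "lsum C (\<lambda>i. G i j) [0..<Suc ?n] = \<dots>" .
  qed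
  finally show ?thesis .
qed

lemma shuffle_words_commute:
  assumes "u \<in> W" "v \<in> W"
  shows "shuffle_words K V u v = shuffle_words K V v u"
  unfolding shuffle_words_eq[OF assms] shuffle_words_eq[OF assms(2,1)]
  by (rule T.lsum_shuffle_commute[OF pure_closed' assms])

text \<open>The relations of \<open>J2\<close> concern nonempty words only. If one of the words is
  empty, a single cut survives, and the cocycle identity reduces to the symmetry of
  \<open>pairing\<close>.\<close>

lemma cocycle_sum_Nil:
  "cocycle_sum [] g h = pairing g h" "cocycle_sum f [] h = pairing f h" "cocycle_sum f g [] = pairing f g"
proof -
  have "cocycle_sum [] g h = lsum C (\<lambda>q. pairing [] (snd q) \<otimes>\<^bsub>C\<^esub> pairing (fst q) h) (splits g)"
    by (simp add: cocycle_sum_def pairing_shuffle_Nil)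
  also have "\<dots> = pairing [] [] \<otimes>\<^bsub>C\<^esub> pairing g h"
    by (subst C.lsum_splits_last) (simp_all add: pairing_simps)
  finally show "cocycle_sum [] g h = pairing g h" by (simp add: pairing_simps)
  have "cocycle_sum f [] h = lsum C (\<lambda>p. pairing (snd p) [] \<otimes>\<^bsub>C\<^esub> pairing (fst p) h) (splits f)"
    by (simp add: cocycle_sum_def pairing_shuffle_Nil)
  also have "\<dots> = pairing [] [] \<otimes>\<^bsub>C\<^esub> pairing f h"
    by (subst C.lsum_splits_last) (simp_all add: pairing_simps)
  finally show "cocycle_sum f [] h = pairing f h" by (simp add: pairing_simps)
  have "cocycle_sum f g [] = lsum C (\<lambda>p. pairing (snd p) g \<otimes>\<^bsub>C\<^esub> pairing_shuffle (fst p) [] []) (splits f)"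
    unfolding cocycle_sum_def
    by (rule lsum_cong, subst C.lsum_splits_first) (simp_all add: pairing_shuffle_empty_right)
  also have "\<dots> = pairing f g \<otimes>\<^bsub>C\<^esub> pairing_shuffle [] [] []"
    by (subst C.lsum_splits_first) (simp_all add: pairing_shuffle_empty_right)
  finally show "cocycle_sum f g [] = pairing f g" by (simp add: pairing_shuffle_empty_right)
qed

text \<open>The relations of \<open>J2\<close> say that \<open>pairing\<close> is a two-cocycle for the bialgebra of words. As the
  pairing is symmetric, the other side of the cocycle identity is \<open>cocycle_sum h g f\<close>.\<close>

lemma cocycle_sum_symmetric:
  assumes W: "f \<in> W" "g \<in> W" "h \<in> W"
  shows "cocycle_sum f g h = cocycle_sum h g f"
proof (cases "f = [] \<or> g = [] \<or> h = []")
  case True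
  then show ?thesis using pairing_commute by (auto simp: cocycle_sum_Nil)
next
  case False
  then have ne: "f \<noteq> []" "g \<noteq> []" "h \<noteq> []" by auto
  note TPc = pure_TP shuffle_words_TP
  have *: "eps2 K V (pure K V f) (shuffle_words K V g h) = eps2 K V (shuffle_words K V h g) (pure K V f)"
    using W ne by (subst eps2_commute) (auto intro!: TPc simp: shuffle_words_commute simp del: in_lists_conv_set)
  \<comment> \<open>By symmetry of \<open>eps2\<close> and of shuffles, the sum over cuts of
    \<open>g\<close> and \<open>h\<close> becomes the double sum in
    \<open>cocycle_sum_nonempty\<close> for the triple \<open>h\<close>, \<open>g\<close>,
    \<open>f\<close>.\<close>
  have "lsum C (\<lambda>j. lsum C (\<lambda>k. eps2 K V (pure K V f) (shuffle_words K V (take j g) (take k h)) \<otimes>\<^bsub>C\<^esub>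
          eps2 K V (pure K V (drop j g)) (pure K V (drop k h))) [1 - j..<length h]) [0..<length g]
    = lsum C (\<lambda>j. lsum C (\<lambda>k. eps2 K V (pure K V (drop k h)) (pure K V (drop j g)) \<otimes>\<^bsub>C\<^esub>
          eps2 K V (shuffle_words K V (take k h) (take j g)) (pure K V f)) [1 - j..<length h]) [0..<length g]"
  proof (intro lsum_cong)
    fix j k assume "j \<in> set [0..<length g]" "k \<in> set [1 - j..<length h]"
    then have jk: "j < length g" "1 - j \<le> k" "k < length h" by auto
    have 1: "pure K V (drop j g) \<in> carrier TP" "pure K V (drop k h) \<in> carrier TP"
      using jk by (auto intro!: TPc td_W W simp del: in_lists_conv_set)
    have 2: "shuffle_words K V (take j g) (take k h) \<in> carrier TP"
      using jk ne by (intro TPc td_W W) auto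
    have 3: "shuffle_words K V (take j g) (take k h) = shuffle_words K V (take k h) (take j g)"
      by (intro shuffle_words_commute td_W W)
    have 4: "pure K V f \<in> carrier TP" by (intro TPc W ne)
    have 5: "shuffle_words K V (take k h) (take j g) \<in> carrier TP" using 2 3 by simp
    note cl = bilinear_map_closed[OF eps2_bilinear]
    show "eps2 K V (pure K V f) (shuffle_words K V (take j g) (take k h)) \<otimes>\<^bsub>C\<^esub>
          eps2 K V (pure K V (drop j g)) (pure K V (drop k h)) =
        eps2 K V (pure K V (drop k h)) (pure K V (drop j g)) \<otimes>\<^bsub>C\<^esub>
          eps2 K V (shuffle_words K V (take k h) (take j g)) (pure K V f)"
      unfolding 3 eps2_commute[OF 4 5] eps2_commute[OF 1]
      by (rule C.m_comm) (rule cl[OF 5 4] cl[OF 1(2,1)])+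
  qed
  then show ?thesis
    unfolding cocycle_sum_nonempty[OF W ne] cocycle_sum_nonempty[OF W(3,2,1) ne(3,2,1)] eps2_relation[OF W ne] *
    by (rule arg_cong)
qed

end

section \<open>The algebra \<open>C2 \<otimes> T\<close>\<close>

lemma bilinear_map_add:
  assumes "module K P" "bilinear_map K M N P f" "bilinear_map K M N P g"
  shows "bilinear_map K M N P (\<lambda>x y. f x y \<oplus>\<^bsub>P\<^esub> g x y)"
  unfolding bilinear_map_def
  by (intro conjI ballI linear_map_add[OF assms(1)] bilinear_mapD[OF assms(2)] bilinear_mapD[OF assms(3)])

lemma bilinear_map_smult:
  assumes "module K P" "bilinear_map K M N P f" "c \<in> carrier K"
  shows "bilinear_map K M N P (\<lambda>x y. c \<odot>\<^bsub>P\<^esub> f x y)"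
  unfolding bilinear_map_def
  by (intro conjI ballI linear_map_smult[OF assms(1) _ assms(3)] bilinear_mapD[OF assms(2)])

context shuffle_context
begin

abbreviation "Z \<equiv> tensor K C T"
abbreviation "te \<equiv> tensor_elt K C T"

lemma Z_module: "module K Z"
  by (rule module_tensor[OF C.module T_module])

sublocale Z: module K Z by (rule Z_module)

lemma te_bilinear: "bilinear_map K C T Z te"
  by (rule bilinear_tensor_elt[OF C.module T_module])

lemmas te_linear1 = bilinear_mapD(2)[OF te_bilinear]
lemmas te_linear2 = bilinear_mapD(1)[OF te_bilinear]

lemma te_closed [simp]: "\<lbrakk>c \<in> carrier C; t \<in> carrier T\<rbrakk> \<Longrightarrow> te c t \<in> carrier Z"
  by (rule bilinear_map_closed[OF te_bilinear])

lemma te_zero: "t \<in> carrier T \<Longrightarrow> te \<zero>\<^bsub>C\<^esub> t = \<zero>\<^bsub>Z\<^esub>"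
  by (rule linear_map_zero[OF C.module Z_module te_linear1])

lemma C_mult_linear: "d \<in> carrier C \<Longrightarrow> linear_map K C C (\<lambda>c. c \<otimes>\<^bsub>C\<^esub> d)" "d \<in> carrier C \<Longrightarrow> linear_map K C C (\<lambda>c. d \<otimes>\<^bsub>C\<^esub> c)"
  using bilinear_mapD[OF bilinear_mult[OF C_algebra]] by auto

text \<open>Total version of \<open>shuffle_words\<close>, in the same sense as
  \<open>pure0\<close>.\<close>

definition shuffle0 :: "'v list \<Rightarrow> 'v list \<Rightarrow> ('v list \<Rightarrow> 'a) set" where
  "shuffle0 u v = lsum T pure0 (shuffle_list u v)"

lemma shuffle0_closed [simp]: "shuffle0 u v \<in> carrier T"
  by (simp add: shuffle0_def)

lemma shuffle0_eq:
  assumes "u \<in> W" "v \<in> W"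
  shows "shuffle0 u v = shuffle_words K V u v"
  unfolding shuffle0_def shuffle_words_eq[OF assms]
proof (rule lsum_cong)
  fix x assume "x \<in> set (shuffle_list u v)"
  then have "x \<in> W" by (rule lists_shuffle_list[OF _ assms])
  then show "pure0 x = pure K V x" by (simp only: pure0_def if_True)
qed

definition pure_product :: "('a, 'v) sym2 set \<Rightarrow> ('a, 'v) sym2 set \<Rightarrow> 'v list \<Rightarrow> 'v list \<Rightarrow> ('a, 'v) c2t" where
  "pure_product c d f g = lsum Z (\<lambda>p. lsum Z (\<lambda>q. te (c \<otimes>\<^bsub>C\<^esub> d \<otimes>\<^bsub>C\<^esub> pairing (snd p) (snd q)) (shuffle0 (fst p) (fst q)))
     (splits g)) (splits f)"

lemma pure_product_closed [simp]: "\<lbrakk>c \<in> carrier C; d \<in> carrier C\<rbrakk> \<Longrightarrow> pure_product c d f g \<in> carrier Z"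
  by (simp add: pure_product_def)

text \<open>The separate first term of the definition is the summand in which both suffixes are
  empty. The summands with exactly one empty suffix are the only other new ones in
  \<open>pure_product\<close>, and \<open>pairing\<close> makes them vanish.\<close>

lemma C2T_pure_mult_eq:
  assumes cd: "c \<in> carrier C" "d \<in> carrier C" and W: "f \<in> W" "g \<in> W"
  shows "C2T_pure_mult K V c d f g = pure_product c d f g"
proof -
  let ?n = "length f" and ?m = "length g"
  define H where "H i j = te (c \<otimes>\<^bsub>C\<^esub> d \<otimes>\<^bsub>C\<^esub> pairing (drop i f) (drop j g)) (shuffle0 (take i f) (take j g))" for i j
  have [simp]: "H i j \<in> carrier Z" for i j using cd by (simp add: H_def)
  have H1: "H i ?m = \<zero>\<^bsub>Z\<^esub>" if "i < ?n" for i using that cd by (simp add: H_def pairing_simps te_zero)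
  have H2: "H ?n j = \<zero>\<^bsub>Z\<^esub>" if "j < ?m" for j using that cd by (simp add: H_def pairing_simps te_zero)
  have H3: "H ?n ?m = te (c \<otimes>\<^bsub>C\<^esub> d) (shuffle_words K V f g)"
    using cd W by (simp add: H_def pairing_simps shuffle0_eq del: in_lists_conv_set)
  have H4: "te (c \<otimes>\<^bsub>C\<^esub> d \<otimes>\<^bsub>C\<^esub> eps2 K V (pure K V (drop i f)) (pure K V (drop j g)))
         (shuffle_words K V (take i f) (take j g)) = H i j" if "i < ?n" "j < ?m" for i j
  proof -
    have "pairing (drop i f) (drop j g) = eps2 K V (pure K V (drop i f)) (pure K V (drop j g))"
      using that by (intro pairing_simps(4) td_W W) auto
    moreover have "shuffle0 (take i f) (take j g) = shuffle_words K V (take i f) (take j g)"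
      by (intro shuffle0_eq td_W W)
    ultimately show ?thesis by (simp add: H_def)
  qed
  have in1: "(\<Oplus>\<^bsub>Z\<^esub>j\<in>{0..<?m}. te (c \<otimes>\<^bsub>C\<^esub> d \<otimes>\<^bsub>C\<^esub> eps2 K V (pure K V (drop i f)) (pure K V (drop j g)))
         (shuffle_words K V (take i f) (take j g))) = lsum Z (H i) [0..<?m]" if "i < ?n" for i
  proof -
    have "(\<Oplus>\<^bsub>Z\<^esub>j\<in>{0..<?m}. te (c \<otimes>\<^bsub>C\<^esub> d \<otimes>\<^bsub>C\<^esub> eps2 K V (pure K V (drop i f)) (pure K V (drop j g)))
         (shuffle_words K V (take i f) (take j g))) = (\<Oplus>\<^bsub>Z\<^esub>j\<in>{0..<?m}. H i j)"
      by (rule Z.finsum_cong') (use that H4 in auto)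
    then show ?thesis by (simp only: Z.finsum_eq_lsum \<open>\<And>i j. H i j \<in> carrier Z\<close>)
  qed
  have "(\<Oplus>\<^bsub>Z\<^esub>i\<in>{0..<?n}. \<Oplus>\<^bsub>Z\<^esub>j\<in>{0..<?m}. te (c \<otimes>\<^bsub>C\<^esub> d \<otimes>\<^bsub>C\<^esub> eps2 K V (pure K V (drop i f)) (pure K V (drop j g)))
         (shuffle_words K V (take i f) (take j g))) = (\<Oplus>\<^bsub>Z\<^esub>i\<in>{0..<?n}. lsum Z (H i) [0..<?m])"
    by (rule Z.finsum_cong') (use in1 in auto)
  also have "\<dots> = lsum Z (\<lambda>i. lsum Z (H i) [0..<?m]) [0..<?n]"
    by (rule Z.finsum_eq_lsum) simp
  finally have 1: "C2T_pure_mult K V c d f g = H ?n ?m \<oplus>\<^bsub>Z\<^esub> lsum Z (\<lambda>i. lsum Z (H i) [0..<?m]) [0..<?n]"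
    unfolding C2T_pure_mult_def Let_def H3 by simp
  have "pure_product c d f g = lsum Z (\<lambda>i. lsum Z (\<lambda>j. H i j) [0..<Suc ?m]) [0..<Suc ?n]"
    unfolding pure_product_def splits_eq lsum_map fst_conv snd_conv H_def by simp
  also have "\<dots> = lsum Z (\<lambda>i. lsum Z (H i) [0..<Suc ?m]) [0..<?n] \<oplus>\<^bsub>Z\<^esub> lsum Z (H ?n) [0..<Suc ?m]"
    unfolding upt_Suc_append[OF zero_le, of ?n] by (subst Z.lsum_append) simp_all
  also have "lsum Z (H ?n) [0..<Suc ?m] = H ?n ?m"
  proof -
    have "lsum Z (H ?n) [0..<?m] = \<zero>\<^bsub>Z\<^esub>" by (rule Z.lsum_zero) (simp add: H2)
    then show ?thesis unfolding upt_Suc_append[OF zero_le] by (subst Z.lsum_append) simp_all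
  qed
  also have "lsum Z (\<lambda>i. lsum Z (H i) [0..<Suc ?m]) [0..<?n] = lsum Z (\<lambda>i. lsum Z (H i) [0..<?m]) [0..<?n]"
    unfolding upt_Suc_append[OF zero_le]
    by (rule lsum_cong, subst Z.lsum_append) (simp_all add: H1)
  finally show ?thesis using 1 by (simp add: Z.a_comm)
qed

lemma shuffle0_commute: "\<lbrakk>u \<in> W; v \<in> W\<rbrakk> \<Longrightarrow> shuffle0 u v = shuffle0 v u"
  by (simp add: shuffle0_eq shuffle_words_commute del: in_lists_conv_set)

lemma pure_product_commute:
  assumes "c \<in> carrier C" "d \<in> carrier C" "f \<in> W" "g \<in> W"
  shows "pure_product c d f g = pure_product d c g f"
proof -
  have "pure_product c d f g = lsum Z (\<lambda>q. lsum Z (\<lambda>p. te (c \<otimes>\<^bsub>C\<^esub> d \<otimes>\<^bsub>C\<^esub> pairing (snd p) (snd q)) (shuffle0 (fst p) (fst q)))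
     (splits f)) (splits g)"
    unfolding pure_product_def by (rule Z.lsum_swap) (use assms in simp)
  also have "\<dots> = pure_product d c g f"
    unfolding pure_product_def
  proof (intro lsum_cong)
    fix q p assume q: "q \<in> set (splits g)" and p: "p \<in> set (splits f)"
    have "shuffle0 (fst p) (fst q) = shuffle0 (fst q) (fst p)"
      by (rule shuffle0_commute[OF lists_splits(1)[OF p assms(3)] lists_splits(1)[OF q assms(4)]])
    then show "te (c \<otimes>\<^bsub>C\<^esub> d \<otimes>\<^bsub>C\<^esub> pairing (snd p) (snd q)) (shuffle0 (fst p) (fst q)) =
        te (d \<otimes>\<^bsub>C\<^esub> c \<otimes>\<^bsub>C\<^esub> pairing (snd q) (snd p)) (shuffle0 (fst q) (fst p))"
      using assms(1,2) by (simp add: C.m_comm pairing_commute[of "snd p"])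
  qed
  finally show ?thesis .
qed

section \<open>Multilinearity of the product of pure tensors\<close>

lemma pairing_multilinear:
  assumes "v \<in> W"
  shows "word_multilinear K V C (\<lambda>u. pairing u v)"
proof (cases "v = []")
  \<comment> \<open>A word that contains a varying letter is nonempty, so its pairing with the empty
    word is zero.\<close>
  case True
  show ?thesis
  proof (rule word_multilinearI)
    show "pairing w v \<in> carrier C" for w by simp
  qed (simp_all add: True pairing_simps)
next
  case False
  show ?thesis
    unfolding word_multilinear_def
  proof (intro conjI ballI)
    show "pairing w v \<in> carrier C" for w by simp
    fix u w assume uw: "u \<in> W" "w \<in> W"
    have "linear_map K V T (\<lambda>x. pure K V (u @ x # w))"
      by (rule word_multilinearD(2)[OF pure_multilinear[OF V_module] uw])
    then have "linear_map K V TP (\<lambda>x. pure K V (u @ x # w))"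
      using pure_TP[of "u @ _ # w"] uw by (auto simp: linear_map_def)
    from linear_map_compose[OF this bilinear_mapD(2)[OF eps2_bilinear pure_TP[OF assms False]]]
    show "linear_map K V C (\<lambda>x. pairing (u @ x # w) v)"
    proof (rule linear_map_cong[OF V_module, rotated])
      show "eps2 K V (pure K V (u @ x # w)) (pure K V v) = pairing (u @ x # w) v" if "x \<in> carrier V" for x
        by (rule pairing_simps(4)[symmetric]) (use that uw assms False in auto)
    qed
  qed
qed

lemma shuffle0_multilinear:
  assumes "v \<in> W"
  shows "word_multilinear K V T (\<lambda>u. shuffle0 u v)"
  by (rule word_multilinear_cong[OF shuffle_words_multilinear(1)[OF assms] V_module])
    (rule shuffle0_eq[symmetric, OF _ assms])

text \<open>At each cut of the first word, the prefix enters through a shuffle and the suffix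
  through \<open>pairing\<close>, which is the situation of \<open>word_multilinear_splits\<close>.
  Commutativity gives the second word.\<close>

lemma pure_product_multilinear:
  assumes "c \<in> carrier C" "d \<in> carrier C" "w \<in> W"
  shows "word_multilinear K V Z (\<lambda>f. pure_product c d f w)" "word_multilinear K V Z (pure_product c d w)"
proof -
  have *: "word_multilinear K V Z (\<lambda>f. pure_product c d f w)" if cd: "c \<in> carrier C" "d \<in> carrier C" for c d
    unfolding pure_product_def
  proof (rule word_multilinear_splits[OF V_module Z_module, where \<Phi> =
      "\<lambda>u v. lsum Z (\<lambda>q. te (c \<otimes>\<^bsub>C\<^esub> d \<otimes>\<^bsub>C\<^esub> pairing v (snd q)) (shuffle0 u (fst q))) (splits w)"])
    fix v assume "v \<in> W"
    show "word_multilinear K V Z (\<lambda>u. lsum Z (\<lambda>q. te (c \<otimes>\<^bsub>C\<^esub> d \<otimes>\<^bsub>C\<^esub> pairing v (snd q)) (shuffle0 u (fst q))) (splits w))"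
    proof (rule word_multilinear_lsum[OF Z_module])
      fix q assume q: "q \<in> set (splits w)"
      show "word_multilinear K V Z (\<lambda>u. te (c \<otimes>\<^bsub>C\<^esub> d \<otimes>\<^bsub>C\<^esub> pairing v (snd q)) (shuffle0 u (fst q)))"
        by (rule word_multilinear_linear[OF shuffle0_multilinear te_linear2])
          (use cd lists_splits[OF q assms(3)] in auto)
    qed
  next
    fix u assume "u \<in> W"
    show "word_multilinear K V Z (\<lambda>v. lsum Z (\<lambda>q. te (c \<otimes>\<^bsub>C\<^esub> d \<otimes>\<^bsub>C\<^esub> pairing v (snd q)) (shuffle0 u (fst q))) (splits w))"
    proof (rule word_multilinear_lsum[OF Z_module])
      fix q assume q: "q \<in> set (splits w)"
      have "linear_map K C Z (\<lambda>x. te (c \<otimes>\<^bsub>C\<^esub> d \<otimes>\<^bsub>C\<^esub> x) (shuffle0 u (fst q)))"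
        by (rule linear_map_compose[OF C_mult_linear(2) te_linear1]) (use cd in auto)
      from word_multilinear_linear[OF pairing_multilinear this]
      show "word_multilinear K V Z (\<lambda>v. te (c \<otimes>\<^bsub>C\<^esub> d \<otimes>\<^bsub>C\<^esub> pairing v (snd q)) (shuffle0 u (fst q)))"
        using lists_splits(2)[OF q assms(3)] .
    qed
  qed
  show "word_multilinear K V Z (\<lambda>f. pure_product c d f w)" by (rule *[OF assms(1,2)])
  show "word_multilinear K V Z (pure_product c d w)"
    by (rule word_multilinear_cong[OF *[OF assms(2,1)] V_module])
      (rule pure_product_commute[OF assms(2,1) _ assms(3)])
qed

lemma pure_product_linear:
  assumes "d \<in> carrier C"
  shows "linear_map K C Z (\<lambda>c. pure_product c d f g)" "linear_map K C Z (\<lambda>c. pure_product d c f g)"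
proof -
  have 1: "linear_map K C Z (\<lambda>c. te (c \<otimes>\<^bsub>C\<^esub> d \<otimes>\<^bsub>C\<^esub> e) t)" "linear_map K C Z (\<lambda>c. te (d \<otimes>\<^bsub>C\<^esub> c \<otimes>\<^bsub>C\<^esub> e) t)"
    if "e \<in> carrier C" "t \<in> carrier T" for e t
    using linear_map_compose[OF linear_map_compose[OF C_mult_linear(1)[OF assms] C_mult_linear(1)[OF that(1)]] te_linear1[OF that(2)]]
      linear_map_compose[OF linear_map_compose[OF C_mult_linear(2)[OF assms] C_mult_linear(1)[OF that(1)]] te_linear1[OF that(2)]] .
  show "linear_map K C Z (\<lambda>c. pure_product c d f g)" "linear_map K C Z (\<lambda>c. pure_product d c f g)"
    unfolding pure_product_def by (intro linear_map_lsum_param[OF Z_module] 1; simp)+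
qed

text \<open>The two inner lifts in the product of \<open>C2T\<close>: for arbitrary tensors
  \<open>s\<close> and \<open>t\<close> this is the product of \<open>c \<otimes> s\<close> and
  \<open>d \<otimes> t\<close>.\<close>

definition \<Phi> where
  "\<Phi> c s d t = pres_lift K Z (\<lambda>f. pres_lift K Z (\<lambda>g. C2T_pure_mult K V c d f g) t) s"

lemma \<Phi>_bilinear:
  assumes cd: "c \<in> carrier C" "d \<in> carrier C"
  shows "bilinear_map K T T Z (\<lambda>s t. \<Phi> c s d t)"
    and "\<lbrakk>f \<in> W; g \<in> W\<rbrakk> \<Longrightarrow> \<Phi> c (pure K V f) d (pure K V g) = pure_product c d f g"
proof -
  have m: "word_multilinear K V Z (\<lambda>f. C2T_pure_mult K V c d f w)"
    "word_multilinear K V Z (C2T_pure_mult K V c d w)" if w: "w \<in> W" for w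
    by (rule word_multilinear_cong[OF pure_product_multilinear(1)[OF cd w] V_module], rule C2T_pure_mult_eq[OF cd _ w, symmetric], assumption)
      (rule word_multilinear_cong[OF pure_product_multilinear(2)[OF cd w] V_module], rule C2T_pure_mult_eq[OF cd w, symmetric], assumption)
  show "bilinear_map K T T Z (\<lambda>s t. \<Phi> c s d t)"
    unfolding \<Phi>_def by (rule tensors_bilinear_lift(1)[OF V_module Z_module m])
  show "\<Phi> c (pure K V f) d (pure K V g) = pure_product c d f g" if "f \<in> W" "g \<in> W"
    unfolding \<Phi>_def
    by (rule trans[OF tensors_bilinear_lift(2)[OF V_module Z_module m that] C2T_pure_mult_eq[OF cd that]])
qed

lemma T_bilinear_eq:
  assumes "bilinear_map K T T Z b" "bilinear_map K T T Z b'"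
    and "\<And>f g. \<lbrakk>f \<in> W; g \<in> W\<rbrakk> \<Longrightarrow> b (pure K V f) (pure K V g) = b' (pure K V f) (pure K V g)"
    and "s \<in> carrier T" "t \<in> carrier T"
  shows "b s t = b' s t"
proof -
  have sub: "pure K V ` W \<subseteq> carrier T" by (rule image_subsetI) (rule pure_closed')
  show ?thesis
    by (rule bilinear_map_eq_on_mspan[OF T_module T_module Z_module sub sub assms(1,2)])
      (use assms(3-5) mspan_pure[OF V_module] in auto)
qed

text \<open>Both sides of each equation are bilinear in \<open>s\<close> and \<open>t\<close>, so it
  can be tested on pure tensors, where \<Phi> is \<open>pure_product\<close>.\<close>

lemma \<Phi>_linear:
  assumes "d \<in> carrier C" "s \<in> carrier T" "t \<in> carrier T"
  shows "linear_map K C Z (\<lambda>c. \<Phi> c s d t)" "linear_map K C Z (\<lambda>c. \<Phi> d s c t)"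
proof -
  show "linear_map K C Z (\<lambda>c. \<Phi> c s d t)"
  proof (rule linear_mapI)
    show "\<Phi> c s d t \<in> carrier Z" if "c \<in> carrier C" for c
      by (rule bilinear_map_closed[OF \<Phi>_bilinear(1)[OF that assms(1)] assms(2,3)])
    show "\<Phi> (c \<oplus>\<^bsub>C\<^esub> c') s d t = \<Phi> c s d t \<oplus>\<^bsub>Z\<^esub> \<Phi> c' s d t" if "c \<in> carrier C" "c' \<in> carrier C" for c c'
      by (rule T_bilinear_eq[where b = "\<lambda>s t. \<Phi> (c \<oplus>\<^bsub>C\<^esub> c') s d t" and b' = "\<lambda>s t. \<Phi> c s d t \<oplus>\<^bsub>Z\<^esub> \<Phi> c' s d t"])
        (use that assms in \<open>auto intro!: bilinear_map_add[OF Z_module] \<Phi>_bilinear(1)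
          simp: \<Phi>_bilinear(2) linear_mapD(2)[OF pure_product_linear(1)] simp del: in_lists_conv_set\<close>)
    show "\<Phi> (a \<odot>\<^bsub>C\<^esub> c) s d t = a \<odot>\<^bsub>Z\<^esub> \<Phi> c s d t" if "a \<in> carrier K" "c \<in> carrier C" for a c
      by (rule T_bilinear_eq[where b = "\<lambda>s t. \<Phi> (a \<odot>\<^bsub>C\<^esub> c) s d t" and b' = "\<lambda>s t. a \<odot>\<^bsub>Z\<^esub> \<Phi> c s d t"])
        (use that assms in \<open>auto intro!: bilinear_map_smult[OF Z_module] \<Phi>_bilinear(1)
          simp: \<Phi>_bilinear(2) linear_mapD(3)[OF pure_product_linear(1)] simp del: in_lists_conv_set\<close>)
  qed
  show "linear_map K C Z (\<lambda>c. \<Phi> d s c t)"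
  proof (rule linear_mapI)
    show "\<Phi> d s c t \<in> carrier Z" if "c \<in> carrier C" for c
      by (rule bilinear_map_closed[OF \<Phi>_bilinear(1)[OF assms(1) that] assms(2,3)])
    show "\<Phi> d s (c \<oplus>\<^bsub>C\<^esub> c') t = \<Phi> d s c t \<oplus>\<^bsub>Z\<^esub> \<Phi> d s c' t" if "c \<in> carrier C" "c' \<in> carrier C" for c c'
      by (rule T_bilinear_eq[where b = "\<lambda>s t. \<Phi> d s (c \<oplus>\<^bsub>C\<^esub> c') t" and b' = "\<lambda>s t. \<Phi> d s c t \<oplus>\<^bsub>Z\<^esub> \<Phi> d s c' t"])
        (use that assms in \<open>auto intro!: bilinear_map_add[OF Z_module] \<Phi>_bilinear(1)
          simp: \<Phi>_bilinear(2) linear_mapD(2)[OF pure_product_linear(2)] simp del: in_lists_conv_set\<close>)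
    show "\<Phi> d s (a \<odot>\<^bsub>C\<^esub> c) t = a \<odot>\<^bsub>Z\<^esub> \<Phi> d s c t" if "a \<in> carrier K" "c \<in> carrier C" for a c
      by (rule T_bilinear_eq[where b = "\<lambda>s t. \<Phi> d s (a \<odot>\<^bsub>C\<^esub> c) t" and b' = "\<lambda>s t. a \<odot>\<^bsub>Z\<^esub> \<Phi> d s c t"])
        (use that assms in \<open>auto intro!: bilinear_map_smult[OF Z_module] \<Phi>_bilinear(1)
          simp: \<Phi>_bilinear(2) linear_mapD(3)[OF pure_product_linear(2)] simp del: in_lists_conv_set\<close>)
  qed
qed

section \<open>The product as a bilinear operation\<close>

abbreviation "CT \<equiv> C2T K V"

lemma CT_simps [simp]:
  "carrier CT = carrier Z" "zero CT = zero Z" "add CT = add Z" "smult CT = smult Z"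
  "one CT = te \<one>\<^bsub>C\<^esub> (pure K V [])"
  by (simp_all add: C2T_def Let_def)

lemma CT_bilinear: "bilinear_map K Z Z Z (mult CT)"
  and CT_mult: "\<lbrakk>c \<in> carrier C; s \<in> carrier T; d \<in> carrier C; t \<in> carrier T\<rbrakk> \<Longrightarrow>
    te c s \<otimes>\<^bsub>CT\<^esub> te d t = \<Phi> c s d t"
proof -
  have cl: "\<Phi> c s d t \<in> carrier Z" if "c \<in> carrier C" "s \<in> carrier T" "d \<in> carrier C" "t \<in> carrier T" for c s d t
    using bilinear_map_closed[OF \<Phi>_bilinear(1)] that by auto
  have b: "bilinear_map K C T Z (\<lambda>c s. \<Phi> c s d t)" "bilinear_map K C T Z (\<Phi> d t)"
    if "d \<in> carrier C" "t \<in> carrier T" for d t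
    unfolding bilinear_map_def using that
    by (auto intro: bilinear_mapD[OF \<Phi>_bilinear(1)] \<Phi>_linear)
  note lift = tensor_bilinear_lift[OF C.module T_module C.module T_module Z_module]
  show "bilinear_map K Z Z Z (mult CT)"
    using lift(1)[OF cl b] by (simp add: C2T_def Let_def \<Phi>_def)
  show "te c s \<otimes>\<^bsub>CT\<^esub> te d t = \<Phi> c s d t" if "c \<in> carrier C" "s \<in> carrier T" "d \<in> carrier C" "t \<in> carrier T"
    using lift(2)[OF cl b that] by (simp add: C2T_def Let_def \<Phi>_def)
qed

lemma CT_mult_pure:
  "\<lbrakk>c \<in> carrier C; f \<in> W; d \<in> carrier C; g \<in> W\<rbrakk> \<Longrightarrow>
    te c (pure K V f) \<otimes>\<^bsub>CT\<^esub> te d (pure K V g) = pure_product c d f g"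
  by (simp add: CT_mult \<Phi>_bilinear(2) pure_closed' del: in_lists_conv_set)

lemma Nil_W: "[] \<in> W" by simp

text \<open>The empty word pairs to zero with nonempty suffixes, so no correction terms occur.
  Elements of \<open>C2 \<otimes> 1\<close> therefore act as scalars from C2, which is what makes
  them usable as coefficients.\<close>

lemma CT_mult_Nil:
  assumes "c \<in> carrier C" "d \<in> carrier C" "t \<in> carrier T"
  shows "te c (pure K V []) \<otimes>\<^bsub>CT\<^esub> te d t = te (c \<otimes>\<^bsub>C\<^esub> d) t"
  unfolding CT_mult[OF assms(1) pure_closed'[OF Nil_W] assms(2,3)]
proof (rule tensors_linear_eq[OF V_module Z_module _ te_linear2 _ assms(3)])
  show "linear_map K T Z (\<Phi> c (pure K V []) d)"
    by (rule bilinear_mapD(1)[OF \<Phi>_bilinear(1)[OF assms(1,2)] pure_closed'[OF Nil_W]])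
  show "c \<otimes>\<^bsub>C\<^esub> d \<in> carrier C" using assms by simp
  fix g assume g: "g \<in> W"
  have "pure_product c d [] g = lsum Z (\<lambda>q. te (c \<otimes>\<^bsub>C\<^esub> d \<otimes>\<^bsub>C\<^esub> pairing [] (snd q)) (shuffle0 [] (fst q))) (splits g)"
    using assms by (simp add: pure_product_def)
  also have "\<dots> = te (c \<otimes>\<^bsub>C\<^esub> d \<otimes>\<^bsub>C\<^esub> pairing [] []) (shuffle0 [] g)"
    using assms by (subst Z.lsum_splits_last) (auto simp: pairing_simps te_zero)
  also have "\<dots> = te (c \<otimes>\<^bsub>C\<^esub> d) (pure K V g)"
    using assms g by (simp add: pairing_simps shuffle0_eq del: in_lists_conv_set)
  finally show "\<Phi> c (pure K V []) d (pure K V g) = te (c \<otimes>\<^bsub>C\<^esub> d) (pure K V g)"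
    using \<Phi>_bilinear(2)[OF assms(1,2) Nil_W g] by simp
qed


section \<open>Associativity of the product on \<open>C2 \<otimes> T\<close>\<close>

definition triple_shuffle :: "'v list \<Rightarrow> 'v list \<Rightarrow> 'v list \<Rightarrow> ('v list \<Rightarrow> 'a) set" where
  "triple_shuffle x y z = lsum T (\<lambda>u. shuffle0 u z) (shuffle_list x y)"

lemma triple_shuffle_closed [simp]: "triple_shuffle x y z \<in> carrier T"
  by (simp add: triple_shuffle_def)

lemma shuffle0_eq_mult: "\<lbrakk>u \<in> W; v \<in> W\<rbrakk> \<Longrightarrow> shuffle0 u v = pure K V u \<otimes>\<^bsub>Sh\<^esub> pure K V v"
  by (simp add: shuffle0_eq shuffle_pure del: in_lists_conv_set)

lemma triple_shuffle_eq:
  assumes "x \<in> W" "y \<in> W" "z \<in> W"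
  shows "triple_shuffle x y z = (pure K V x \<otimes>\<^bsub>Sh\<^esub> pure K V y) \<otimes>\<^bsub>Sh\<^esub> pure K V z"
proof -
  have "triple_shuffle x y z = lsum T (\<lambda>u. pure K V u \<otimes>\<^bsub>Sh\<^esub> pure K V z) (shuffle_list x y)"
    unfolding triple_shuffle_def
    by (rule lsum_cong) (rule shuffle0_eq_mult[OF lists_shuffle_list[OF _ assms(1,2)] assms(3)])
  also have "\<dots> = lsum T (pure K V) (shuffle_list x y) \<otimes>\<^bsub>Sh\<^esub> pure K V z"
    by (rule linear_map_lsum[OF T_module T_module bilinear_mapD(2)[OF shuffle_bilinear pure_closed'[OF assms(3)]], symmetric])
      (rule pure_shuffle_closed[OF assms(1,2)])
  finally show ?thesis by (simp only: shuffle_words_eq[OF assms(1,2), symmetric] shuffle_pure[OF assms(1,2)])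
qed

text \<open>This is the place where associativity of the shuffle product is used.\<close>

lemma triple_shuffle_symmetric:
  assumes "x \<in> W" "y \<in> W" "z \<in> W"
  shows "triple_shuffle x y z = triple_shuffle z y x"
proof -
  have "pure K V w \<in> carrier Sh" if "w \<in> W" for w using pure_closed'[OF that] by simp
  then have "(pure K V x \<otimes>\<^bsub>Sh\<^esub> pure K V y) \<otimes>\<^bsub>Sh\<^esub> pure K V z = (pure K V z \<otimes>\<^bsub>Sh\<^esub> pure K V y) \<otimes>\<^bsub>Sh\<^esub> pure K V x"
    using assms by (metis Sh.m_assoc Sh.m_comm)
  then show ?thesis unfolding triple_shuffle_eq[OF assms] triple_shuffle_eq[OF assms(3,2,1)] .
qed

text \<open>A normal form for threefold products in which each word is cut only once. Its two
  ingredients, \<open>cocycle_sum\<close> of the suffixes and \<open>triple_shuffle\<close> of the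
  prefixes, are both symmetric in the outer arguments.\<close>

definition triple_product :: "('a, 'v) sym2 set \<Rightarrow> 'v list \<Rightarrow> 'v list \<Rightarrow> 'v list \<Rightarrow> ('a, 'v) c2t" where
  "triple_product a f g h = lsum Z (\<lambda>p. lsum Z (\<lambda>q. lsum Z (\<lambda>s.
     te (a \<otimes>\<^bsub>C\<^esub> cocycle_sum (snd p) (snd q) (snd s)) (triple_shuffle (fst p) (fst q) (fst s))) (splits h)) (splits g)) (splits f)"

text \<open>For a commutative product, \<open>(x y) z = (z y) x\<close> is associativity.\<close>

lemma triple_product_symmetric:
  assumes a: "a \<in> carrier C" and W: "f \<in> W" "g \<in> W" "h \<in> W"
  shows "triple_product a f g h = triple_product a h g f"
proof -
  define X where "X p q s = te (a \<otimes>\<^bsub>C\<^esub> cocycle_sum (snd p) (snd q) (snd s)) (triple_shuffle (fst p) (fst q) (fst s))"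
    for p q s :: "'v list \<times> 'v list"
  have [simp]: "X p q s \<in> carrier Z" for p q s using a by (simp add: X_def)
  have "triple_product a f g h = lsum Z (\<lambda>p. lsum Z (\<lambda>q. lsum Z (\<lambda>s. X p q s) (splits h)) (splits g)) (splits f)"
    by (simp only: triple_product_def X_def)
  also have "\<dots> = lsum Z (\<lambda>p. lsum Z (\<lambda>s. lsum Z (\<lambda>q. X p q s) (splits g)) (splits h)) (splits f)"
    by (rule lsum_cong, rule Z.lsum_swap) simp
  also have "\<dots> = lsum Z (\<lambda>s. lsum Z (\<lambda>p. lsum Z (\<lambda>q. X p q s) (splits g)) (splits f)) (splits h)"
    by (rule Z.lsum_swap) simp
  also have "\<dots> = lsum Z (\<lambda>s. lsum Z (\<lambda>q. lsum Z (\<lambda>p. X p q s) (splits f)) (splits g)) (splits h)"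
    by (rule lsum_cong, rule Z.lsum_swap) simp
  also have "\<dots> = triple_product a h g f"
    unfolding triple_product_def X_def
  proof (intro lsum_cong)
    fix s q p assume "s \<in> set (splits h)" "q \<in> set (splits g)" "p \<in> set (splits f)"
    note w = lists_splits[OF this(1) W(3)] lists_splits[OF this(2) W(2)] lists_splits[OF this(3) W(1)]
    show "te (a \<otimes>\<^bsub>C\<^esub> cocycle_sum (snd p) (snd q) (snd s)) (triple_shuffle (fst p) (fst q) (fst s)) =
        te (a \<otimes>\<^bsub>C\<^esub> cocycle_sum (snd s) (snd q) (snd p)) (triple_shuffle (fst s) (fst q) (fst p))"
      by (simp only: cocycle_sum_symmetric[OF w(6,4,2)] triple_shuffle_symmetric[OF w(5,3,1)])
  qed
  finally show ?thesis .
qed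

lemma te_lsum1:
  assumes "\<And>x. x \<in> set xs \<Longrightarrow> \<phi> x \<in> carrier C" "t \<in> carrier T"
  shows "te (lsum C \<phi> xs) t = lsum Z (\<lambda>x. te (\<phi> x) t) xs"
  by (rule linear_map_lsum[OF C.module Z_module te_linear1[OF assms(2)] assms(1)])

lemma te_lsum2:
  assumes "\<And>x. x \<in> set xs \<Longrightarrow> \<phi> x \<in> carrier T" "c \<in> carrier C"
  shows "te c (lsum T \<phi> xs) = lsum Z (\<lambda>x. te c (\<phi> x)) xs"
  by (rule linear_map_lsum[OF T_module Z_module te_linear2[OF assms(2)] assms(1)])

lemma C_lsum_right:
  assumes "\<And>x. x \<in> set xs \<Longrightarrow> \<phi> x \<in> carrier C" "c \<in> carrier C"
  shows "c \<otimes>\<^bsub>C\<^esub> lsum C \<phi> xs = lsum C (\<lambda>x. c \<otimes>\<^bsub>C\<^esub> \<phi> x) xs"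
  by (rule linear_map_lsum[OF C.module C.module C_mult_linear(2)[OF assms(2)] assms(1)])

lemma te_cocycle_sum:
  assumes a: "a \<in> carrier C" and t: "t \<in> carrier T"
  shows "te (a \<otimes>\<^bsub>C\<^esub> cocycle_sum f g h) t = lsum Z (\<lambda>p. lsum Z (\<lambda>q. lsum Z (\<lambda>v.
    te (a \<otimes>\<^bsub>C\<^esub> (pairing (snd p) (snd q) \<otimes>\<^bsub>C\<^esub> pairing v h)) t) (shuffle_list (fst p) (fst q))) (splits g)) (splits f)"
  using assms t by (simp add: cocycle_sum_def pairing_shuffle_def C_lsum_right te_lsum1)

text \<open>For f = f1 f2 f3, g = g1 g2 g3 and h = h1 h2, the left side is the sum of e(f3, g3) e(f2
  \<squnion> g2, h2) \<otimes> (f1 \<squnion> g1 \<squnion> h1), up to the factor from C2. The first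
  product splits off f3 and g3; the second one cuts the shuffles of what is left, that is, it cuts
  f1 f2 and g1 g2. Taking f2 f3 and g2 g3 together instead exhibits the cocycle sum.\<close>

lemma CT_mult_assoc_pure:
  assumes cd: "c \<in> carrier C" "d \<in> carrier C" "k \<in> carrier C" and W: "f \<in> W" "g \<in> W" "h \<in> W"
  shows "(te c (pure K V f) \<otimes>\<^bsub>CT\<^esub> te d (pure K V g)) \<otimes>\<^bsub>CT\<^esub> te k (pure K V h) = triple_product (c \<otimes>\<^bsub>C\<^esub> d \<otimes>\<^bsub>C\<^esub> k) f g h"
proof -
  let ?a = "c \<otimes>\<^bsub>C\<^esub> d \<otimes>\<^bsub>C\<^esub> k"
  have a: "?a \<in> carrier C" using cd by simp
  \<comment> \<open>Here \<open>x\<close> and \<open>y\<close> stand for the last segments of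
    \<open>f\<close> and \<open>g\<close>, and \<open>u\<close>, \<open>v\<close> for the two parts
    of a shuffle of what precedes them.\<close>
  define F where "F x y u v = lsum Z (\<lambda>s. te (?a \<otimes>\<^bsub>C\<^esub> (pairing x y \<otimes>\<^bsub>C\<^esub> pairing v (snd s))) (shuffle0 u (fst s))) (splits h)"
    for x y u v
  have F_closed [simp]: "F x y u v \<in> carrier Z" for x y u v using a by (simp add: F_def)
  have lin: "linear_map K Z Z (\<lambda>U. U \<otimes>\<^bsub>CT\<^esub> te k (pure K V h))"
    by (rule bilinear_mapD(2)[OF CT_bilinear te_closed[OF cd(3) pure_closed'[OF W(3)]]])
  have 1: "te (c \<otimes>\<^bsub>C\<^esub> d \<otimes>\<^bsub>C\<^esub> e) (pure0 u) \<otimes>\<^bsub>CT\<^esub> te k (pure K V h)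
      = lsum Z (\<lambda>r. lsum Z (\<lambda>s. te (?a \<otimes>\<^bsub>C\<^esub> (e \<otimes>\<^bsub>C\<^esub> pairing (snd r) (snd s))) (shuffle0 (fst r) (fst s))) (splits h)) (splits u)"
    if "u \<in> W" "e \<in> carrier C" for u e
  proof -
    have "te (c \<otimes>\<^bsub>C\<^esub> d \<otimes>\<^bsub>C\<^esub> e) (pure0 u) \<otimes>\<^bsub>CT\<^esub> te k (pure K V h) = pure_product (c \<otimes>\<^bsub>C\<^esub> d \<otimes>\<^bsub>C\<^esub> e) k u h"
      using that cd W by (simp add: pure0_def CT_mult_pure del: in_lists_conv_set)
    moreover have "c \<otimes>\<^bsub>C\<^esub> d \<otimes>\<^bsub>C\<^esub> e \<otimes>\<^bsub>C\<^esub> k \<otimes>\<^bsub>C\<^esub> x = ?a \<otimes>\<^bsub>C\<^esub> (e \<otimes>\<^bsub>C\<^esub> x)" if "x \<in> carrier C" for x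
      using that cd \<open>e \<in> carrier C\<close> by (simp add: C.m_ac)
    ultimately show ?thesis by (simp add: pure_product_def)
  qed
  have fg: "te c (pure K V f) \<otimes>\<^bsub>CT\<^esub> te d (pure K V g) = lsum Z (\<lambda>p. lsum Z (\<lambda>q. lsum Z (\<lambda>u.
      te (c \<otimes>\<^bsub>C\<^esub> d \<otimes>\<^bsub>C\<^esub> pairing (snd p) (snd q)) (pure0 u)) (shuffle_list (fst p) (fst q))) (splits g)) (splits f)"
    unfolding CT_mult_pure[OF cd(1) W(1) cd(2) W(2)] pure_product_def shuffle0_def
    using cd by (simp add: te_lsum2)
  have "(te c (pure K V f) \<otimes>\<^bsub>CT\<^esub> te d (pure K V g)) \<otimes>\<^bsub>CT\<^esub> te k (pure K V h) = lsum Z (\<lambda>p. lsum Z (\<lambda>q. lsum Z (\<lambda>u.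
      te (c \<otimes>\<^bsub>C\<^esub> d \<otimes>\<^bsub>C\<^esub> pairing (snd p) (snd q)) (pure0 u) \<otimes>\<^bsub>CT\<^esub> te k (pure K V h))
      (shuffle_list (fst p) (fst q))) (splits g)) (splits f)"
    unfolding fg using cd by (simp add: linear_map_lsum[OF Z_module Z_module lin])
  also have "\<dots> = lsum Z (\<lambda>p. lsum Z (\<lambda>q. lsum Z (\<lambda>u. lsum Z (\<lambda>r. F (snd p) (snd q) (fst r) (snd r))
      (splits u)) (shuffle_list (fst p) (fst q))) (splits g)) (splits f)"
  proof (rule lsum_cong, rule lsum_cong, rule lsum_cong)
    fix p q u assume p: "p \<in> set (splits f)" and q: "q \<in> set (splits g)"
      and u: "u \<in> set (shuffle_list (fst p) (fst q))"
    have "u \<in> W" by (rule lists_shuffle_list[OF u lists_splits(1)[OF p W(1)] lists_splits(1)[OF q W(2)]])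
    then show "te (c \<otimes>\<^bsub>C\<^esub> d \<otimes>\<^bsub>C\<^esub> pairing (snd p) (snd q)) (pure0 u) \<otimes>\<^bsub>CT\<^esub> te k (pure K V h)
        = lsum Z (\<lambda>r. F (snd p) (snd q) (fst r) (snd r)) (splits u)"
      unfolding F_def by (rule 1) simp
  qed
  \<comment> \<open>Multiplicativity of deconcatenation: the cuts of a shuffle are the shuffles of
    cuts.\<close>
  also have "\<dots> = lsum Z (\<lambda>p. lsum Z (\<lambda>q. lsum Z (\<lambda>p'. lsum Z (\<lambda>q'. lsum Z (\<lambda>u. lsum Z (\<lambda>v.
      F (snd p) (snd q) u v) (shuffle_list (snd p') (snd q'))) (shuffle_list (fst p') (fst q')))
      (splits (fst q))) (splits (fst p))) (splits g)) (splits f)"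
    by (rule lsum_cong, rule lsum_cong, rule Z.lsum_splits_shuffle) simp
  also have "\<dots> = lsum Z (\<lambda>p. lsum Z (\<lambda>p'. lsum Z (\<lambda>q. lsum Z (\<lambda>q'. lsum Z (\<lambda>u. lsum Z (\<lambda>v.
      F (snd p) (snd q) u v) (shuffle_list (snd p') (snd q'))) (shuffle_list (fst p') (fst q')))
      (splits (fst q))) (splits g)) (splits (fst p))) (splits f)"
    by (rule lsum_cong, rule Z.lsum_swap) simp
  \<comment> \<open>Coassociativity for \<open>f\<close>: the suffix is cut a second time instead of
    the prefix.\<close>
  also have "\<dots> = lsum Z (\<lambda>p. lsum Z (\<lambda>p'. lsum Z (\<lambda>q. lsum Z (\<lambda>q'. lsum Z (\<lambda>u. lsum Z (\<lambda>v.
      F (snd p') (snd q) u v) (shuffle_list (fst p') (snd q'))) (shuffle_list (fst p) (fst q')))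
      (splits (fst q))) (splits g)) (splits (snd p))) (splits f)"
    by (rule Z.lsum_splits_coassoc[where F = "\<lambda>a1 a2 b. lsum Z (\<lambda>q. lsum Z (\<lambda>q'. lsum Z (\<lambda>u. lsum Z (\<lambda>v.
      F b (snd q) u v) (shuffle_list a2 (snd q'))) (shuffle_list a1 (fst q'))) (splits (fst q))) (splits g)"]) simp
  \<comment> \<open>The same regrouping for \<open>g\<close>, with the three segments of
    \<open>f\<close> fixed.\<close>
  also have "\<dots> = lsum Z (\<lambda>p. lsum Z (\<lambda>p'. lsum Z (\<lambda>q. lsum Z (\<lambda>q'. lsum Z (\<lambda>u. lsum Z (\<lambda>v.
      F (snd p') (snd q') u v) (shuffle_list (fst p') (fst q'))) (shuffle_list (fst p) (fst q)))
      (splits (snd q))) (splits g)) (splits (snd p))) (splits f)"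
  proof (rule lsum_cong, rule lsum_cong)
    fix p p' :: "'v list \<times> 'v list"
    show "lsum Z (\<lambda>q. lsum Z (\<lambda>q'. lsum Z (\<lambda>u. lsum Z (\<lambda>v.
        F (snd p') (snd q) u v) (shuffle_list (fst p') (snd q'))) (shuffle_list (fst p) (fst q')))
        (splits (fst q))) (splits g)
      = lsum Z (\<lambda>q. lsum Z (\<lambda>q'. lsum Z (\<lambda>u. lsum Z (\<lambda>v.
        F (snd p') (snd q') u v) (shuffle_list (fst p') (fst q'))) (shuffle_list (fst p) (fst q)))
        (splits (snd q))) (splits g)"
      by (rule Z.lsum_splits_coassoc[where F = "\<lambda>b1 b2 b. lsum Z (\<lambda>u. lsum Z (\<lambda>v.
        F (snd p') b u v) (shuffle_list (fst p') b2)) (shuffle_list (fst p) b1)"]) simp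
  qed
  also have "\<dots> = lsum Z (\<lambda>p. lsum Z (\<lambda>q. lsum Z (\<lambda>p'. lsum Z (\<lambda>q'. lsum Z (\<lambda>u. lsum Z (\<lambda>v.
      F (snd p') (snd q') u v) (shuffle_list (fst p') (fst q'))) (shuffle_list (fst p) (fst q)))
      (splits (snd q))) (splits (snd p))) (splits g)) (splits f)"
    by (rule lsum_cong, rule Z.lsum_swap) simp
  \<comment> \<open>For a fixed cut \<open>s\<close> of \<open>h\<close>, the sums over
    \<open>p'\<close>, \<open>q'\<close> and \<open>v\<close> make up \<open>cocycle_sum\<close>,
    and the sum over \<open>u\<close> makes up \<open>triple_shuffle\<close>. The interchanges bring
    \<open>s\<close> to the outside and \<open>u\<close> to the inside.\<close>
  also have "\<dots> = triple_product ?a f g h"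
    unfolding triple_product_def
  proof (rule lsum_cong, rule lsum_cong)
    fix p q :: "'v list \<times> 'v list"
    define X where "X p' q' v s u = te (?a \<otimes>\<^bsub>C\<^esub> (pairing (snd p') (snd q') \<otimes>\<^bsub>C\<^esub> pairing v (snd s))) (shuffle0 u (fst s))"
      for p' q' s :: "'v list \<times> 'v list" and v u :: "'v list"
    have [simp]: "X p' q' v s u \<in> carrier Z" for p' q' v s u using a by (simp add: X_def)
    let ?P = "splits (snd p)" and ?Q = "splits (snd q)" and ?U = "shuffle_list (fst p) (fst q)"
    let ?H = "splits h" and ?V = "\<lambda>p' q'. shuffle_list (fst p') (fst q')"
    have "lsum Z (\<lambda>p'. lsum Z (\<lambda>q'. lsum Z (\<lambda>u. lsum Z (\<lambda>v. F (snd p') (snd q') u v) (?V p' q')) ?U) ?Q) ?P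
        = lsum Z (\<lambda>p'. lsum Z (\<lambda>q'. lsum Z (\<lambda>u. lsum Z (\<lambda>v. lsum Z (\<lambda>s. X p' q' v s u) ?H) (?V p' q')) ?U) ?Q) ?P"
      by (simp only: F_def X_def)
    also have "\<dots> = lsum Z (\<lambda>p'. lsum Z (\<lambda>q'. lsum Z (\<lambda>v. lsum Z (\<lambda>u. lsum Z (\<lambda>s. X p' q' v s u) ?H) ?U) (?V p' q')) ?Q) ?P"
      by (rule lsum_cong, rule lsum_cong, rule Z.lsum_swap) simp
    also have "\<dots> = lsum Z (\<lambda>p'. lsum Z (\<lambda>q'. lsum Z (\<lambda>v. lsum Z (\<lambda>s. lsum Z (\<lambda>u. X p' q' v s u) ?U) ?H) (?V p' q')) ?Q) ?P"
      by (rule lsum_cong, rule lsum_cong, rule lsum_cong, rule Z.lsum_swap) simp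
    also have "\<dots> = lsum Z (\<lambda>p'. lsum Z (\<lambda>q'. lsum Z (\<lambda>s. lsum Z (\<lambda>v. lsum Z (\<lambda>u. X p' q' v s u) ?U) (?V p' q')) ?H) ?Q) ?P"
      by (rule lsum_cong, rule lsum_cong, rule Z.lsum_swap) simp
    also have "\<dots> = lsum Z (\<lambda>p'. lsum Z (\<lambda>s. lsum Z (\<lambda>q'. lsum Z (\<lambda>v. lsum Z (\<lambda>u. X p' q' v s u) ?U) (?V p' q')) ?Q) ?H) ?P"
      by (rule lsum_cong, rule Z.lsum_swap) simp
    also have "\<dots> = lsum Z (\<lambda>s. lsum Z (\<lambda>p'. lsum Z (\<lambda>q'. lsum Z (\<lambda>v. lsum Z (\<lambda>u. X p' q' v s u) ?U) (?V p' q')) ?Q) ?P) ?H"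
      by (rule Z.lsum_swap) simp
    also have "\<dots> = lsum Z (\<lambda>s. te (?a \<otimes>\<^bsub>C\<^esub> cocycle_sum (snd p) (snd q) (snd s)) (triple_shuffle (fst p) (fst q) (fst s))) ?H"
      unfolding te_cocycle_sum[OF a triple_shuffle_closed] X_def
      by (rule lsum_cong, rule lsum_cong, rule lsum_cong, rule lsum_cong)
        (use a in \<open>simp add: triple_shuffle_def te_lsum2\<close>)
    finally show "lsum Z (\<lambda>p'. lsum Z (\<lambda>q'. lsum Z (\<lambda>u. lsum Z (\<lambda>v. F (snd p') (snd q') u v) (?V p' q')) ?U) ?Q) ?P
        = lsum Z (\<lambda>s. te (?a \<otimes>\<^bsub>C\<^esub> cocycle_sum (snd p) (snd q) (snd s)) (triple_shuffle (fst p) (fst q) (fst s))) ?H" .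
  qed
  finally show ?thesis .
qed

lemma CT_algebra: "algebra K CT"
proof -
  let ?G = "{te c t | c t. c \<in> carrier C \<and> t \<in> pure K V ` W}"
  have eq: "CT = Z\<lparr>mult := mult CT, one := one CT\<rparr>"
    by (simp add: C2T_def Let_def)
  have mod: "module K CT"
    by (subst eq, subst mult_one_update) (rule Z_module)
  have comm: "U \<otimes>\<^bsub>CT\<^esub> X = X \<otimes>\<^bsub>CT\<^esub> U" if UX: "U \<in> ?G" "X \<in> ?G" for U X
  proof -
    obtain c f where c: "U = te c (pure K V f)" "c \<in> carrier C" "f \<in> W" using UX(1) by auto
    obtain d g where d: "X = te d (pure K V g)" "d \<in> carrier C" "g \<in> W" using UX(2) by auto
    show ?thesis
      unfolding c(1) d(1) CT_mult_pure[OF c(2,3) d(2,3)] CT_mult_pure[OF d(2,3) c(2,3)]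
      by (rule pure_product_commute[OF c(2) d(2) c(3) d(3)])
  qed
  show ?thesis
  proof (rule algebra_by_generators[OF mod, of ?G])
    show "bilinear_map K CT CT CT (mult CT)"
      using CT_bilinear by (simp add: bilinear_map_def linear_map_def)
    show "\<one>\<^bsub>CT\<^esub> \<in> carrier CT" using pure_closed'[OF Nil_W] by simp
    show "?G \<subseteq> carrier CT"
      by (auto intro!: te_closed pure_closed')
    have "pure K V ` W \<subseteq> carrier T" by (rule image_subsetI) (rule pure_closed')
    from mspan_tensor_elts[OF C.module T_module order_refl _ this mspan_pure[OF V_module]]
    have "mspan K Z ?G = carrier Z"
      using submodule_mspan(2,3)[OF C.module order_refl] by auto
    then show "mspan K CT ?G = carrier CT"
      by (subst eq, subst mult_one_update) simp
    show "\<one>\<^bsub>CT\<^esub> \<otimes>\<^bsub>CT\<^esub> U = U" if U: "U \<in> ?G" for U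
    proof -
      obtain c f where c: "U = te c (pure K V f)" "c \<in> carrier C" "f \<in> W" using U by auto
      show ?thesis using CT_mult_Nil[OF C.one_closed c(2) pure_closed'[OF c(3)]] c(1,2) by simp
    qed
    show "U \<otimes>\<^bsub>CT\<^esub> X = X \<otimes>\<^bsub>CT\<^esub> U" if "U \<in> ?G" "X \<in> ?G" for U X
      by (rule comm[OF that])
    fix U X Y assume U: "U \<in> ?G" and X: "X \<in> ?G" and Y: "Y \<in> ?G"
    obtain c f where c: "U = te c (pure K V f)" "c \<in> carrier C" "f \<in> W" using U by auto
    obtain d g where d: "X = te d (pure K V g)" "d \<in> carrier C" "g \<in> W" using X by auto
    obtain k h where k: "Y = te k (pure K V h)" "k \<in> carrier C" "h \<in> W" using Y by auto
    have cl: "U \<in> carrier Z" "X \<in> carrier Z" "Y \<in> carrier Z"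
      unfolding c(1) d(1) k(1) by (rule te_closed[OF c(2) pure_closed'[OF c(3)]]
          te_closed[OF d(2) pure_closed'[OF d(3)]] te_closed[OF k(2) pure_closed'[OF k(3)]])+
    have "X \<otimes>\<^bsub>CT\<^esub> Y \<in> carrier Z" by (rule bilinear_map_closed[OF CT_bilinear cl(2,3)])
    have span: "mspan K Z ?G = carrier Z" by fact
    have sub: "?G \<subseteq> carrier Z" by (auto intro!: te_closed pure_closed')
    have flip: "bilinear_map K Z Z Z (\<lambda>x y. y \<otimes>\<^bsub>CT\<^esub> x)" using CT_bilinear by (simp add: bilinear_map_def)
    \<comment> \<open>A product of two generators need not be a generator, so commutativity is first
      extended to the whole module by bilinearity.\<close>
    have comm': "U \<otimes>\<^bsub>CT\<^esub> (X \<otimes>\<^bsub>CT\<^esub> Y) = (X \<otimes>\<^bsub>CT\<^esub> Y) \<otimes>\<^bsub>CT\<^esub> U"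
      by (rule bilinear_map_eq_on_mspan[OF Z_module Z_module Z_module sub sub CT_bilinear flip comm])
        (use span cl \<open>X \<otimes>\<^bsub>CT\<^esub> Y \<in> carrier Z\<close> in auto)
    have "(U \<otimes>\<^bsub>CT\<^esub> X) \<otimes>\<^bsub>CT\<^esub> Y = triple_product (c \<otimes>\<^bsub>C\<^esub> d \<otimes>\<^bsub>C\<^esub> k) f g h"
      unfolding c(1) d(1) k(1) by (rule CT_mult_assoc_pure[OF c(2) d(2) k(2) c(3) d(3) k(3)])
    also have "\<dots> = triple_product (k \<otimes>\<^bsub>C\<^esub> d \<otimes>\<^bsub>C\<^esub> c) h g f"
    proof -
      have "c \<otimes>\<^bsub>C\<^esub> d \<otimes>\<^bsub>C\<^esub> k = k \<otimes>\<^bsub>C\<^esub> d \<otimes>\<^bsub>C\<^esub> c" using c(2) d(2) k(2) by (simp add: C.m_ac)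
      then show ?thesis using c d k triple_product_symmetric[of "c \<otimes>\<^bsub>C\<^esub> d \<otimes>\<^bsub>C\<^esub> k" f g h] by simp
    qed
    also have "\<dots> = (Y \<otimes>\<^bsub>CT\<^esub> X) \<otimes>\<^bsub>CT\<^esub> U"
      unfolding c(1) d(1) k(1) by (rule CT_mult_assoc_pure[OF k(2) d(2) c(2) k(3) d(3) c(3), symmetric])
    also have "\<dots> = U \<otimes>\<^bsub>CT\<^esub> (X \<otimes>\<^bsub>CT\<^esub> Y)"
      unfolding comm' by (simp only: comm[OF X Y])
    finally show "U \<otimes>\<^bsub>CT\<^esub> X \<otimes>\<^bsub>CT\<^esub> Y = U \<otimes>\<^bsub>CT\<^esub> (X \<otimes>\<^bsub>CT\<^esub> Y)" .
  qed
qed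

end

section \<open>Monomials and the grading of \<open>T\<close>\<close>

definition monomial :: "('b, 'z) monoid_scheme \<Rightarrow> 'b multiset \<Rightarrow> 'b" where
  "monomial A m = (\<Otimes>\<^bsub>A\<^esub>b\<in>set_mset m. b [^]\<^bsub>A\<^esub> count m b)"

lemma poly_eval_eq: "poly_eval K A = lin_ext K A (monomial A)"
  by (auto simp: poly_eval_def lin_ext_def monomial_def)

context comm_monoid
begin

lemma monomial_empty: "monomial G {#} = \<one>"
  by (simp add: monomial_def)

text \<open>The definition by powers matches \<open>poly_eval\<close>; inductions need this
  recursion. Separating the factor of \<open>b\<close> covers both cases, since an element that does
  not occur contributes its power zero.\<close>

lemma monomial_add_mset:
  assumes "b \<in> carrier G" "set_mset m \<subseteq> carrier G"
  shows "monomial G (add_mset b m) = b \<otimes> monomial G m"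
proof -
  let ?S = "set_mset m - {b}"
  let ?P = "\<Otimes>x\<in>?S. x [^] count m x"
  have P: "?P \<in> carrier G" using assms by (intro finprod_closed) auto
  have "monomial G m = (\<Otimes>x\<in>insert b ?S. x [^] count m x)"
  proof (cases "b \<in># m")
    case True
    then show ?thesis by (simp add: monomial_def insert_absorb)
  next
    case False
    then have [simp]: "?S = set_mset m" by auto
    have "(\<Otimes>x\<in>insert b ?S. x [^] count m x) = b [^] count m b \<otimes> (\<Otimes>x\<in>set_mset m. x [^] count m x)"
      using assms False by (subst finprod_insert) auto
    also have "count m b = 0" using False by (simp add: not_in_iff)
    finally show ?thesis using P by (simp add: monomial_def)
  qed
  also have "\<dots> = b [^] count m b \<otimes> ?P"
    using assms by (subst finprod_insert) auto
  finally have m: "monomial G m = b [^] count m b \<otimes> ?P" .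
  have "monomial G (add_mset b m) = (\<Otimes>x\<in>insert b ?S. x [^] count (add_mset b m) x)"
    by (simp add: monomial_def)
  also have "\<dots> = b [^] Suc (count m b) \<otimes> (\<Otimes>x\<in>?S. x [^] count (add_mset b m) x)"
    using assms by (subst finprod_insert) auto
  also have "(\<Otimes>x\<in>?S. x [^] count (add_mset b m) x) = ?P"
    using assms by (intro finprod_cong') auto
  also have "b [^] Suc (count m b) \<otimes> ?P = b \<otimes> (b [^] count m b \<otimes> ?P)"
    using assms P by (simp add: m_ac)
  finally show ?thesis by (simp add: m)
qed

lemma monomial_closed: "set_mset m \<subseteq> carrier G \<Longrightarrow> monomial G m \<in> carrier G"
  by (induction m) (auto simp: monomial_empty monomial_add_mset)

end

lemma submodule_lsum:
  assumes "submodule U K M" "\<And>x. x \<in> set xs \<Longrightarrow> \<phi> x \<in> U"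
  shows "lsum M \<phi> xs \<in> U"
proof -
  have add: "a \<oplus>\<^bsub>M\<^esub> b \<in> U" if "a \<in> U" "b \<in> U" for a b
    using subgroup.m_closed[OF submodule.axioms(1)[OF assms(1)] that] by simp
  show ?thesis using assms(2) by (induction xs) (auto simp: submodule_zero[OF assms(1)] add)
qed

lemma bilinear_map_image_mspan:
  assumes "module K M" "module K N" "module K P" "bilinear_map K M N P f" "S \<subseteq> carrier M" "R \<subseteq> carrier N"
    and "x \<in> mspan K M S" "y \<in> mspan K N R" "submodule U K P" "\<And>x y. \<lbrakk>x \<in> S; y \<in> R\<rbrakk> \<Longrightarrow> f x y \<in> U"
  shows "f x y \<in> U"
proof -
  have y: "y \<in> carrier N" using submodule_mspan(3)[OF assms(2,6)] assms(8) by auto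
  have "f s y \<in> U" if "s \<in> S" for s
    using that assms(5)
    by (intro linear_map_image_mspan[OF assms(2,3) bilinear_mapD(1)[OF assms(4)] assms(6,8,9) assms(10)]) auto
  then show ?thesis
    by (rule linear_map_image_mspan[OF assms(1,3) bilinear_mapD(2)[OF assms(4) y] assms(5,7,9)])
qed

context shuffle_context
begin

text \<open>The grading is not built into the presentation of T. This map exists because the
  relations are homogeneous in length, and it shows that the sum of the tensor powers is
  direct.\<close>

definition proj :: "nat \<Rightarrow> ('v list \<Rightarrow> 'a) set \<Rightarrow> ('v list \<Rightarrow> 'a) set" where
  "proj n = pres_lift K T (\<lambda>w. if length w = n then pure K V w else \<zero>\<^bsub>T\<^esub>)"

lemma proj_multilinear: "word_multilinear K V T (\<lambda>w. if length w = n then pure K V w else \<zero>\<^bsub>T\<^esub>)"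
  unfolding word_multilinear_def
proof (intro conjI ballI)
  show "(if length w = n then pure K V w else \<zero>\<^bsub>T\<^esub>) \<in> carrier T" if "w \<in> W" for w
    using pure_closed'[OF that] by simp
  show "linear_map K V T (\<lambda>x. if length (u @ x # w) = n then pure K V (u @ x # w) else \<zero>\<^bsub>T\<^esub>)"
    if "u \<in> W" "w \<in> W" for u w
    using word_multilinearD(2)[OF pure_multilinear[OF V_module] that] linear_map_const_zero[OF T_module]
    by (cases "length u + Suc (length w) = n") simp_all
qed

lemma proj_linear: "linear_map K T T (proj n)"
  unfolding proj_def by (rule tensors_lift(1)[OF V_module T_module proj_multilinear])

lemma proj_pure: "w \<in> W \<Longrightarrow> proj n (pure K V w) = (if length w = n then pure K V w else \<zero>\<^bsub>T\<^esub>)"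
  unfolding proj_def by (rule tensors_lift(2)[OF V_module T_module proj_multilinear])

lemma proj_tensor_power:
  assumes "t \<in> tensor_power K V k"
  shows "proj n t = (if k = n then t else \<zero>\<^bsub>T\<^esub>)"
proof (rule linear_map_eq_on_mspan[OF T_module T_module tensor_power_subset proj_linear _ _ assms[unfolded tensor_power_def]])
  show "linear_map K T T (\<lambda>t. if k = n then t else \<zero>\<^bsub>T\<^esub>)"
    by (cases "k = n") (simp_all add: linear_map_id linear_map_const_zero[OF T_module])
  show "proj n x = (if k = n then x else \<zero>\<^bsub>T\<^esub>)" if x: "x \<in> {pure K V w |w. w \<in> W \<and> length w = k}" for x
  proof -
    obtain w where w: "x = pure K V w" "w \<in> W" "length w = k" using x by auto
    show ?thesis unfolding w(1) proj_pure[OF w(2)] w(3) by simp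
  qed
qed

lemma shuffle_tensor_power:
  assumes "s \<in> tensor_power K V p" "t \<in> tensor_power K V q"
  shows "s \<otimes>\<^bsub>Sh\<^esub> t \<in> tensor_power K V (p + q)"
proof (rule bilinear_map_image_mspan[OF T_module T_module T_module shuffle_bilinear tensor_power_subset
      tensor_power_subset assms[unfolded tensor_power_def] tensor_power_submodule])
  fix x y assume "x \<in> {pure K V w |w. w \<in> W \<and> length w = p}" "y \<in> {pure K V w |w. w \<in> W \<and> length w = q}"
  then obtain u w where u: "x = pure K V u" "u \<in> W" "length u = p" and w: "y = pure K V w" "w \<in> W" "length w = q"
    by auto
  show "x \<otimes>\<^bsub>Sh\<^esub> y \<in> tensor_power K V (p + q)"
    unfolding u(1) w(1) shuffle_pure[OF u(2) w(2)] shuffle_words_eq[OF u(2) w(2)]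
  proof (rule submodule_lsum[OF tensor_power_submodule])
    fix z assume z: "z \<in> set (shuffle_list u w)"
    show "pure K V z \<in> tensor_power K V (p + q)"
      by (rule pure_in_tensor_power[OF lists_shuffle_list[OF z u(2) w(2)]])
        (simp add: length_shuffle_list[OF z] u(3) w(3))
  qed
qed

section \<open>The length filtration\<close>

text \<open>The bound is strict, so that the remainder behind a leading term of degree
  \<open>d\<close> lies in \<open>Fil d\<close>. In particular \<open>Fil 0\<close> is zero, which
  starts the induction in \<open>CT_monomial_leading\<close>.\<close>

definition Fil :: "nat \<Rightarrow> ('a, 'v) c2t set" where
  "Fil d = mspan K Z {te c (pure K V w) | c w. c \<in> carrier C \<and> w \<in> W \<and> length w < d}"

lemma Fil_gens: "{te c (pure K V w) | c w. c \<in> carrier C \<and> w \<in> W \<and> length w < d} \<subseteq> carrier Z"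
  by (auto intro!: te_closed pure_closed')

lemma Fil_submodule: "submodule (Fil d) K Z"
  unfolding Fil_def by (rule submodule_mspan(1)[OF Z_module Fil_gens])

lemma Fil_closed: "z \<in> Fil d \<Longrightarrow> z \<in> carrier Z"
  using submodule_mspan(3)[OF Z_module Fil_gens] unfolding Fil_def by blast

lemma Fil_gen: "\<lbrakk>c \<in> carrier C; w \<in> W; length w < d\<rbrakk> \<Longrightarrow> te c (pure K V w) \<in> Fil d"
  unfolding Fil_def using submodule_mspan(2)[OF Z_module Fil_gens] by blast

lemma Fil_shw:
  assumes "c \<in> carrier C" "u \<in> W" "w \<in> W" "length u + length w < d"
  shows "te c (shuffle0 u w) \<in> Fil d"
proof -
  have "te c (shuffle0 u w) = lsum Z (\<lambda>z. te c (pure0 z)) (shuffle_list u w)"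
    unfolding shuffle0_def using assms(1) by (simp add: te_lsum2)
  also have "\<dots> \<in> Fil d"
  proof (rule submodule_lsum[OF Fil_submodule])
    fix z assume z: "z \<in> set (shuffle_list u w)"
    have "z \<in> W" by (rule lists_shuffle_list[OF z assms(2,3)])
    then show "te c (pure0 z) \<in> Fil d"
      using Fil_gen[OF assms(1)] length_shuffle_list[OF z] assms(4) by (simp only: pure0_def if_True)
  qed
  finally show ?thesis .
qed

lemma splits_snoc: "splits w = map (\<lambda>i. (take i w, drop i w)) [0..<length w] @ [(w, [])]"
  by (simp add: splits_eq)

text \<open>The cut with both suffixes empty gives the shuffle. Every other cut shortens a prefix,
  and the length of a shuffle is the sum of the lengths.\<close>

lemma pure_product_leading:
  assumes cd: "c \<in> carrier C" "d \<in> carrier C" and W: "f \<in> W" "g \<in> W"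
  shows "\<exists>r\<in>Fil (length f + length g). pure_product c d f g = te (c \<otimes>\<^bsub>C\<^esub> d) (shuffle0 f g) \<oplus>\<^bsub>Z\<^esub> r"
proof -
  let ?n = "length f" and ?m = "length g"
  define H where "H p q = te (c \<otimes>\<^bsub>C\<^esub> d \<otimes>\<^bsub>C\<^esub> pairing (snd p) (snd q)) (shuffle0 (fst p) (fst q))" for p q :: "'v list \<times> 'v list"
  have [simp]: "H p q \<in> carrier Z" for p q using cd by (simp add: H_def)
  have H: "H p q \<in> Fil (?n + ?m)"
    if "p \<in> set (splits f)" "q \<in> set (splits g)" "length (fst p) + length (fst q) < ?n + ?m" for p q
    unfolding H_def
    by (rule Fil_shw[OF _ lists_splits(1)[OF that(1) W(1)] lists_splits(1)[OF that(2) W(2)] that(3)])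
      (use cd in simp)
  \<comment> \<open>All cuts except the last one, that is, those with a proper prefix.\<close>
  let ?F = "map (\<lambda>i. (take i f, drop i f)) [0..<?n]" and ?G = "map (\<lambda>i. (take i g, drop i g)) [0..<?m]"
  have 1: "pure_product c d f g = lsum Z (\<lambda>p. lsum Z (H p) (splits g)) (splits f)"
    by (simp add: pure_product_def H_def[abs_def])
  have 2: "\<dots> = lsum Z (\<lambda>p. lsum Z (H p) (splits g)) ?F \<oplus>\<^bsub>Z\<^esub> lsum Z (H (f, [])) (splits g)"
    unfolding splits_snoc[of f] by (subst Z.lsum_append) simp_all
  have 3: "lsum Z (H (f, [])) (splits g) = lsum Z (H (f, [])) ?G \<oplus>\<^bsub>Z\<^esub> H (f, []) (g, [])"
    unfolding splits_snoc[of g] by (subst Z.lsum_append) simp_all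
  have sF: "set ?F \<subseteq> set (splits f)" and sG: "set ?G \<subseteq> set (splits g)" and f: "(f, []) \<in> set (splits f)"
    unfolding splits_snoc[of f] splits_snoc[of g] by auto
  have le: "length (fst q) \<le> ?m" if "q \<in> set (splits g)" for q
    using append_splits[OF that] by (metis length_append le_add1)
  have r1: "lsum Z (\<lambda>p. lsum Z (H p) (splits g)) ?F \<in> Fil (?n + ?m)"
  proof (rule submodule_lsum[OF Fil_submodule], rule submodule_lsum[OF Fil_submodule])
    fix p q assume p: "p \<in> set ?F" and q: "q \<in> set (splits g)"
    then have "length (fst p) < ?n" by auto
    with le[OF q] show "H p q \<in> Fil (?n + ?m)"
      using sF p by (intro H[OF _ q]) auto
  qed
  have r2: "lsum Z (H (f, [])) ?G \<in> Fil (?n + ?m)"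
  proof (rule submodule_lsum[OF Fil_submodule])
    fix q assume q: "q \<in> set ?G"
    then have "length (fst q) < ?m" by auto
    then show "H (f, []) q \<in> Fil (?n + ?m)" using sG q by (intro H[OF f]) auto
  qed
  have 4: "H (f, []) (g, []) = te (c \<otimes>\<^bsub>C\<^esub> d) (shuffle0 f g)" using cd by (simp add: H_def pairing_simps)
  have "pure_product c d f g = te (c \<otimes>\<^bsub>C\<^esub> d) (shuffle0 f g) \<oplus>\<^bsub>Z\<^esub>
      (lsum Z (\<lambda>p. lsum Z (H p) (splits g)) ?F \<oplus>\<^bsub>Z\<^esub> lsum Z (H (f, [])) ?G)"
    unfolding 1 2 3 4[symmetric] using Fil_closed[OF r1] Fil_closed[OF r2]
    by (simp add: Z.a_ac del: lsum_map)
  moreover have "lsum Z (\<lambda>p. lsum Z (H p) (splits g)) ?F \<oplus>\<^bsub>Z\<^esub> lsum Z (H (f, [])) ?G \<in> Fil (?n + ?m)"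
    by (rule Z.submoduleE(5)[OF Fil_submodule r1 r2])
  ultimately show ?thesis by blast
qed

sublocale CT: algebra K CT by (rule CT_algebra)

lemma one_C: "\<one>\<^bsub>C\<^esub> \<in> carrier C" by simp

text \<open>For pure tensors, neither the leading shuffle nor the remainder exceeds the sum of the
  lengths. Here \<open>p\<close> is exact and only the bound \<open>d\<close> is strict, so the sum
  remains below \<open>p + d\<close>.\<close>

lemma mult_Fil:
  assumes "s \<in> tensor_power K V p" "z \<in> Fil d"
  shows "te \<one>\<^bsub>C\<^esub> s \<otimes>\<^bsub>CT\<^esub> z \<in> Fil (p + d)"
proof -
  have bil: "bilinear_map K T Z Z (\<lambda>s z. te \<one>\<^bsub>C\<^esub> s \<otimes>\<^bsub>CT\<^esub> z)"
    by (rule bilinear_map_compose[OF CT_bilinear te_linear2[OF one_C] linear_map_id])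
  show ?thesis
  proof (rule bilinear_map_image_mspan[OF T_module Z_module Z_module bil tensor_power_subset Fil_gens
        assms[unfolded tensor_power_def Fil_def] Fil_submodule])
    fix x y assume "x \<in> {pure K V w |w. w \<in> W \<and> length w = p}"
      "y \<in> {te c (pure K V w) |c w. c \<in> carrier C \<and> w \<in> W \<and> length w < d}"
    then obtain u c w where x: "x = pure K V u" "u \<in> W" "length u = p"
      and y: "y = te c (pure K V w)" "c \<in> carrier C" "w \<in> W" "length w < d" by auto
    obtain r where r: "r \<in> Fil (p + length w)" "pure_product \<one>\<^bsub>C\<^esub> c u w = te (\<one>\<^bsub>C\<^esub> \<otimes>\<^bsub>C\<^esub> c) (shuffle0 u w) \<oplus>\<^bsub>Z\<^esub> r"
      using pure_product_leading[OF one_C y(2) x(2) y(3)] x(3) by auto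
    have "r \<in> Fil (p + d)"
    proof -
      have "Fil (p + length w) \<subseteq> Fil (p + d)"
        unfolding Fil_def[of "p + length w"]
        by (rule mspan_minimal[OF Fil_submodule]) (use y(4) in \<open>auto intro!: Fil_gen\<close>)
      then show ?thesis using r(1) by auto
    qed
    moreover have "te (\<one>\<^bsub>C\<^esub> \<otimes>\<^bsub>C\<^esub> c) (shuffle0 u w) \<in> Fil (p + d)"
      by (rule Fil_shw) (use x y in simp_all)
    ultimately show "te \<one>\<^bsub>C\<^esub> x \<otimes>\<^bsub>CT\<^esub> y \<in> Fil (p + d)"
      unfolding x(1) y(1) CT_mult_pure[OF one_C x(2) y(2,3)] r(2)
      by (intro Z.submoduleE(5)[OF Fil_submodule])
  qed
qed

text \<open>Homogeneity reduces this to words of the exact lengths \<open>p\<close> and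
  \<open>q\<close>, for which all remainders lie below the same bound \<open>p + q\<close>.\<close>

lemma mult_leading:
  assumes "s \<in> tensor_power K V p" "t \<in> tensor_power K V q"
  shows "te \<one>\<^bsub>C\<^esub> s \<otimes>\<^bsub>CT\<^esub> te \<one>\<^bsub>C\<^esub> t \<ominus>\<^bsub>Z\<^esub> te \<one>\<^bsub>C\<^esub> (s \<otimes>\<^bsub>Sh\<^esub> t) \<in> Fil (p + q)"
proof -
  \<comment> \<open>The difference is written with the scalar minus one, so that it is visibly
    bilinear.\<close>
  let ?D = "\<lambda>s t. te \<one>\<^bsub>C\<^esub> s \<otimes>\<^bsub>CT\<^esub> te \<one>\<^bsub>C\<^esub> t \<oplus>\<^bsub>Z\<^esub> (\<ominus>\<^bsub>K\<^esub> \<one>\<^bsub>K\<^esub>) \<odot>\<^bsub>Z\<^esub> te \<one>\<^bsub>C\<^esub> (s \<otimes>\<^bsub>Sh\<^esub> t)"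
  have bil: "bilinear_map K T T Z ?D"
    by (intro bilinear_map_add[OF Z_module] bilinear_map_smult[OF Z_module]
        bilinear_map_compose[OF CT_bilinear te_linear2[OF one_C] te_linear2[OF one_C]]
        linear_bilinear_compose[OF shuffle_bilinear te_linear2[OF one_C]]) simp
  have "?D s t \<in> Fil (p + q)"
  proof (rule bilinear_map_image_mspan[OF T_module T_module Z_module bil tensor_power_subset
      tensor_power_subset assms[unfolded tensor_power_def] Fil_submodule])
    fix x y assume "x \<in> {pure K V w |w. w \<in> W \<and> length w = p}" "y \<in> {pure K V w |w. w \<in> W \<and> length w = q}"
    then obtain u w where u: "x = pure K V u" "u \<in> W" "length u = p" and w: "y = pure K V w" "w \<in> W" "length w = q"
      by auto
    obtain r where r: "r \<in> Fil (p + q)" "pure_product \<one>\<^bsub>C\<^esub> \<one>\<^bsub>C\<^esub> u w = te (\<one>\<^bsub>C\<^esub> \<otimes>\<^bsub>C\<^esub> \<one>\<^bsub>C\<^esub>) (shuffle0 u w) \<oplus>\<^bsub>Z\<^esub> r"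
      using pure_product_leading[OF one_C one_C u(2) w(2)] u(3) w(3) by auto
    have "te \<one>\<^bsub>C\<^esub> (shuffle0 u w) \<in> carrier Z" by simp
    then have "?D x y = r"
      unfolding u(1) w(1) CT_mult_pure[OF one_C u(2) one_C w(2)] r(2) shuffle0_eq_mult[OF u(2) w(2), symmetric]
      using Fil_closed[OF r(1)] by (simp add: Z.smult_l_minus Z.a_ac Z.r_neg Z.r_neg1 Z.r_neg2)
    then show "?D x y \<in> Fil (p + q)" using r(1) by simp
  qed
  moreover have "te \<one>\<^bsub>C\<^esub> (s \<otimes>\<^bsub>Sh\<^esub> t) \<in> carrier Z"
    using tensor_power_closed[OF shuffle_tensor_power[OF assms]] by simp
  ultimately show ?thesis by (simp add: Z.smult_l_minus Z.minus_eq)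
qed

end

section \<open>Coordinates with respect to the monomials\<close>

text \<open>That an element is homogeneous only asserts that some degree exists; \<open>dg\<close>
  fixes a choice, so that monomials have a degree.\<close>

locale shuffle_basis = shuffle_context K V
  for K :: "('a, 'k) ring_scheme" and V :: "('a, 'v, 'y) module_scheme" +
  fixes B :: "('v list \<Rightarrow> 'a) set set" and dg :: "('v list \<Rightarrow> 'a) set \<Rightarrow> nat"
  assumes basis: "algebra_basis K (shuffle_algebra K V) B"
    and dg: "b \<in> B \<Longrightarrow> b \<in> tensor_power K V (dg b)"
begin

abbreviation "Mon \<equiv> {m. set_mset m \<subseteq> B}"
abbreviation "FM \<equiv> free_module K Mon"
abbreviation "Sh_monomial \<equiv> monomial Sh"
abbreviation "deg m \<equiv> sum_mset (image_mset dg m)"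

lemma B_closed: "b \<in> B \<Longrightarrow> b \<in> carrier T"
  by (rule tensor_power_closed[OF dg])

lemma mon_add: "\<lbrakk>b \<in> B; m \<in> Mon\<rbrakk> \<Longrightarrow> Sh_monomial (add_mset b m) = b \<otimes>\<^bsub>Sh\<^esub> Sh_monomial m"
  by (rule Sh.monomial_add_mset) (use B_closed in auto)

lemma mon_tensor_power: "m \<in> Mon \<Longrightarrow> Sh_monomial m \<in> tensor_power K V (deg m)"
proof (induction m)
  case empty
  show ?case using pure_in_tensor_power[OF Nil_W, of 0] by (simp add: Sh.monomial_empty)
next
  case (add b m)
  then show ?case
    using shuffle_tensor_power[OF dg[of b], of "Sh_monomial m" "deg m"] by (simp add: mon_add)
qed

lemma mon_closed: "m \<in> Mon \<Longrightarrow> Sh_monomial m \<in> carrier T"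
  by (rule tensor_power_closed[OF mon_tensor_power])

lemma FM_module: "module K FM"
  by (rule module_free_module[OF K.is_cring])

sublocale FM: module K FM by (rule FM_module)

lemma Sh_module: "module K Sh"
  by (rule Sh.module)

lemma ev_linear: "linear_map K FM T (lin_ext K Sh Sh_monomial)"
proof -
  have "linear_map K FM Sh (lin_ext K Sh Sh_monomial)"
    by (rule lin_ext_linear[OF Sh_module]) (use mon_closed in auto)
  then show ?thesis by (simp add: linear_map_def)
qed

lemma ev_surj: "t \<in> carrier T \<Longrightarrow> \<exists>p\<in>carrier FM. lin_ext K Sh Sh_monomial p = t"
  using basis by (auto simp: algebra_basis_def algebra_generators_def polynomials_def poly_eval_eq)

lemma ev_inj:
  assumes "p \<in> carrier FM" "q \<in> carrier FM" "lin_ext K Sh Sh_monomial p = lin_ext K Sh Sh_monomial q"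
  shows "p = q"
proof -
  have "lin_ext K Sh Sh_monomial (p \<ominus>\<^bsub>FM\<^esub> q) = \<zero>\<^bsub>T\<^esub>"
    using linear_mapD(1)[OF ev_linear assms(2)]
    by (simp add: linear_map_minus[OF FM_module T_module ev_linear assms(1,2)] assms(3) T.minus_eq T.r_neg)
  then have "p \<ominus>\<^bsub>FM\<^esub> q = \<zero>\<^bsub>FM\<^esub>"
    using basis FM.minus_closed[OF assms(1,2)]
    by (simp add: algebra_basis_def algebraically_independent_def polynomials_def poly_eval_eq)
  then show ?thesis using FM.minus_eq_zero_iff[OF assms(1,2)] by blast
qed

text \<open>The inverse of polynomial evaluation. A preimage exists because \<open>B\<close>
  generates, and it is unique because \<open>B\<close> is independent.\<close>

definition coords :: "('v list \<Rightarrow> 'a) set \<Rightarrow> ('v list \<Rightarrow> 'a) set multiset \<Rightarrow> 'a" where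
  "coords t = (SOME p. p \<in> carrier FM \<and> lin_ext K Sh Sh_monomial p = t)"

lemma coords:
  assumes "t \<in> carrier T"
  shows "coords t \<in> carrier FM" "lin_ext K Sh Sh_monomial (coords t) = t"
  using someI_ex[of "\<lambda>p. p \<in> carrier FM \<and> lin_ext K Sh Sh_monomial p = t"] ev_surj[OF assms]
  unfolding coords_def by blast+

lemma coords_eqI: "\<lbrakk>p \<in> carrier FM; lin_ext K Sh Sh_monomial p = t\<rbrakk> \<Longrightarrow> coords t = p"
  using ev_inj coords linear_mapD(1)[OF ev_linear] by metis

lemma coords_linear: "linear_map K T FM coords"
proof (rule linear_mapI)
  show "coords t \<in> carrier FM" if "t \<in> carrier T" for t by (rule coords(1)[OF that])
  show "coords (s \<oplus>\<^bsub>T\<^esub> t) = coords s \<oplus>\<^bsub>FM\<^esub> coords t" if "s \<in> carrier T" "t \<in> carrier T" for s t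
  proof (rule coords_eqI)
    show "coords s \<oplus>\<^bsub>FM\<^esub> coords t \<in> carrier FM" by (rule FM.a_closed[OF coords(1)[OF that(1)] coords(1)[OF that(2)]])
    show "lin_ext K Sh Sh_monomial (coords s \<oplus>\<^bsub>FM\<^esub> coords t) = s \<oplus>\<^bsub>T\<^esub> t"
      by (simp only: linear_mapD(2)[OF ev_linear coords(1)[OF that(1)] coords(1)[OF that(2)]] coords(2)[OF that(1)] coords(2)[OF that(2)])
  qed
  show "coords (c \<odot>\<^bsub>T\<^esub> t) = c \<odot>\<^bsub>FM\<^esub> coords t" if "c \<in> carrier K" "t \<in> carrier T" for c t
  proof (rule coords_eqI)
    show "c \<odot>\<^bsub>FM\<^esub> coords t \<in> carrier FM" by (rule FM.smult_closed[OF that(1) coords(1)[OF that(2)]])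
    show "lin_ext K Sh Sh_monomial (c \<odot>\<^bsub>FM\<^esub> coords t) = c \<odot>\<^bsub>T\<^esub> t"
      by (simp only: linear_mapD(3)[OF ev_linear that(1) coords(1)[OF that(2)]] coords(2)[OF that(2)])
  qed
qed

lemma coords_coeff_closed: "t \<in> carrier T \<Longrightarrow> coords t m \<in> carrier K"
  using coords(1) by (simp add: free_module_carrier)

lemma coords_mon: "m \<in> Mon \<Longrightarrow> coords (Sh_monomial m) = unit_vec K m"
proof (rule coords_eqI)
  assume m: "m \<in> Mon"
  show "unit_vec K m \<in> carrier FM" by (rule unit_vec_closed[OF K.is_cring m])
  show "lin_ext K Sh Sh_monomial (unit_vec K m) = Sh_monomial m"
    by (rule lin_ext_unit_vec[OF Sh_module _ m]) (use mon_closed in auto)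
qed

text \<open>Applying the projection to degree \<open>k\<close> to the expansion of a tensor of degree \<open>k\<close> removes
  the monomials of other degrees.\<close>

lemma coords_homogeneous:
  assumes t: "t \<in> tensor_power K V k" and "deg m \<noteq> k"
  shows "coords t m = \<zero>\<^bsub>K\<^esub>"
proof -
  have tT: "t \<in> carrier T" by (rule tensor_power_closed[OF t])
  note p = coords[OF tT]
  let ?A = "{m. coords t m \<noteq> \<zero>\<^bsub>K\<^esub>}"
  have A: "finite ?A" "?A \<subseteq> Mon" using p(1) by (auto simp: free_module_carrier)
  \<comment> \<open>The part of the expansion in degree \<open>k\<close>. It evaluates to
    \<open>proj k t\<close>, which is \<open>t\<close>.\<close>
  define q where "q m = (if deg m = k then coords t m else \<zero>\<^bsub>K\<^esub>)" for m
  have qA: "{m. q m \<noteq> \<zero>\<^bsub>K\<^esub>} \<subseteq> ?A" by (auto simp: q_def)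
  have q: "q \<in> carrier FM"
    using p(1) A qA finite_subset[OF qA] by (auto simp: free_module_carrier q_def)
  have cl: "coords t m \<in> carrier K" for m using p(1) by (simp add: free_module_carrier)
  have t1: "proj k t = t" using proj_tensor_power[OF t, of k] by simp
  have t2: "t = (\<Oplus>\<^bsub>T\<^esub>m\<in>?A. coords t m \<odot>\<^bsub>T\<^esub> Sh_monomial m)"
    using p(2) by (simp add: lin_ext_def finsum_def)
  have "proj k (\<Oplus>\<^bsub>T\<^esub>m\<in>?A. coords t m \<odot>\<^bsub>T\<^esub> Sh_monomial m) = (\<Oplus>\<^bsub>T\<^esub>m\<in>?A. proj k (coords t m \<odot>\<^bsub>T\<^esub> Sh_monomial m))"
    by (rule finsum_linear_map[OF T_module T_module proj_linear A(1)]) (use A mon_closed cl in auto)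
  also have "\<dots> = (\<Oplus>\<^bsub>T\<^esub>m\<in>?A. q m \<odot>\<^bsub>T\<^esub> Sh_monomial m)"
  proof (rule T.finsum_cong')
    fix m assume "m \<in> ?A"
    then have m: "m \<in> Mon" using A by auto
    have "proj k (coords t m \<odot>\<^bsub>T\<^esub> Sh_monomial m) = coords t m \<odot>\<^bsub>T\<^esub> proj k (Sh_monomial m)"
      by (rule linear_mapD(3)[OF proj_linear cl mon_closed[OF m]])
    also have "\<dots> = q m \<odot>\<^bsub>T\<^esub> Sh_monomial m"
      using proj_tensor_power[OF mon_tensor_power[OF m], of k] cl mon_closed[OF m] by (simp add: q_def)
    finally show "proj k (coords t m \<odot>\<^bsub>T\<^esub> Sh_monomial m) = q m \<odot>\<^bsub>T\<^esub> Sh_monomial m" .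
  next
    show "(\<lambda>m. q m \<odot>\<^bsub>T\<^esub> Sh_monomial m) \<in> ?A \<rightarrow> carrier T"
      using A mon_closed cl by (auto simp: q_def)
  qed simp
  also have "\<dots> = lin_ext K T Sh_monomial q"
    by (rule lin_ext_superset[OF T_module q _ A(1) qA A(2), symmetric]) (use mon_closed in auto)
  also have "\<dots> = lin_ext K Sh Sh_monomial q" by (simp add: lin_ext_def finsum_def)
  \<comment> \<open>As \<open>t\<close> has only one expansion, the truncated one is already
    complete.\<close>
  finally have "lin_ext K Sh Sh_monomial q = t" unfolding t2[symmetric] t1 by (rule sym)
  from coords_eqI[OF q this] have "coords t m = q m" by simp
  then show ?thesis using assms(2) by (simp add: q_def)
qed

text \<open>The coordinate at \<open>m\<close>, extended linearly over C2. Its values are placed in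
  \<open>C2 \<otimes> 1\<close> inside the algebra, so that C2 does not have to be identified with
  its image there.\<close>

definition CT_coord :: "('v list \<Rightarrow> 'a) set multiset \<Rightarrow> ('a, 'v) c2t \<Rightarrow> ('a, 'v) c2t" where
  "CT_coord m = pres_lift K Z (\<lambda>(c, t). coords t m \<odot>\<^bsub>Z\<^esub> te c (pure K V []))"

lemma one_T: "pure K V [] \<in> carrier T"
  by (rule pure_closed'[OF Nil_W])

lemma CT_coord_bilinear: "bilinear_map K C T Z (\<lambda>c t. coords t m \<odot>\<^bsub>Z\<^esub> te c (pure K V []))"
  unfolding bilinear_map_def
proof (intro conjI ballI)
  fix c assume c: "c \<in> carrier C"
  show "linear_map K T Z (\<lambda>t. coords t m \<odot>\<^bsub>Z\<^esub> te c (pure K V []))"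
    using c one_T linear_mapD[OF coords_linear] coords_coeff_closed
    by (intro linear_mapI) (simp_all add: Z.smult_l_distr Z.smult_assoc1)
next
  fix t assume "t \<in> carrier T"
  then show "linear_map K C Z (\<lambda>c. coords t m \<odot>\<^bsub>Z\<^esub> te c (pure K V []))"
    by (intro linear_map_smult[OF Z_module] te_linear1 one_T coords_coeff_closed)
qed

lemma CT_coord_linear: "linear_map K Z Z (CT_coord m)"
  unfolding CT_coord_def by (rule tensor_lift(1)[OF C.module T_module Z_module CT_coord_bilinear])

lemma CT_coord_te: "\<lbrakk>c \<in> carrier C; t \<in> carrier T\<rbrakk> \<Longrightarrow> CT_coord m (te c t) = coords t m \<odot>\<^bsub>Z\<^esub> te c (pure K V [])"
  unfolding CT_coord_def by (rule tensor_lift(2)[OF C.module T_module Z_module CT_coord_bilinear])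

text \<open>Linearity over \<open>C2 \<otimes> 1\<close>, the first step towards linearity over the
  ring of coefficients in \<open>I_coord_mult\<close>.\<close>

lemma CT_coord_mult:
  assumes "d \<in> carrier C" "z \<in> carrier Z"
  shows "CT_coord m (te d (pure K V []) \<otimes>\<^bsub>CT\<^esub> z) = te d (pure K V []) \<otimes>\<^bsub>CT\<^esub> CT_coord m z"
proof -
  have d: "te d (pure K V []) \<in> carrier Z" using assms(1) one_T by simp
  note lin = bilinear_mapD(1)[OF CT_bilinear d]
  show ?thesis
  proof (rule tensor_linear_eq[OF C.module T_module Z_module linear_map_compose[OF lin CT_coord_linear]
        linear_map_compose[OF CT_coord_linear lin] _ assms(2)])
    fix c t assume ct: "c \<in> carrier C" "t \<in> carrier T"
    show "CT_coord m (te d (pure K V []) \<otimes>\<^bsub>CT\<^esub> te c t) = te d (pure K V []) \<otimes>\<^bsub>CT\<^esub> CT_coord m (te c t)"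
      using ct assms(1) one_T coords_coeff_closed[OF ct(2)]
      by (simp add: CT_mult_Nil CT_coord_te linear_mapD(3)[OF lin])
  qed
qed

text \<open>A word shorter than \<open>deg m\<close> is homogeneous of another degree, so its
  expansion does not contain \<open>m\<close>.\<close>

lemma CT_coord_Fil:
  assumes "z \<in> Fil d" "d \<le> deg m"
  shows "CT_coord m z = \<zero>\<^bsub>Z\<^esub>"
proof (rule linear_map_eq_on_mspan[OF Z_module Z_module Fil_gens CT_coord_linear linear_map_const_zero[OF Z_module]
      _ assms(1)[unfolded Fil_def]])
  fix x assume "x \<in> {te c (pure K V w) |c w. c \<in> carrier C \<and> w \<in> W \<and> length w < d}"
  then obtain c w where x: "x = te c (pure K V w)" "c \<in> carrier C" "w \<in> W" "length w < d" by auto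
  have "coords (pure K V w) m = \<zero>\<^bsub>K\<^esub>"
    by (rule coords_homogeneous[OF pure_in_tensor_power[OF x(3) refl]]) (use x(4) assms(2) in auto)
  then show "CT_coord m x = \<zero>\<^bsub>Z\<^esub>"
    unfolding x(1) using x(2) one_T by (simp add: CT_coord_te[OF x(2) pure_closed'[OF x(3)]])
qed

section \<open>Monomials with respect to the twisted product\<close>

abbreviation "iota \<equiv> te \<one>\<^bsub>C\<^esub>"

text \<open>Taking the image of a multiset preserves multiplicities, so nothing is lost should
  \<open>iota\<close> identify elements of \<open>B\<close>.\<close>

definition CT_monomial :: "('v list \<Rightarrow> 'a) set multiset \<Rightarrow> ('a, 'v) c2t" where
  "CT_monomial m = monomial CT (image_mset iota m)"

lemma iota_closed: "b \<in> B \<Longrightarrow> iota b \<in> carrier Z"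
  using B_closed by simp

lemma CT_monomial_empty: "CT_monomial {#} = \<one>\<^bsub>CT\<^esub>"
  by (simp add: CT_monomial_def CT.monomial_empty)

lemma CT_monomial_add: "\<lbrakk>b \<in> B; m \<in> Mon\<rbrakk> \<Longrightarrow> CT_monomial (add_mset b m) = iota b \<otimes>\<^bsub>CT\<^esub> CT_monomial m"
  unfolding CT_monomial_def image_mset_add_mset
  by (rule CT.monomial_add_mset) (use iota_closed in auto)

lemma CT_monomial_closed: "m \<in> Mon \<Longrightarrow> CT_monomial m \<in> carrier Z"
  unfolding CT_monomial_def using CT.monomial_closed[of "image_mset iota m"] iota_closed by auto

text \<open>One half of the triangular comparison: the two kinds of monomials agree up to shorter
  tensors.\<close>

lemma CT_monomial_leading: "m \<in> Mon \<Longrightarrow> \<exists>r\<in>Fil (deg m). CT_monomial m = iota (Sh_monomial m) \<oplus>\<^bsub>Z\<^esub> r"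
proof (induction m)
  case empty
  show ?case
    using submodule_zero[OF Fil_submodule, of 0] one_T
    by (intro bexI[of _ "\<zero>\<^bsub>Z\<^esub>"]) (simp_all add: CT_monomial_empty Sh.monomial_empty)
next
  case (add b m)
  then have b: "b \<in> B" and m: "m \<in> Mon" by auto
  obtain r where r: "r \<in> Fil (deg m)" "CT_monomial m = iota (Sh_monomial m) \<oplus>\<^bsub>Z\<^esub> r" using add m by auto
  \<comment> \<open>The new remainder has two parts: \<open>?d\<close>, from replacing the twisted
    product by the shuffle product, and the old remainder \<open>r\<close> multiplied by
    \<open>iota b\<close>.\<close>
  let ?d = "iota b \<otimes>\<^bsub>CT\<^esub> iota (Sh_monomial m) \<ominus>\<^bsub>Z\<^esub> iota (b \<otimes>\<^bsub>Sh\<^esub> Sh_monomial m)"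
  have d: "?d \<in> Fil (dg b + deg m)" by (rule mult_leading[OF dg[OF b] mon_tensor_power[OF m]])
  have e: "iota b \<otimes>\<^bsub>CT\<^esub> r \<in> Fil (dg b + deg m)" by (rule mult_Fil[OF dg[OF b] r(1)])
  have cl: "iota b \<in> carrier Z" "iota (Sh_monomial m) \<in> carrier Z" "r \<in> carrier Z"
    "iota (b \<otimes>\<^bsub>Sh\<^esub> Sh_monomial m) \<in> carrier Z" "iota b \<otimes>\<^bsub>CT\<^esub> iota (Sh_monomial m) \<in> carrier Z" "iota b \<otimes>\<^bsub>CT\<^esub> r \<in> carrier Z"
    using iota_closed[OF b] mon_closed[OF m] Fil_closed[OF r(1)] Fil_closed[OF e]
      bilinear_map_closed[OF shuffle_bilinear B_closed[OF b] mon_closed[OF m]]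
      bilinear_map_closed[OF CT_bilinear, of "iota b" "iota (Sh_monomial m)"] by simp_all
  have "CT_monomial (add_mset b m) = iota b \<otimes>\<^bsub>CT\<^esub> (iota (Sh_monomial m) \<oplus>\<^bsub>Z\<^esub> r)"
    using CT_monomial_add[OF b m] r(2) by simp
  also have "\<dots> = iota b \<otimes>\<^bsub>CT\<^esub> iota (Sh_monomial m) \<oplus>\<^bsub>Z\<^esub> iota b \<otimes>\<^bsub>CT\<^esub> r"
    by (rule linear_mapD(2)[OF bilinear_mapD(1)[OF CT_bilinear cl(1)] cl(2,3)])
  also have "\<dots> = iota (Sh_monomial (add_mset b m)) \<oplus>\<^bsub>Z\<^esub> (?d \<oplus>\<^bsub>Z\<^esub> iota b \<otimes>\<^bsub>CT\<^esub> r)"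
    unfolding mon_add[OF b m] using cl(4-6) by (simp add: Z.minus_eq Z.a_ac Z.r_neg1 Z.r_neg2 Z.r_neg)
  finally show ?case using Z.submoduleE(5)[OF Fil_submodule d e] by auto
qed

text \<open>Unitriangularity: the remainder of the monomial \<open>m\<close> lies below
  \<open>deg m\<close>, hence below \<open>deg m'\<close>, and is invisible to the functional at
  \<open>m'\<close>. Only the shuffle monomial contributes, with its coordinate at
  \<open>m'\<close>.\<close>

lemma CT_coord_CT_monomial:
  assumes "m \<in> Mon" "m' \<in> Mon" "deg m \<le> deg m'"
  shows "CT_coord m' (CT_monomial m) = (if m = m' then \<one>\<^bsub>CT\<^esub> else \<zero>\<^bsub>Z\<^esub>)"
proof -
  obtain r where r: "r \<in> Fil (deg m)" "CT_monomial m = iota (Sh_monomial m) \<oplus>\<^bsub>Z\<^esub> r" using CT_monomial_leading[OF assms(1)] by auto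
  have "CT_coord m' (CT_monomial m) = CT_coord m' (iota (Sh_monomial m)) \<oplus>\<^bsub>Z\<^esub> CT_coord m' r"
    unfolding r(2)
    by (rule linear_mapD(2)[OF CT_coord_linear]) (use mon_closed[OF assms(1)] Fil_closed[OF r(1)] in auto)
  also have "CT_coord m' r = \<zero>\<^bsub>Z\<^esub>" by (rule CT_coord_Fil[OF r(1) assms(3)])
  also have "CT_coord m' (iota (Sh_monomial m)) = unit_vec K m m' \<odot>\<^bsub>Z\<^esub> \<one>\<^bsub>CT\<^esub>"
    by (simp add: CT_coord_te mon_closed[OF assms(1)] coords_mon[OF assms(1)] del: mem_Collect_eq)
  finally show ?thesis using one_T by (auto simp: unit_vec_def)
qed

text \<open>Inverts the triangular comparison by induction on the length of words. A pure tensor is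
  a combination of shuffle monomials of the same degree, and each of these differs from a twisted
  monomial by shorter tensors.\<close>

lemma CT_monomial_generate:
  assumes U: "submodule U K Z" and mult: "\<And>c z. \<lbrakk>c \<in> carrier C; z \<in> U\<rbrakk> \<Longrightarrow> te c (pure K V []) \<otimes>\<^bsub>CT\<^esub> z \<in> U"
    and CT_monomial: "\<And>m. m \<in> Mon \<Longrightarrow> CT_monomial m \<in> U"
  shows "carrier Z \<subseteq> U"
proof -
  have gen: "te c (pure K V w) \<in> U" if "c \<in> carrier C" "w \<in> W" for c w
    using that
  proof (induction "length w" arbitrary: c w rule: less_induct)
    case less
    let ?t = "pure K V w"
    have t: "?t \<in> carrier T" by (rule pure_closed'[OF less.prems(2)])
    note p = coords[OF t]
    \<comment> \<open>The induction hypothesis, for all coefficients and all shorter words, says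
      that every possible remainder lies in \<open>U\<close>.\<close>
    have Fil: "Fil (length w) \<subseteq> U"
      unfolding Fil_def by (rule mspan_minimal[OF U]) (use less.hyps in auto)
    let ?A = "{m. coords ?t m \<noteq> \<zero>\<^bsub>K\<^esub>}"
    have A: "finite ?A" "?A \<subseteq> Mon" using p(1) by (auto simp: free_module_carrier)
    have Sh_monomial: "iota (Sh_monomial m) \<in> U" if "m \<in> ?A" for m
    proof -
      have m: "m \<in> Mon" using A that by auto
      have "deg m = length w"
        using coords_homogeneous[OF pure_in_tensor_power[OF less.prems(2) refl], of m] that by auto
      then obtain r where r: "r \<in> Fil (length w)" "CT_monomial m = iota (Sh_monomial m) \<oplus>\<^bsub>Z\<^esub> r"
        using CT_monomial_leading[OF m] by auto
      have "iota (Sh_monomial m) = CT_monomial m \<oplus>\<^bsub>Z\<^esub> \<ominus>\<^bsub>Z\<^esub> r"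
        using mon_closed[OF m] Fil_closed[OF r(1)] unfolding r(2) by (simp add: Z.a_assoc Z.r_neg)
      moreover have "r \<in> U" using r(1) Fil by auto
      ultimately show ?thesis
        using Z.submoduleE(5)[OF U CT_monomial[OF m] Z.submoduleE(6)[OF U]] by simp
    qed
    have "iota ?t = (\<Oplus>\<^bsub>Z\<^esub>m\<in>?A. iota (coords ?t m \<odot>\<^bsub>T\<^esub> Sh_monomial m))"
    proof -
      have "?t = (\<Oplus>\<^bsub>T\<^esub>m\<in>?A. coords ?t m \<odot>\<^bsub>T\<^esub> Sh_monomial m)"
        using p(2) by (simp add: lin_ext_def finsum_def)
      then have "iota ?t = iota (\<Oplus>\<^bsub>T\<^esub>m\<in>?A. coords ?t m \<odot>\<^bsub>T\<^esub> Sh_monomial m)" by (rule arg_cong)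
      also have "\<dots> = (\<Oplus>\<^bsub>Z\<^esub>m\<in>?A. iota (coords ?t m \<odot>\<^bsub>T\<^esub> Sh_monomial m))"
        by (rule finsum_linear_map[OF T_module Z_module te_linear2[OF one_C] A(1)])
          (use A mon_closed coords_coeff_closed[OF t] in auto)
      finally show ?thesis .
    qed
    also have "\<dots> \<in> U"
    proof -
      have *: "iota (coords ?t m \<odot>\<^bsub>T\<^esub> Sh_monomial m) \<in> U" if "m \<in> ?A" for m
      proof -
        have "m \<in> Mon" using that A(2) by blast
        then have "iota (coords ?t m \<odot>\<^bsub>T\<^esub> Sh_monomial m) = coords ?t m \<odot>\<^bsub>Z\<^esub> iota (Sh_monomial m)"
          using mon_closed coords_coeff_closed[OF t] by (intro linear_mapD(3)[OF te_linear2[OF one_C]])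
        then show ?thesis using Z.submoduleE(4)[OF U coords_coeff_closed[OF t] Sh_monomial[OF that]] by simp
      qed
      have "(\<Oplus>\<^bsub>Z\<^esub>m\<in>X. iota (coords ?t m \<odot>\<^bsub>T\<^esub> Sh_monomial m)) \<in> U" if "finite X" "X \<subseteq> ?A" for X
        using that
      proof (induction X)
        case empty
        show ?case using submodule_zero[OF U] by simp
      next
        case (insert x X)
        have "iota (coords ?t m \<odot>\<^bsub>T\<^esub> Sh_monomial m) \<in> carrier Z" if "m \<in> insert x X" for m
          using * insert.prems that Z.submoduleE(1)[OF U] by blast
        then have "(\<Oplus>\<^bsub>Z\<^esub>m\<in>insert x X. iota (coords ?t m \<odot>\<^bsub>T\<^esub> Sh_monomial m))
            = iota (coords ?t x \<odot>\<^bsub>T\<^esub> Sh_monomial x) \<oplus>\<^bsub>Z\<^esub> (\<Oplus>\<^bsub>Z\<^esub>m\<in>X. iota (coords ?t m \<odot>\<^bsub>T\<^esub> Sh_monomial m))"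
          using insert.hyps by (intro Z.finsum_insert) auto
        then show ?case using Z.submoduleE(5)[OF U * insert.IH] insert.prems by simp
      qed
      from this[OF A(1) order_refl] show ?thesis .
    qed
    finally have 1: "iota ?t \<in> U" .
    \<comment> \<open>The coefficient is put back by multiplying with \<open>c \<otimes> 1\<close>,
      under which \<open>U\<close> is closed.\<close>
    have "te c ?t = te c (pure K V []) \<otimes>\<^bsub>CT\<^esub> iota ?t"
      using CT_mult_Nil[OF less.prems(1) one_C t] less.prems(1) by simp
    then show ?case using mult[OF less.prems(1) 1] by simp
  qed
  have sub: "pure K V ` W \<subseteq> carrier T" by (rule image_subsetI) (rule pure_closed')
  have "mspan K Z {te c t | c t. c \<in> carrier C \<and> t \<in> pure K V ` W} = carrier Z"
    using mspan_tensor_elts[OF C.module T_module order_refl _ sub mspan_pure[OF V_module]]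
      submodule_mspan(2,3)[OF C.module order_refl] by auto
  moreover have "mspan K Z {te c t | c t. c \<in> carrier C \<and> t \<in> pure K V ` W} \<subseteq> U"
    by (rule mspan_minimal[OF U]) (use gen in auto)
  ultimately show ?thesis by simp
qed

end

section \<open>Tensor products with \<open>C2 \<otimes> T\<close>\<close>

lemma self_algebra_simps [simp]:
  "carrier (self_algebra R) = carrier R" "mult (self_algebra R) = mult R" "one (self_algebra R) = one R"
  "zero (self_algebra R) = zero R" "add (self_algebra R) = add R" "smult (self_algebra R) = mult R"
  by (simp_all add: self_algebra_def)

lemma cring_self_algebra:
  assumes "cring R"
  shows "cring (self_algebra R)"
proof -
  interpret R: cring R by fact
  show ?thesis
  proof (rule cringI)
    show "abelian_group (self_algebra R)"
      by (rule abelian_groupI) (auto simp: R.a_ac intro: R.l_neg R.a_inv_closed)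
    show "Group.comm_monoid (self_algebra R)"
      by (rule comm_monoidI) (simp_all add: R.m_assoc, simp add: R.m_comm)
  qed (simp add: R.l_distr)
qed

lemma algebra_self_algebra:
  assumes "cring R" "S \<subseteq> carrier R" "cring (R\<lparr>carrier := S\<rparr>)"
  shows "algebra (R\<lparr>carrier := S\<rparr>) (self_algebra R)"
proof -
  interpret R: cring R by fact
  show ?thesis
    using assms(2)
    by (intro algebraI cring_self_algebra[OF assms(1)] assms(3))
      (auto simp: R.l_distr R.r_distr R.m_assoc subset_iff)
qed

text \<open>The factor \<open>R \<otimes> C1\<close> enters only as some commutative algebra
  \<open>A\<close>.\<close>

locale tensor_basis = shuffle_basis K V B dg
  for K :: "('a, 'k) ring_scheme" and V :: "('a, 'v, 'y) module_scheme" and B dg +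
  fixes A :: "('a, 'm, 'z) module_scheme"
  assumes A_algebra: "algebra K A"
begin

sublocale A: algebra K A by (rule A_algebra)

abbreviation "I \<equiv> tensor_algebra K A CT"
abbreviation "ti \<equiv> tensor_elt K A CT"

lemma I_algebra: "algebra K I"
  by (rule algebra_tensor_algebra[OF A_algebra CT_algebra])

sublocale I: algebra K I by (rule I_algebra)

lemmas I_simps [simp] = tensor_algebra_simps[OF A_algebra CT_algebra]

lemma ti_bilinear: "bilinear_map K A CT (tensor K A CT) ti"
  by (rule bilinear_tensor_elt[OF A.module CT.module])

lemma ti_closed [simp]: "\<lbrakk>x \<in> carrier A; z \<in> carrier Z\<rbrakk> \<Longrightarrow> ti x z \<in> carrier (tensor K A CT)"
  using bilinear_map_closed[OF ti_bilinear, of x z] by simp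

lemma ti_mult:
  "\<lbrakk>x \<in> carrier A; z \<in> carrier Z; x' \<in> carrier A; z' \<in> carrier Z\<rbrakk> \<Longrightarrow>
    ti x z \<otimes>\<^bsub>I\<^esub> ti x' z' = ti (x \<otimes>\<^bsub>A\<^esub> x') (z \<otimes>\<^bsub>CT\<^esub> z')"
  by (rule tensor_algebra_mult[OF A_algebra CT_algebra]) simp_all

abbreviation "A0_gens \<equiv> {ti x (te c (pure K V [])) | x c. x \<in> carrier A \<and> c \<in> carrier C}"

text \<open>The coefficient ring is a span inside the big algebra, as in \<open>IDR_coeffs\<close>.
  No comparison with an abstract tensor product of \<open>A\<close> and C2 is made.\<close>

definition A0 where "A0 = mspan K I A0_gens"

abbreviation "AR \<equiv> I\<lparr>carrier := A0\<rparr>"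
abbreviation "S \<equiv> self_algebra I"

lemma te1_closed: "c \<in> carrier C \<Longrightarrow> te c (pure K V []) \<in> carrier Z"
  using one_T by simp

lemma A0_gens_sub: "A0_gens \<subseteq> carrier I"
  using te1_closed by auto

lemma A0_submodule: "submodule A0 K I"
  unfolding A0_def by (rule submodule_mspan(1)[OF I.module A0_gens_sub])

lemma A0_sub: "A0 \<subseteq> carrier I"
  unfolding A0_def by (rule submodule_mspan(3)[OF I.module A0_gens_sub])

lemma A0_gen: "\<lbrakk>x \<in> carrier A; c \<in> carrier C\<rbrakk> \<Longrightarrow> ti x (te c (pure K V [])) \<in> A0"
  unfolding A0_def using submodule_mspan(2)[OF I.module A0_gens_sub] by blast

lemma te1_mult:
  "\<lbrakk>c \<in> carrier C; d \<in> carrier C\<rbrakk> \<Longrightarrow>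
    te c (pure K V []) \<otimes>\<^bsub>CT\<^esub> te d (pure K V []) = te (c \<otimes>\<^bsub>C\<^esub> d) (pure K V [])"
  by (rule CT_mult_Nil[OF _ _ one_T])

lemma A0_mult: "\<lbrakk>a \<in> A0; b \<in> A0\<rbrakk> \<Longrightarrow> a \<otimes>\<^bsub>I\<^esub> b \<in> A0"
proof (rule bilinear_map_image_mspan[OF I.module I.module I.module bilinear_mult[OF I_algebra] A0_gens_sub
      A0_gens_sub _ _ A0_submodule])
  fix x y assume "x \<in> A0_gens" "y \<in> A0_gens"
  then obtain a c b d where xy: "x = ti a (te c (pure K V []))" "y = ti b (te d (pure K V []))"
    "a \<in> carrier A" "c \<in> carrier C" "b \<in> carrier A" "d \<in> carrier C" by auto
  have "x \<otimes>\<^bsub>I\<^esub> y = ti (a \<otimes>\<^bsub>A\<^esub> b) (te (c \<otimes>\<^bsub>C\<^esub> d) (pure K V []))"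
    unfolding xy(1,2) using xy(3-6) te1_closed by (simp add: ti_mult te1_mult)
  also have "\<dots> \<in> A0" using xy(3-6) by (intro A0_gen) auto
  finally show "x \<otimes>\<^bsub>I\<^esub> y \<in> A0" .
qed (simp_all add: A0_def)

lemma A0_one: "\<one>\<^bsub>I\<^esub> \<in> A0"
  using A0_gen[OF A.one_closed one_C] by simp

lemma AR_cring: "cring AR"
proof (rule cringI)
  show "abelian_group AR"
    using submodule.submodule_is_module[OF A0_submodule I.module] by (simp add: module_def)
  show "Group.comm_monoid AR"
  proof (rule comm_monoidI)
    fix x y z assume "x \<in> carrier AR" "y \<in> carrier AR" "z \<in> carrier AR"
    then have c: "x \<in> carrier I" "y \<in> carrier I" "z \<in> carrier I" using A0_sub by auto
    show "x \<otimes>\<^bsub>AR\<^esub> y \<otimes>\<^bsub>AR\<^esub> z = x \<otimes>\<^bsub>AR\<^esub> (y \<otimes>\<^bsub>AR\<^esub> z)" using I.m_assoc[OF c] by simp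
    show "x \<otimes>\<^bsub>AR\<^esub> y = y \<otimes>\<^bsub>AR\<^esub> x" using I.m_comm[OF c(1,2)] by simp
    show "\<one>\<^bsub>AR\<^esub> \<otimes>\<^bsub>AR\<^esub> x = x" using I.l_one[OF c(1)] by simp
  qed (use A0_one A0_mult in \<open>simp_all del: I_simps\<close>)
qed (use A0_sub in \<open>auto simp: subset_iff I.l_distr simp del: I_simps\<close>)

lemma AR_algebra: "algebra AR S"
  by (rule algebra_self_algebra[OF I.M_cring A0_sub AR_cring])

sublocale AR: algebra AR S by (rule AR_algebra)

text \<open>The base change of \<open>CT_coord\<close> to \<open>A\<close>. Linear maps extend to
  tensor products over any ring, which is why functionals are used here instead of
  embeddings.\<close>

definition I_coord where
  "I_coord m = pres_lift K (tensor K A CT) (\<lambda>(x, z). ti x (CT_coord m z))"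

lemma CT_coord_linear_CT: "linear_map K CT CT (CT_coord m)"
  using CT_coord_linear[of m] by (simp add: linear_map_def)

lemma I_coord_bilinear: "bilinear_map K A CT (tensor K A CT) (\<lambda>x z. ti x (CT_coord m z))"
  by (rule bilinear_map_compose[OF ti_bilinear linear_map_id CT_coord_linear_CT])

lemma ZI_module: "module K (tensor K A CT)"
  by (rule module_tensor[OF A.module CT.module])

lemma I_coord_linear: "linear_map K (tensor K A CT) (tensor K A CT) (I_coord m)"
  unfolding I_coord_def by (rule tensor_lift(1)[OF A.module CT.module ZI_module I_coord_bilinear])

lemma I_coord_ti: "\<lbrakk>x \<in> carrier A; z \<in> carrier Z\<rbrakk> \<Longrightarrow> I_coord m (ti x z) = ti x (CT_coord m z)"
  unfolding I_coord_def by (rule tensor_lift(2)[OF A.module CT.module ZI_module I_coord_bilinear]) simp_all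

lemma I_mult_bilinear:
  "bilinear_map K (tensor K A CT) (tensor K A CT) (tensor K A CT) (mult I)"
  using bilinear_mult[OF I_algebra] by (simp add: bilinear_map_def linear_map_def)

text \<open>Linearity over the coefficient ring. Both sides are linear in \<open>a\<close> and in
  \<open>y\<close>, so \<open>a\<close> may be a generator of \<open>A0\<close> and \<open>y\<close>
  a pure tensor, where \<open>CT_coord_mult\<close> applies.\<close>

lemma I_coord_mult:
  assumes a: "a \<in> A0" and y: "y \<in> carrier I"
  shows "I_coord m (a \<otimes>\<^bsub>I\<^esub> y) = a \<otimes>\<^bsub>I\<^esub> I_coord m y"
proof -
  have y': "y \<in> carrier (tensor K A CT)" using y by simp
  have Ly: "I_coord m y \<in> carrier (tensor K A CT)" by (rule linear_mapD(1)[OF I_coord_linear y'])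
  have l1: "linear_map K I (tensor K A CT) (\<lambda>a. I_coord m (a \<otimes>\<^bsub>I\<^esub> y))"
    using linear_map_compose[OF bilinear_mapD(2)[OF I_mult_bilinear y'] I_coord_linear] by (simp add: linear_map_def)
  have l2: "linear_map K I (tensor K A CT) (\<lambda>a. a \<otimes>\<^bsub>I\<^esub> I_coord m y)"
    using bilinear_mapD(2)[OF I_mult_bilinear Ly] by (simp add: linear_map_def)
  show ?thesis
  proof (rule linear_map_eq_on_mspan[OF I.module ZI_module A0_gens_sub l1 l2 _ a[unfolded A0_def]])
    fix g assume "g \<in> A0_gens"
    then obtain x c where g: "g = ti x (te c (pure K V []))" "x \<in> carrier A" "c \<in> carrier C" by auto
    have gc: "g \<in> carrier (tensor K A CT)" unfolding g(1) using g(2,3) te1_closed by simp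
    note lin = bilinear_mapD(1)[OF I_mult_bilinear gc]
    show "I_coord m (g \<otimes>\<^bsub>I\<^esub> y) = g \<otimes>\<^bsub>I\<^esub> I_coord m y"
    proof (rule tensor_linear_eq[OF A.module CT.module ZI_module linear_map_compose[OF lin I_coord_linear]
          linear_map_compose[OF I_coord_linear lin] _ y'])
      fix x' z assume xz: "x' \<in> carrier A" "z \<in> carrier CT"
      have z: "z \<in> carrier Z" "CT_coord m z \<in> carrier Z" using xz(2) linear_mapD(1)[OF CT_coord_linear] by simp_all
      have tz: "te c (pure K V []) \<otimes>\<^bsub>CT\<^esub> z \<in> carrier Z"
        by (rule bilinear_map_closed[OF CT_bilinear te1_closed[OF g(3)] z(1)])
      show "I_coord m (g \<otimes>\<^bsub>I\<^esub> ti x' z) = g \<otimes>\<^bsub>I\<^esub> I_coord m (ti x' z)"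
        unfolding g(1) using xz z tz g(2,3) te1_closed[OF g(3)]
        by (simp add: ti_mult I_coord_ti CT_coord_mult)
    qed
  qed
qed

lemma I_coord_AR_linear: "linear_map AR S S (I_coord m)"
  by (rule linear_mapI) (use linear_mapD(1,2)[OF I_coord_linear] I_coord_mult in simp_all)

section \<open>Monomials in the images of the basis elements\<close>

definition kappa where "kappa b = ti \<one>\<^bsub>A\<^esub> (iota b)"

lemma kappa_closed: "b \<in> B \<Longrightarrow> kappa b \<in> carrier S"
  unfolding kappa_def using iota_closed by simp

lemma monomial_kappa:
  assumes "m \<in> Mon"
  shows "monomial S (image_mset kappa m) = ti \<one>\<^bsub>A\<^esub> (CT_monomial m)"
  using assms
proof (induction m)
  case empty
  show ?case by (simp add: AR.monomial_empty CT_monomial_empty)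
next
  case (add b m)
  then have b: "b \<in> B" and m: "m \<in> Mon" by auto
  have "monomial S (image_mset kappa (add_mset b m)) = kappa b \<otimes>\<^bsub>S\<^esub> monomial S (image_mset kappa m)"
    unfolding image_mset_add_mset
    by (rule AR.monomial_add_mset) (use b m kappa_closed in auto)
  also have "\<dots> = ti \<one>\<^bsub>A\<^esub> (iota b) \<otimes>\<^bsub>I\<^esub> ti \<one>\<^bsub>A\<^esub> (CT_monomial m)"
    by (simp only: self_algebra_simps kappa_def[of b] add.IH[OF m])
  also have "\<dots> = ti \<one>\<^bsub>A\<^esub> (CT_monomial (add_mset b m))"
    using iota_closed[OF b] CT_monomial_closed[OF m] by (simp add: ti_mult CT_monomial_add[OF b m])
  finally show ?case .
qed

lemma I_coord_monomial:
  assumes "m \<in> Mon" "m' \<in> Mon" "deg m \<le> deg m'"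
  shows "I_coord m' (monomial S (image_mset kappa m)) = (if m = m' then \<one>\<^bsub>S\<^esub> else \<zero>\<^bsub>S\<^esub>)"
proof -
  have "I_coord m' (monomial S (image_mset kappa m)) = ti \<one>\<^bsub>A\<^esub> (CT_coord m' (CT_monomial m))"
    using CT_monomial_closed[OF assms(1)] by (simp add: monomial_kappa[OF assms(1)] I_coord_ti)
  moreover have "ti \<one>\<^bsub>A\<^esub> \<zero>\<^bsub>Z\<^esub> = \<zero>\<^bsub>S\<^esub>"
    using linear_map_zero[OF CT.module ZI_module bilinear_mapD(1)[OF ti_bilinear A.one_closed]] by simp
  ultimately show ?thesis by (simp add: CT_coord_CT_monomial[OF assms])
qed

abbreviation "MonK \<equiv> {n. set_mset n \<subseteq> kappa ` B}"

lemma MonK_E: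
  assumes "n \<in> MonK"
  obtains m where "m \<in> Mon" "n = image_mset kappa m"
proof
  show "image_mset (inv_into B kappa) n \<in> Mon" using assms by (auto intro!: inv_into_into)
  show "n = image_mset kappa (image_mset (inv_into B kappa) n)"
    using assms by (auto simp: multiset.map_comp f_inv_into_f subset_iff intro!: multiset.map_ident_strong[symmetric])
qed

lemma monomial_closed: "n \<in> MonK \<Longrightarrow> monomial S n \<in> carrier S"
  using AR.monomial_closed[of n] kappa_closed by auto

abbreviation "FK \<equiv> free_module AR MonK"

lemma AR_module: "module AR S"
  by (rule AR.module)

lemma evK_linear: "linear_map AR FK S (lin_ext AR S (monomial S))"
  by (rule lin_ext_linear[OF AR_module]) (use monomial_closed in auto)

text \<open>The values \<open>?Q\<close> of polynomials form a submodule stable under the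
  coefficient ring. Its preimage in \<open>C2 \<otimes> T\<close> satisfies the hypotheses of
  \<open>CT_monomial_generate\<close> and is therefore everything.\<close>

lemma algebra_generators_kappa: "algebra_generators AR S (kappa ` B)"
proof -
  let ?Q = "lin_ext AR S (monomial S) ` carrier FK"
  have FK_module: "module AR FK" by (rule module_free_module[OF module_cring[OF AR_module]])
  interpret F: module AR FK by (rule FK_module)
  note ev = evK_linear
  have add: "x \<oplus>\<^bsub>I\<^esub> y \<in> ?Q" if "x \<in> ?Q" "y \<in> ?Q" for x y
  proof -
    obtain p q where p: "p \<in> carrier FK" "x = lin_ext AR S (monomial S) p"
      and q: "q \<in> carrier FK" "y = lin_ext AR S (monomial S) q" using \<open>x \<in> ?Q\<close> \<open>y \<in> ?Q\<close> by auto
    have "x \<oplus>\<^bsub>I\<^esub> y = lin_ext AR S (monomial S) (p \<oplus>\<^bsub>FK\<^esub> q)"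
      unfolding p(2) q(2) using linear_mapD(2)[OF ev p(1) q(1)] by simp
    then show ?thesis using F.a_closed[OF p(1) q(1)] by blast
  qed
  have mult: "a \<otimes>\<^bsub>I\<^esub> x \<in> ?Q" if "a \<in> A0" "x \<in> ?Q" for a x
  proof -
    obtain p where p: "p \<in> carrier FK" "x = lin_ext AR S (monomial S) p" using \<open>x \<in> ?Q\<close> by auto
    have a: "a \<in> carrier AR" using that by simp
    have "a \<otimes>\<^bsub>I\<^esub> x = lin_ext AR S (monomial S) (a \<odot>\<^bsub>FK\<^esub> p)"
      unfolding p(2) using linear_mapD(3)[OF ev a p(1)] by simp
    then show ?thesis using F.smult_closed[OF a p(1)] by blast
  qed
  have "\<zero>\<^bsub>I\<^esub> = lin_ext AR S (monomial S) \<zero>\<^bsub>FK\<^esub>"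
    using linear_map_zero[OF FK_module AR_module ev] by simp
  then have zero: "\<zero>\<^bsub>I\<^esub> \<in> ?Q"
    by (rule image_eqI[where f = "lin_ext AR S (monomial S)"]) (rule F.zero_closed)
  have sub: "?Q \<subseteq> carrier I" using linear_mapD(1)[OF ev] by auto
  have smult: "k \<odot>\<^bsub>I\<^esub> x \<in> ?Q" if "k \<in> carrier K" "x \<in> ?Q" for k x
  proof -
    have x: "x \<in> carrier I" using sub that(2) by auto
    \<comment> \<open>Scalars from \<open>K\<close> act through the coefficient ring, as multiples
      of its unit.\<close>
    have "k \<odot>\<^bsub>I\<^esub> x = (k \<odot>\<^bsub>I\<^esub> \<one>\<^bsub>I\<^esub>) \<otimes>\<^bsub>I\<^esub> x"
      using I.smult_assoc2[OF that(1) I.one_closed x] x by (simp del: I_simps)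
    moreover have "k \<odot>\<^bsub>I\<^esub> \<one>\<^bsub>I\<^esub> \<in> A0" by (rule I.submoduleE(4)[OF A0_submodule that(1) A0_one])
    ultimately show ?thesis using mult that(2) by simp
  qed
  have neg: "\<ominus>\<^bsub>I\<^esub> x \<in> ?Q" if "x \<in> ?Q" for x
  proof -
    have x: "x \<in> carrier I" using sub that by auto
    have "\<ominus>\<^bsub>I\<^esub> x = (\<ominus>\<^bsub>K\<^esub> \<one>\<^bsub>K\<^esub>) \<odot>\<^bsub>I\<^esub> x"
      using x by (simp add: I.smult_l_minus del: I_simps)
    then show ?thesis using smult[OF _ that] by simp
  qed
  have Qsub: "submodule ?Q K I"
    by (rule I.submoduleI[OF sub zero neg add smult])
  note tl = bilinear_mapD(1)[OF ti_bilinear A.one_closed]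
  \<comment> \<open>First the tensors with unit in the factor \<open>A\<close>; arbitrary elements
    of \<open>A\<close> are multiplied on afterwards.\<close>
  have "carrier Z \<subseteq> {z \<in> carrier Z. ti \<one>\<^bsub>A\<^esub> z \<in> ?Q}"
  proof (rule CT_monomial_generate)
    show "submodule {z \<in> carrier Z. ti \<one>\<^bsub>A\<^esub> z \<in> ?Q} K Z"
    proof (rule Z.submoduleI)
      show "\<zero>\<^bsub>Z\<^esub> \<in> {z \<in> carrier Z. ti \<one>\<^bsub>A\<^esub> z \<in> ?Q}"
        using linear_map_zero[OF CT.module ZI_module tl] zero by simp
      show z: "x \<oplus>\<^bsub>Z\<^esub> y \<in> {z \<in> carrier Z. ti \<one>\<^bsub>A\<^esub> z \<in> ?Q}"
        if "x \<in> {z \<in> carrier Z. ti \<one>\<^bsub>A\<^esub> z \<in> ?Q}" "y \<in> {z \<in> carrier Z. ti \<one>\<^bsub>A\<^esub> z \<in> ?Q}" for x y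
        using that linear_mapD(2)[OF tl, of x y] add[of "ti \<one>\<^bsub>A\<^esub> x" "ti \<one>\<^bsub>A\<^esub> y"] by simp
      show s: "k \<odot>\<^bsub>Z\<^esub> x \<in> {z \<in> carrier Z. ti \<one>\<^bsub>A\<^esub> z \<in> ?Q}"
        if "k \<in> carrier K" "x \<in> {z \<in> carrier Z. ti \<one>\<^bsub>A\<^esub> z \<in> ?Q}" for k x
        using that linear_mapD(3)[OF tl, of k x] smult[of k "ti \<one>\<^bsub>A\<^esub> x"] by simp
      show "\<ominus>\<^bsub>Z\<^esub> x \<in> {z \<in> carrier Z. ti \<one>\<^bsub>A\<^esub> z \<in> ?Q}"
        if x: "x \<in> {z \<in> carrier Z. ti \<one>\<^bsub>A\<^esub> z \<in> ?Q}" for x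
      proof -
        have "\<ominus>\<^bsub>Z\<^esub> x = (\<ominus>\<^bsub>K\<^esub> \<one>\<^bsub>K\<^esub>) \<odot>\<^bsub>Z\<^esub> x" using x by (simp add: Z.smult_l_minus)
        then show ?thesis using s[OF _ x, of "\<ominus>\<^bsub>K\<^esub> \<one>\<^bsub>K\<^esub>"] by simp
      qed
    qed auto
  next
    fix c z assume c: "c \<in> carrier C" and z: "z \<in> {z \<in> carrier Z. ti \<one>\<^bsub>A\<^esub> z \<in> ?Q}"
    have "ti \<one>\<^bsub>A\<^esub> (te c (pure K V []) \<otimes>\<^bsub>CT\<^esub> z) = ti \<one>\<^bsub>A\<^esub> (te c (pure K V [])) \<otimes>\<^bsub>I\<^esub> ti \<one>\<^bsub>A\<^esub> z"
      using z te1_closed[OF c] by (simp add: ti_mult)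
    also have "\<dots> \<in> ?Q" using z by (intro mult A0_gen c A.one_closed) simp
    finally show "te c (pure K V []) \<otimes>\<^bsub>CT\<^esub> z \<in> {z \<in> carrier Z. ti \<one>\<^bsub>A\<^esub> z \<in> ?Q}"
      using bilinear_map_closed[OF CT_bilinear te1_closed[OF c]] z by simp
  next
    fix m assume m: "m \<in> Mon"
    then have n: "image_mset kappa m \<in> MonK" by auto
    have "ti \<one>\<^bsub>A\<^esub> (CT_monomial m) = lin_ext AR S (monomial S) (unit_vec AR (image_mset kappa m))"
      unfolding monomial_kappa[OF m, symmetric]
      by (rule lin_ext_unit_vec[OF AR_module _ n, symmetric]) (use monomial_closed in auto)
    then have "ti \<one>\<^bsub>A\<^esub> (CT_monomial m) \<in> ?Q"
      by (rule image_eqI[where f = "lin_ext AR S (monomial S)"]) (rule unit_vec_closed[OF module_cring[OF AR_module] n])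
    then show "CT_monomial m \<in> {z \<in> carrier Z. ti \<one>\<^bsub>A\<^esub> z \<in> ?Q}"
      using CT_monomial_closed[OF m] by simp
  qed
  then have 1: "ti \<one>\<^bsub>A\<^esub> z \<in> ?Q" if "z \<in> carrier Z" for z using that by auto
  have 2: "ti x z \<in> ?Q" if "x \<in> carrier A" "z \<in> carrier Z" for x z
  proof -
    have one: "\<one>\<^bsub>CT\<^esub> \<in> carrier Z" using te1_closed[OF one_C] by simp
    \<comment> \<open>The factor from \<open>A\<close> is split off as the coefficient
      \<open>x \<otimes> 1\<close>.\<close>
    have "ti x z = ti x \<one>\<^bsub>CT\<^esub> \<otimes>\<^bsub>I\<^esub> ti \<one>\<^bsub>A\<^esub> z"
      using that one CT.l_one[of z] by (simp add: ti_mult del: CT_simps(5))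
    moreover have "ti x \<one>\<^bsub>CT\<^esub> \<in> A0" using A0_gen[OF that(1) one_C] by simp
    ultimately show ?thesis using mult[OF _ 1[OF that(2)]] by simp
  qed
  have "mspan K I {ti x z | x z. x \<in> carrier A \<and> z \<in> carrier CT} \<subseteq> ?Q"
    by (rule mspan_minimal[OF Qsub]) (use 2 in auto)
  moreover have "mspan K I {ti x z | x z. x \<in> carrier A \<and> z \<in> carrier CT} = carrier I"
  proof -
    have eq: "I = (tensor K A CT)\<lparr>mult := mult I, one := one I\<rparr>" by (simp add: tensor_algebra_def)
    show ?thesis
      by (subst eq, subst mult_one_update) (simp add: mspan_tensor_all[OF A.module CT.module, simplified])
  qed
  ultimately have "carrier S \<subseteq> ?Q" by simp
  then show ?thesis
    unfolding algebra_generators_def polynomials_def poly_eval_eq using kappa_closed by auto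
qed

text \<open>The functional at one of two distinct basis elements separates their images with values
  one and zero. In the zero ring these values coincide, whence the hypothesis.\<close>

lemma inj_kappa:
  assumes "\<one>\<^bsub>S\<^esub> \<noteq> \<zero>\<^bsub>S\<^esub>"
  shows "inj_on kappa B"
proof -
  \<comment> \<open>The functional must belong to the element of larger or equal degree, since it is
    controlled only on monomials of no larger degree.\<close>
  have *: "b = b'" if "b \<in> B" "b' \<in> B" "kappa b = kappa b'" "dg b \<le> dg b'" for b b'
  proof (rule ccontr)
    assume "b \<noteq> b'"
    then have "I_coord {#b'#} (monomial S {#kappa b#}) = \<zero>\<^bsub>S\<^esub>"
      using I_coord_monomial[of "{#b#}" "{#b'#}"] that by simp
    moreover have "I_coord {#b'#} (monomial S {#kappa b'#}) = \<one>\<^bsub>S\<^esub>"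
      using I_coord_monomial[of "{#b'#}" "{#b'#}"] that by simp
    ultimately show False using assms that(3) by simp
  qed
  show ?thesis
  proof (rule inj_onI)
    fix b b' assume "b \<in> B" "b' \<in> B" "kappa b = kappa b'"
    then show "b = b'" using *[of b b'] *[of b' b] by (cases "dg b \<le> dg b'") auto
  qed
qed

text \<open>If a polynomial vanishes, then the functional \<open>I_coord m\<close> of a monomial \<open>m\<close> of maximal degree in
  its support extracts its coefficient at \<open>m\<close>.\<close>

lemma algebraically_independent_kappa: "algebraically_independent AR S (kappa ` B)"
  unfolding algebraically_independent_def
proof (intro conjI ballI impI)
  show "kappa ` B \<subseteq> carrier S" using kappa_closed by auto
  fix p assume "p \<in> polynomials AR (kappa ` B)" and ev0: "poly_eval AR S p = \<zero>\<^bsub>S\<^esub>"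
  then have p: "p \<in> carrier FK" by (simp add: polynomials_def)
  have pA: "p n \<in> A0" for n using p by (simp add: free_module_carrier)
  have pI: "p n \<in> carrier S" for n using pA A0_sub by auto
  show "p = (\<lambda>n. \<zero>\<^bsub>AR\<^esub>)"
  proof (rule ccontr)
    assume ne: "p \<noteq> (\<lambda>n. \<zero>\<^bsub>AR\<^esub>)"
    \<comment> \<open>In the zero ring all coefficients would vanish. The ring is thus nonzero, and
      \<open>kappa\<close> is injective.\<close>
    have nontriv: "\<one>\<^bsub>S\<^esub> \<noteq> \<zero>\<^bsub>S\<^esub>"
    proof
      assume "\<one>\<^bsub>S\<^esub> = \<zero>\<^bsub>S\<^esub>"
      then have "p n = \<zero>\<^bsub>S\<^esub>" for n
        using AR.l_one[OF pI[of n]] AR.l_null[OF pI[of n]] by simp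
      then show False using ne by auto
    qed
    let ?A = "{n. p n \<noteq> \<zero>\<^bsub>AR\<^esub>}"
    have A: "finite ?A" "?A \<subseteq> MonK" "?A \<noteq> {}" using p ne by (auto simp: free_module_carrier)
    \<comment> \<open>The functionals are indexed by monomials over \<open>B\<close>, whereas
      \<open>p\<close> has monomials over the images. Injectivity of \<open>kappa\<close> makes the
      two correspond on the support.\<close>
    define pull where "pull n = image_mset (inv_into B kappa) n" for n
    have pull: "pull n \<in> Mon" "image_mset kappa (pull n) = n" if n: "n \<in> ?A" for n
    proof -
      obtain m where m: "m \<in> Mon" "n = image_mset kappa m"
        by (rule MonK_E[OF subsetD[OF A(2) n]])
      have "(inv_into B kappa \<circ> kappa) b = b" if "b \<in> set_mset m" for b
        using m(1) that inv_into_f_f[OF inj_kappa[OF nontriv], of b] by auto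
      then have "pull n = m"
        unfolding pull_def m(2) multiset.map_comp by (rule multiset.map_ident_strong)
      then show "pull n \<in> Mon" "image_mset kappa (pull n) = n" using m by auto
    qed
    \<comment> \<open>With \<open>k\<close> of maximal degree, \<open>I_coord_monomial\<close>
      covers every monomial of the support.\<close>
    have "Max ((\<lambda>n. deg (pull n)) ` ?A) \<in> (\<lambda>n. deg (pull n)) ` ?A" using A by (intro Max_in) auto
    then obtain k where k: "Max ((\<lambda>n. deg (pull n)) ` ?A) = deg (pull k)" "k \<in> ?A"
      by (rule imageE)
    have le: "deg (pull n) \<le> deg (pull k)" if "n \<in> ?A" for n
      unfolding k(1)[symmetric] using A(1) that by (intro Max_ge) auto
    let ?f = "\<lambda>n. p n \<odot>\<^bsub>S\<^esub> monomial S n"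
    have fc: "?f n \<in> carrier S" if "n \<in> ?A" for n
      using pI A(2) that monomial_closed by (simp only: self_algebra_simps) (intro I.m_closed, auto)
    have "\<zero>\<^bsub>S\<^esub> = I_coord (pull k) (\<Oplus>\<^bsub>S\<^esub>n\<in>?A. ?f n)"
      using ev0 linear_map_zero[OF AR_module AR_module I_coord_AR_linear] by (simp add: poly_eval_eq lin_ext_def)
    also have "\<dots> = (\<Oplus>\<^bsub>S\<^esub>n\<in>?A. I_coord (pull k) (?f n))"
      by (rule finsum_linear_map[OF AR_module AR_module I_coord_AR_linear A(1)]) (use fc in auto)
    also have "\<dots> = (\<Oplus>\<^bsub>S\<^esub>n\<in>?A. if k = n then p n else \<zero>\<^bsub>S\<^esub>)"
    proof (rule AR.finsum_cong')
      fix n assume n: "n \<in> ?A"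
      have mc: "monomial S n \<in> carrier S" using A(2) n monomial_closed by auto
      have "I_coord (pull k) (?f n) = p n \<odot>\<^bsub>S\<^esub> I_coord (pull k) (monomial S n)"
        by (rule linear_mapD(3)[OF I_coord_AR_linear _ mc]) (use pA in simp)
      also have "I_coord (pull k) (monomial S n) = (if pull n = pull k then \<one>\<^bsub>S\<^esub> else \<zero>\<^bsub>S\<^esub>)"
        using I_coord_monomial[OF pull(1)[OF n] pull(1)[OF k(2)] le[OF n]] unfolding pull(2)[OF n] .
      also have "pull n = pull k \<longleftrightarrow> k = n" using pull(2)[OF n] pull(2)[OF k(2)] by metis
      finally show "I_coord (pull k) (?f n) = (if k = n then p n else \<zero>\<^bsub>S\<^esub>)"
        using pI[of n] AR.r_one[OF pI[of n]] AR.r_null[OF pI[of n]] by simp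
    next
      show "(\<lambda>n. if k = n then p n else \<zero>\<^bsub>S\<^esub>) \<in> ?A \<rightarrow> carrier S"
        by (rule funcsetI) (simp only: pI AR.zero_closed split: if_split, simp)
    qed simp
    also have "\<dots> = p k"
      by (rule AR.finsum_singleton[OF k(2) A(1)]) (rule funcsetI, rule pI)
    finally show False using k(2) by simp
  qed
qed

theorem algebra_basis_kappa: "algebra_basis AR S (kappa ` B)"
  unfolding algebra_basis_def
  using AR_algebra algebra_generators_kappa algebraically_independent_kappa by blast

end

section \<open>The integro-differential ring\<close>

context differential_ring
begin

abbreviation "KK \<equiv> constants R der"

lemma constants_simps [simp]:
  "mult KK = mult R" "one KK = one R" "zero KK = zero R" "add KK = add R"
  "carrier KK = {c \<in> carrier R. der c = \<zero>}"
  by (simp_all add: constants_def)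

text \<open>The ring laws of the constants are a hypothesis here; the theorem obtains them from
  \<open>algebra_basis\<close>.\<close>

lemma algebra_self_constants:
  assumes "cring KK"
  shows "algebra KK (self_algebra R)"
  using algebra_self_algebra[OF is_cring _ assms[unfolded constants_def]]
  by (auto simp: constants_def)

end

context quasi_integration
begin

lemma module_self_constants: "cring KK \<Longrightarrow> module KK (self_algebra R)"
  using algebra_self_constants algebra.module by blast

lemma Q_zero: "Q \<zero> = \<zero>"
proof -
  have "Q \<zero> \<oplus> Q \<zero> = Q \<zero>" using Q_add[of \<zero> \<zero>] by simp
  then show ?thesis using Q_closed[of \<zero>] by (simp add: add.r_cancel_one)
qed

lemma Q_minus: "x \<in> carrier R \<Longrightarrow> Q (\<ominus> x) = \<ominus> Q x"
proof -
  assume x: "x \<in> carrier R"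
  have "Q (\<ominus> x) \<oplus> Q x = \<zero>" using Q_add[of "\<ominus> x" x] x by (simp add: l_neg Q_zero)
  then show ?thesis using x Q_closed by (simp add: minus_equality)
qed

text \<open>Negation is not a field of the record but is derived from addition, so it has to be
  compared between the two records.\<close>

lemma minus_self_algebra: "x \<in> carrier R \<Longrightarrow> \<ominus>\<^bsub>self_algebra R\<^esub> x = \<ominus> x"
proof -
  assume x: "x \<in> carrier R"
  interpret S: cring "self_algebra R" by (rule cring_self_algebra[OF is_cring])
  show ?thesis using x S.minus_equality[of "\<ominus> x" x] by (simp add: l_neg)
qed

lemma R_T_module:
  assumes "cring KK"
  shows "module KK (R_T R Q)"
proof -
  interpret M: module KK "self_algebra R" by (rule module_self_constants[OF assms])
  have "submodule {x \<in> carrier R. Q x = \<zero>} KK (self_algebra R)"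
    by (rule M.submoduleI) (auto simp: Q_zero Q_add Q_minus Q_scale minus_self_algebra)
  from submodule.submodule_is_module[OF this M.module_axioms] show ?thesis
    by (simp add: R_T_def)
qed

lemma R_J_module:
  assumes "cring KK"
  shows "module KK (R_J R Q)"
proof -
  interpret M: module KK "self_algebra R" by (rule module_self_constants[OF assms])
  have "submodule (Q ` carrier R) KK (self_algebra R)"
  proof (rule M.submoduleI)
    show "\<zero>\<^bsub>self_algebra R\<^esub> \<in> Q ` carrier R" using Q_zero by (metis imageI self_algebra_simps(4) zero_closed)
    show "\<ominus>\<^bsub>self_algebra R\<^esub> a \<in> Q ` carrier R" if a: "a \<in> Q ` carrier R" for a
    proof -
      obtain x where x: "x \<in> carrier R" "a = Q x" using a by auto
      then have "\<ominus>\<^bsub>self_algebra R\<^esub> a = Q (\<ominus> x)" by (simp add: minus_self_algebra Q_closed Q_minus)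
      then show ?thesis using x by auto
    qed
    show "a \<oplus>\<^bsub>self_algebra R\<^esub> b \<in> Q ` carrier R" if "a \<in> Q ` carrier R" "b \<in> Q ` carrier R" for a b
      using that by (auto simp: Q_add[symmetric])
    show "c \<odot>\<^bsub>self_algebra R\<^esub> a \<in> Q ` carrier R" if c: "c \<in> carrier KK" and a: "a \<in> Q ` carrier R" for c a
    proof -
      obtain x where x: "x \<in> carrier R" "a = Q x" using a by auto
      then have "c \<odot>\<^bsub>self_algebra R\<^esub> a = Q (c \<otimes> x)" using Q_scale[OF c] by simp
      then show ?thesis using x c by auto
    qed
  qed (auto simp: Q_closed)
  from submodule.submodule_is_module[OF this M.module_axioms] show ?thesis
    by (simp add: R_J_def)
qed

end

theorem corollary29:
  fixes R :: "('a, 'r) ring_scheme" and der Q :: "'a \<Rightarrow> 'a"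
    and B :: "('a list \<Rightarrow> 'a) set set"
  assumes "quasi_integration R der Q"
    and "algebra_basis (constants R der) (shuffle_algebra (constants R der) (R_T R Q)) B"
    and "\<forall>b\<in>B. homogeneous (constants R der) (R_T R Q) b"
  shows "algebra_basis (IDR_coeffs R der Q) (self_algebra (IDR R der Q))
    {IDR_elt R der Q \<one>\<^bsub>R\<^esub> \<one>\<^bsub>C1 (constants R der) (R_J R Q) (R_T R Q)\<^esub>
       \<one>\<^bsub>C2 (constants R der) (R_T R Q)\<^esub> b | b. b \<in> B}"
proof -
  let ?K = "constants R der" and ?V = "R_T R Q" and ?J = "R_J R Q"
  let ?C1 = "C1 ?K ?J ?V" and ?A = "RC1 R der Q"
  interpret QI: quasi_integration R der Q by fact
  \<comment> \<open>A basis in the sense of \<open>algebra_basis\<close> includes the algebra laws,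
    here associativity of shuffles and the ring laws of the constants.\<close>
  have sh: "algebra ?K (shuffle_algebra ?K ?V)" using assms(2) by (simp add: algebra_basis_def)
  have K: "cring ?K" by (rule algebra.R_cring[OF sh])
  have V: "module ?K ?V" by (rule QI.R_T_module[OF K])
  have J: "module ?K ?J" by (rule QI.R_J_module[OF K])
  have R: "algebra ?K (self_algebra R)" by (rule QI.algebra_self_constants[OF K])
  have C1: "algebra ?K ?C1"
    unfolding C1_def by (intro algebra_sym_algebra module_tensor J module_tensors V)
  have RC1: "?A = tensor_algebra ?K (self_algebra R) ?C1" by (simp add: RC1_def Let_def)
  have A: "algebra ?K ?A" unfolding RC1 by (rule algebra_tensor_algebra[OF R C1])
  \<comment> \<open>Some degree is chosen for each homogeneous basis element.\<close>
  define dg where "dg b = (SOME n. b \<in> tensor_power ?K ?V n)" for b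
  have dg: "b \<in> tensor_power ?K ?V (dg b)" if "b \<in> B" for b
  proof -
    have "\<exists>n. b \<in> tensor_power ?K ?V n" using assms(3) that by (simp add: homogeneous_def)
    then show ?thesis unfolding dg_def by (rule someI_ex)
  qed
  interpret TB: tensor_basis ?K ?V B dg ?A
    by (intro tensor_basis.intro shuffle_basis.intro shuffle_context.intro shuffle_basis_axioms.intro
        tensor_basis_axioms.intro V sh assms(2) dg A)
  interpret C1: algebra ?K ?C1 by (rule C1)
  let ?r = "tensor_elt ?K (self_algebra R) ?C1"
  let ?te = "tensor_elt ?K (C2 ?K ?V) (tensors ?K ?V)"
  let ?ti = "tensor_elt ?K ?A (C2T ?K ?V)"
  let ?one = "pure ?K ?V []"
  have elt: "IDR_elt R der Q r c1 c2 t = ?ti (?r r c1) (?te c2 t)" for r c1 c2 t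
    by (simp add: IDR_elt_def Let_def)
  have I: "IDR R der Q = TB.I" by (simp add: IDR_def Let_def)
  let ?G = "{IDR_elt R der Q r c1 c2 (c \<odot>\<^bsub>tensors ?K ?V\<^esub> ?one) | r c1 c2 c.
           r \<in> carrier R \<and> c1 \<in> carrier ?C1 \<and> c2 \<in> carrier (C2 ?K ?V) \<and> c \<in> carrier ?K}"
  note r_bil = bilinear_tensor_elt[OF algebra.module[OF R] C1.module]
  have rc: "?r r c1 \<in> carrier ?A" if "r \<in> carrier R" "c1 \<in> carrier ?C1" for r c1
    using bilinear_map_closed[OF r_bil, of r c1] that unfolding RC1 tensor_algebra_simps[OF R C1] by simp
  \<comment> \<open>Scalars move across the tensor sign: the factor \<open>c\<close> of the empty
    tensor is absorbed by \<open>c2\<close>.\<close>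
  have sub1: "?G \<subseteq> TB.A0_gens"
  proof
    fix x assume "x \<in> ?G"
    then obtain r c1 c2 c where x: "x = ?ti (?r r c1) (?te c2 (c \<odot>\<^bsub>tensors ?K ?V\<^esub> ?one))"
      "r \<in> carrier R" "c1 \<in> carrier ?C1" "c2 \<in> carrier (C2 ?K ?V)" "c \<in> carrier ?K"
      unfolding elt by blast
    have "?te c2 (c \<odot>\<^bsub>tensors ?K ?V\<^esub> ?one) = ?te (c \<odot>\<^bsub>C2 ?K ?V\<^esub> c2) ?one"
      using linear_mapD(3)[OF TB.te_linear2[OF x(4)] x(5) TB.one_T]
        linear_mapD(3)[OF TB.te_linear1[OF TB.one_T] x(5,4)] by simp
    moreover have "c \<odot>\<^bsub>C2 ?K ?V\<^esub> c2 \<in> carrier (C2 ?K ?V)" using x(4,5) by (rule TB.C.smult_closed[rotated])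
    ultimately show "x \<in> TB.A0_gens" using x(1) rc[OF x(2,3)] by auto
  qed
  have G: "?G \<subseteq> carrier TB.I" using sub1 TB.A0_gens_sub by (rule subset_trans)
  note sm = submodule_mspan[OF TB.I.module G]
  \<comment> \<open>Conversely, an element of \<open>R \<otimes> C1\<close> is a combination of pure
    tensors, and for these the scalar one in front of the empty tensor gives a generator of the
    statement.\<close>
  have sub2: "TB.A0_gens \<subseteq> mspan ?K TB.I ?G"
  proof
    fix x assume "x \<in> TB.A0_gens"
    then obtain a c where x: "x = ?ti a (?te c ?one)" "a \<in> carrier ?A" "c \<in> carrier (C2 ?K ?V)" by auto
    have z: "?te c ?one \<in> carrier (C2T ?K ?V)" using TB.te1_closed[OF x(3)] by simp
    \<comment> \<open>\<open>RC1\<close> and \<open>TB.I\<close> carry a product on top of a tensor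
      product of modules; the linear map is moved between the records that share the additive
      structure.\<close>
    have lin: "linear_map ?K (tensor ?K (self_algebra R) ?C1) TB.I (\<lambda>a. ?ti a (?te c ?one))"
      by (rule linear_map_change[OF bilinear_mapD(2)[OF TB.ti_bilinear z]])
        (simp_all only: TB.I_simps, simp_all only: RC1 tensor_algebra_simps[OF R C1])
    have "?ti a (?te c ?one) \<in> mspan ?K TB.I ?G"
    proof (rule linear_map_image_mspan[OF module_tensor[OF algebra.module[OF R] C1.module] TB.I.module lin _ _ sm(1)])
      let ?S = "{?r x y | x y. x \<in> carrier (self_algebra R) \<and> y \<in> carrier ?C1}"
      show "?S \<subseteq> carrier (tensor ?K (self_algebra R) ?C1)"
        using bilinear_map_closed[OF r_bil] by auto
      show "a \<in> mspan ?K (tensor ?K (self_algebra R) ?C1) ?S"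
        using x(2) unfolding mspan_tensor_all[OF algebra.module[OF R] C1.module] RC1 tensor_algebra_simps[OF R C1] .
      fix s assume "s \<in> ?S"
      then obtain r c1 where s: "s = ?r r c1" "r \<in> carrier R" "c1 \<in> carrier ?C1" by auto
      have "?ti s (?te c ?one) = IDR_elt R der Q r c1 c (\<one>\<^bsub>?K\<^esub> \<odot>\<^bsub>tensors ?K ?V\<^esub> ?one)"
        unfolding elt s(1) TB.T.smult_one[OF TB.one_T] ..
      moreover have "\<dots> \<in> ?G" using s(2,3) x(3) TB.K.one_closed by blast
      ultimately have "?ti s (?te c ?one) \<in> ?G" by simp
      then show "?ti s (?te c ?one) \<in> mspan ?K TB.I ?G" using sm(2) by blast
    qed
    then show "x \<in> mspan ?K TB.I ?G" unfolding x(1) .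
  qed
  have "mspan ?K TB.I ?G = TB.A0"
  proof
    show "mspan ?K TB.I ?G \<subseteq> TB.A0"
      by (rule mspan_minimal[OF TB.A0_submodule])
        (use sub1 submodule_mspan(2)[OF TB.I.module TB.A0_gens_sub] in \<open>auto simp only: TB.A0_def intro: subset_trans\<close>)
    show "TB.A0 \<subseteq> mspan ?K TB.I ?G"
      unfolding TB.A0_def by (rule mspan_minimal[OF sm(1) sub2])
  qed
  then have coeffs: "IDR_coeffs R der Q = TB.AR"
    unfolding IDR_coeffs_def Let_def I by simp
  have "{IDR_elt R der Q \<one>\<^bsub>R\<^esub> \<one>\<^bsub>?C1\<^esub> \<one>\<^bsub>C2 ?K ?V\<^esub> b | b. b \<in> B} = TB.kappa ` B"
  proof -
    have "\<one>\<^bsub>?A\<^esub> = ?r \<one>\<^bsub>R\<^esub> \<one>\<^bsub>?C1\<^esub>"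
      unfolding RC1 tensor_algebra_simps[OF R C1] self_algebra_simps ..
    then have "IDR_elt R der Q \<one>\<^bsub>R\<^esub> \<one>\<^bsub>?C1\<^esub> \<one>\<^bsub>C2 ?K ?V\<^esub> b = TB.kappa b" for b
      unfolding elt TB.kappa_def by simp
    then show ?thesis by auto
  qed
  then show ?thesis
    unfolding coeffs I using TB.algebra_basis_kappa by simp
qed

end
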